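(* Let $\beta=\{\beta_k\}_{k\ge0}$ be non-negative reals with $\beta_0=\beta_1=0<\beta_2$, let $\beta(x)=\sum_{k\ge2}\beta_kx^k$, assume $\beta'(1)<\infty$, let $g=\inf\{x\in[0,1):\beta'(x)+\log(1-x)<0\}$, and assume $\beta'(x)+\log(1-x)>0$ for all $x\in(0,g)$. For each $N$ let $\Lambda$ be a Poisson($\beta$) random hypergraph on $V=\{1,\dots,N\}$, and fix a vertex $v_0$. Let $T^N$ be the number of vertices in the domain of $v_0$, $Z^N$ the number of hyperedges identifiable from $v_0$, $\bar T^N=N^{-1}T^N$, $\bar Z^N=N^{-1}Z^N$. Let $\{\xi_n\}_{n\ge0}$ be a random walk on $\mathbb Z$ with $\xi_0=1$ and i.i.d. increments distributed as $-1+\mathrm{Poisson}(2\beta_2)$, and $M=\inf\{n\ge0:\xi_n=0\}\in\mathbb N\cup\{\infty\}$. Set $\bar T=g\,\mathbf 1_{\{M=\infty\}}$ and $\bar Z=[\beta(g)-(1-g)\log(1-g)]\mathbf 1_{\{M=\infty\}}$. Then, as $N\to\infty$, $(T^N,Z^N)\to(M,M)$ in distribution (with $M$ taking values in the one-point compactification $\mathbb N\cup\{\infty\}$) and $(\bar T^N,\bar Z^N)\to(\bar T,\bar Z)$ in distribution.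
   Context: A hypergraph on $V$ is a map $\Lambda:2^V\to\{0,1,2,\dots\}$ ($\Lambda(A)$ = number of hyperedges equal to $A$). A Poisson($\beta$) random hypergraph on $V=\{1,\dots,N\}$: the $\Lambda(A)$, $A\subset V$, are independent Poisson with mean $N\beta_{|A|}/\binom{N}{|A|}$. For $S\subset V$, $\Lambda^S(A)=\sum_{B\supset A,\,B\setminus S=A}\Lambda(B)$. Hypergraph collapse: while some vertex $v$ has $\Lambda(\{v\})\ge1$, choose one, replace $V$ by $V\setminus\{v\}$ and $\Lambda$ by $\Lambda^{\{v\}}$; removed vertices are identifiable and a hyperedge is identifiable if all its vertices are. For patch-free $\Lambda$, a vertex is in the domain of $v_0$ if it is identifiable in $\Lambda+\mathbf 1_{\{v_0\}}$ (one extra hyperedge $\{v_0\}$ added), and a hyperedge is identifiable from $v_0$ if it is identifiable in $\Lambda+\mathbf 1_{\{v_0\}}$. *)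

theory Defs
  imports "HOL-Probability.Probability"
begin

text \<open>The library's poisson_pmf needs a strictly positive rate; Poisson(0) is the
  point mass at 0.\<close>
definition poisson0_pmf :: "real \<Rightarrow> nat pmf" where
  "poisson0_pmf r = (if r > 0 then poisson_pmf r else return_pmf 0)"

text \<open>A hypergraph on a finite vertex set V is a map Lam :: nat set => nat
  (Lam A = number of hyperedges equal to A), supported on subsets of V.\<close>

definition hg_restrict :: "nat set \<Rightarrow> (nat set \<Rightarrow> nat) \<Rightarrow> nat set \<Rightarrow> (nat set \<Rightarrow> nat)" where
  "hg_restrict V Lam S = (\<lambda>A. \<Sum>B\<in>{B. B \<subseteq> V \<and> B - S = A}. Lam B)"

definition collapse_step :: "nat set \<times> (nat set \<Rightarrow> nat) \<Rightarrow> nat set \<times> (nat set \<Rightarrow> nat)" where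
  "collapse_step = (\<lambda>(V, Lam).
     if \<exists>v\<in>V. 1 \<le> Lam {v}
     then (let v = (LEAST v. v \<in> V \<and> 1 \<le> Lam {v})
           in (V - {v}, hg_restrict V Lam {v}))
     else (V, Lam))"

text \<open>Since each effective step removes a vertex, card V steps run the collapse to
  completion. The identifiable vertices are the removed ones.\<close>
definition identifiable_vertices :: "nat set \<Rightarrow> (nat set \<Rightarrow> nat) \<Rightarrow> nat set" where
  "identifiable_vertices V Lam = V - fst ((collapse_step ^^ card V) (V, Lam))"

definition identifiable_hyperedges :: "nat set \<Rightarrow> (nat set \<Rightarrow> nat) \<Rightarrow> nat" where
  "identifiable_hyperedges V Lam = (\<Sum>A\<in>Pow (identifiable_vertices V Lam). Lam A)"

definition add_patch :: "(nat set \<Rightarrow> nat) \<Rightarrow> nat \<Rightarrow> (nat set \<Rightarrow> nat)" where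
  "add_patch Lam v0 = Lam({v0} := Lam {v0} + 1)"

definition domain_of :: "nat set \<Rightarrow> (nat set \<Rightarrow> nat) \<Rightarrow> nat \<Rightarrow> nat set" where
  "domain_of V Lam v0 = identifiable_vertices V (add_patch Lam v0)"

definition identifiable_from :: "nat set \<Rightarrow> (nat set \<Rightarrow> nat) \<Rightarrow> nat \<Rightarrow> nat" where
  "identifiable_from V Lam v0 = identifiable_hyperedges V (add_patch Lam v0)"

definition poisson_hypergraph :: "(nat \<Rightarrow> real) \<Rightarrow> nat \<Rightarrow> (nat set \<Rightarrow> nat) pmf" where
  "poisson_hypergraph \<beta> N =
     Pi_pmf (Pow {1..N}) 0
       (\<lambda>A. poisson0_pmf (real N * \<beta> (card A) / real (N choose card A)))"

definition iid_poisson_space :: "real \<Rightarrow> (nat \<Rightarrow> nat) measure" where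
  "iid_poisson_space r = PiM UNIV (\<lambda>_. measure_pmf (poisson0_pmf r))"

definition rw_walk :: "(nat \<Rightarrow> nat) \<Rightarrow> nat \<Rightarrow> int" where
  "rw_walk \<omega> n = 1 + (\<Sum>i<n. int (\<omega> i) - 1)"

definition rw_hitting_time :: "(nat \<Rightarrow> nat) \<Rightarrow> enat" where
  "rw_hitting_time \<omega> =
     (if \<exists>n. rw_walk \<omega> n = 0 then enat (LEAST n. rw_walk \<omega> n = 0) else \<infinity>)"

definition conv_in_distribution :: "(nat \<Rightarrow> 'a::topological_space measure) \<Rightarrow> 'a measure \<Rightarrow> bool" where
  "conv_in_distribution \<mu>s \<mu> \<longleftrightarrow>
     (\<forall>f :: 'a \<Rightarrow> real. continuous_on UNIV f \<longrightarrow> bounded (range f) \<longrightarrow>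
        (\<lambda>n. \<integral>x. f x \<partial>(\<mu>s n)) \<longlonglongrightarrow> (\<integral>x. f x \<partial>\<mu>))"

end

theory Submission
  imports Defs
begin

text \<open>
  Collapse one vertex at a time and reveal only the patches this creates. The edges with at least
  two surviving vertices stay independent Poisson; their rates change from \<open>lam k\<close> to
  \<open>lam k + lam (k + 1)\<close>, by additivity of the Poisson law. Hence during each collapse every surviving vertex
  independently receives a Poisson number of new patches. After \<open>n = x N\<close> collapses a given vertex
  has been patched with probability about \<open>1 - exp (- \<beta>' x)\<close>, and about
  \<open>(\<beta> x + (1 - x) * \<beta>' x) * N\<close> patches have been created in total. The collapse
  stops when all patched vertices are used up, at which time every patch has become an identifiable
  hyperedge.

  For a fixed number of steps two patches rarely meet, and the number of active vertices converges to the
  random walk. The moment generating functions of the number of unpatched vertices and of the number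
  of patches are explicit, and Chernoff bounds show that the collapse is very unlikely to stop
  between a large constant and \<open>(g - \<epsilon>) N\<close> or to continue beyond
  \<open>(g + \<epsilon>) N\<close>. The edge count is monotone along the collapse, so it is squeezed
  to \<open>\<beta> g + (1 - g) * \<beta>' g\<close>, where \<open>\<beta>' g = - ln (1 - g)\<close>. If
  \<open>2 * \<beta>\<^sub>2 \<le> 1\<close> the walk dies out and the domain stays bounded in probability.
\<close>

section \<open>Revealing the hypergraph along the collapse\<close>


text \<open>No conditioning is required: the vertex collapsed next depends only on the patches
  already revealed, so the larger edges keep their product law and the collapse becomes a recursion
  (\<open>chain_stop\<close>, \<open>chain_step\<close>) along which all bounds are proved by
  induction. Repeated shifting of the rates is a power of 1 + shift; this produces binomial weights,
  whose ratios turn sums over edge sizes into values of \<beta> and \<beta>'. The fluid picture says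
  nothing at times \<open>n\<close> that grow more slowly than \<open>N\<close>. For
  \<open>2 * \<beta> 2 > 1\<close> this range is covered by a separate linear lower bound on the
  number of patched vertices, which makes stopping at \<open>n\<close> geometrically unlikely,
  uniformly in \<open>N\<close>. Inside (0, g) the Chernoff estimate needs a margin between the two
  ends of a time window, so it is proved for short windows and extended by bisection. Above g only
  points of the defining set arbitrarily close to g are at hand, and one of them suffices. At
  \<open>2 * \<beta> 2 = 1\<close> the number g may be positive, but then the event it is attached
  to has probability 0.\<close>

lemma pmf_poisson0: "0 \<le> r \<Longrightarrow> pmf (poisson0_pmf r) k = r ^ k / fact k * exp (- r)"
  by (cases "k = 0") (auto simp: poisson0_pmf_def power_0_left)

lemma poisson0_add:
  assumes "0 \<le> a" "0 \<le> b"
  shows "map_pmf (\<lambda>(x, y). x + y) (pair_pmf (poisson0_pmf a) (poisson0_pmf b)) = poisson0_pmf (a + b)"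
proof (rule pmf_eqI)
  fix n :: nat
  have eq: "(\<lambda>(x, y). x + y) -` {n} = (\<lambda>k. (k, n - k)) ` {..n}"
    by (auto simp: image_iff)
  have inj: "inj_on (\<lambda>k. (k, n - k)) {..n}" by (auto simp: inj_on_def)
  have "pmf (map_pmf (\<lambda>(x, y). x + y) (pair_pmf (poisson0_pmf a) (poisson0_pmf b))) n =
      (\<Sum>k\<le>n. pmf (poisson0_pmf a) k * pmf (poisson0_pmf b) (n - k))"
    by (simp add: pmf_map eq measure_measure_pmf_finite sum.reindex[OF inj] pmf_pair)
  also have "\<dots> = (\<Sum>k\<le>n. of_nat (n choose k) * a ^ k * b ^ (n - k) * (exp (- a) * exp (- b) / fact n))"
    using assms by (intro sum.cong refl) (auto simp: pmf_poisson0 binomial_fact)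
  also have "\<dots> = (a + b) ^ n * (exp (- a) * exp (- b) / fact n)"
    by (simp add: binomial_ring sum_distrib_right sum_divide_distrib)
  also have "\<dots> = pmf (poisson0_pmf (a + b)) n"
    using assms by (simp add: pmf_poisson0 mult_exp_exp)
  finally show "pmf (map_pmf (\<lambda>(x, y). x + y) (pair_pmf (poisson0_pmf a) (poisson0_pmf b))) n =
      pmf (poisson0_pmf (a + b)) n" .
qed

lemma sum_Pi_pmf_poisson0:
  assumes "finite A" "0 \<le> r"
  shows "map_pmf (\<lambda>X. sum X A) (Pi_pmf A 0 (\<lambda>_. poisson0_pmf r)) = poisson0_pmf (real (card A) * r)"
  using assms(1)
proof (induction rule: finite_induct)
  case empty
  show ?case by (simp add: poisson0_pmf_def)
next
  case (insert x A)
  have "map_pmf (\<lambda>X. sum X (insert x A)) (Pi_pmf (insert x A) 0 (\<lambda>_. poisson0_pmf r)) =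
    map_pmf (\<lambda>(y, f). y + sum f A) (pair_pmf (poisson0_pmf r) (Pi_pmf A 0 (\<lambda>_. poisson0_pmf r)))"
    using insert.hyps
    by (subst Pi_pmf_insert) (auto simp: pmf.map_comp o_def case_prod_unfold intro!: map_pmf_cong sum.cong)
  also have "\<dots> = map_pmf (\<lambda>(y, z). y + z) (pair_pmf (poisson0_pmf r)
      (map_pmf (\<lambda>f. sum f A) (Pi_pmf A 0 (\<lambda>_. poisson0_pmf r))))"
    by (simp add: pair_map_pmf2 pmf.map_comp o_def case_prod_unfold)
  also have "\<dots> = poisson0_pmf (r + real (card A) * r)"
    using assms(2) by (simp add: insert.IH poisson0_add)
  finally show ?case using insert.hyps by (simp add: algebra_simps)
qed

lemma nn_integral_poisson0_power:
  assumes "0 \<le> r" "0 \<le> s"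
  shows "(\<integral>\<^sup>+x. ennreal (s ^ x) \<partial>poisson0_pmf r) = ennreal (exp (r * (s - 1)))"
proof -
  have "(\<integral>\<^sup>+x. ennreal (s ^ x) \<partial>poisson0_pmf r)
      = (\<Sum>k. ennreal (pmf (poisson0_pmf r) k) * ennreal (s ^ k))"
    by (simp add: nn_integral_measure_pmf nn_integral_count_space_nat)
  also have "\<dots> = (\<Sum>k. ennreal (exp (- r) * (inverse (fact k) * (r * s) ^ k)))"
    using assms
    by (intro suminf_cong) (simp add: pmf_poisson0 ennreal_mult'' [symmetric] power_mult_distrib field_simps)
  also have "\<dots> = ennreal (\<Sum>k. exp (- r) * (inverse (fact k) * (r * s) ^ k))"
    using assms summable_exp[of "r * s"]
    by (intro suminf_ennreal_eq) (auto intro!: summable_sums summable_mult)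
  also have "(\<Sum>k. exp (- r) * (inverse (fact k) * (r * s) ^ k)) = exp (- r) * exp (r * s)"
    using summable_exp[of "r * s"] by (subst suminf_mult) (auto simp: exp_def scaleR_conv_of_real divide_inverse mult.commute)
  also have "\<dots> = exp (r * (s - 1))"
    by (simp add: mult_exp_exp algebra_simps)
  finally show ?thesis .
qed

text \<open>One factor of the product in \<open>chain_unpatched_bound\<close>: an unpatched vertex
  keeps the weight \<open>s\<close> exactly if no fresh patch lands on it.\<close>

lemma nn_integral_poisson0_zero:
  assumes "0 \<le> r" "0 \<le> s"
  shows "(\<integral>\<^sup>+x. ennreal (if x = 0 then s else 1) \<partial>poisson0_pmf r) = ennreal (1 - exp (- r) + exp (- r) * s)"
proof -
  have "(\<integral>\<^sup>+x. ennreal (if x = 0 then s else 1) \<partial>poisson0_pmf r)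
      = (\<integral>\<^sup>+x. (ennreal s * indicator {0} x + indicator (- {0}) x) \<partial>poisson0_pmf r)"
    by (intro nn_integral_cong) (auto simp: indicator_def)
  also have "\<dots> = ennreal s * emeasure (poisson0_pmf r) {0} + emeasure (poisson0_pmf r) (- {0})"
    by (simp add: nn_integral_add nn_integral_cmult)
  also have "emeasure (poisson0_pmf r) {0} = ennreal (exp (- r))"
    using assms by (simp add: emeasure_pmf_single pmf_poisson0)
  also have "emeasure (poisson0_pmf r) (- {0}) = ennreal (1 - exp (- r))"
    using assms measure_pmf.prob_compl[of "{0}" "poisson0_pmf r"]
    by (simp add: measure_pmf.emeasure_eq_measure Compl_eq_Diff_UNIV measure_pmf_single pmf_poisson0)
  finally show ?thesis using assms
    by (simp add: ennreal_mult' [symmetric] ennreal_plus [symmetric] mult.commute add.commute del: ennreal_plus)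
qed

text \<open>Used with \<open>h = insert v\<close>, since removing \<open>v\<close> merges the edges
  \<open>A\<close> and \<open>insert v A\<close>. Distinct pairs share no coordinate, so their sums
  stay independent; the induction splits off both members of one pair at a time.\<close>

lemma Pi_pmf_add_pairs:
  fixes D :: "'a \<Rightarrow> nat pmf"
  assumes "finite S" "inj_on h S" "S \<inter> h ` S = {}"
  shows "map_pmf (\<lambda>L A. if A \<in> S then L A + L (h A) else 0) (Pi_pmf (S \<union> h ` S) 0 D) =
    Pi_pmf S 0 (\<lambda>A. map_pmf (\<lambda>(x, y). x + y) (pair_pmf (D A) (D (h A))))"
  using assms
proof (induction rule: finite_induct)
  case empty
  show ?case by simp
next
  case (insert a S)
  let ?T = "S \<union> h ` S"
  have IH: "map_pmf (\<lambda>L A. if A \<in> S then L A + L (h A) else 0) (Pi_pmf ?T 0 D) =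
    Pi_pmf S 0 (\<lambda>A. map_pmf (\<lambda>(x, y). x + y) (pair_pmf (D A) (D (h A))))"
    using insert by auto
  have U: "insert a S \<union> h ` insert a S = insert a (insert (h a) ?T)" by auto
  have nin: "h a \<notin> ?T" "a \<notin> insert (h a) ?T"
    using insert.prems insert.hyps by (auto simp: inj_on_def)
  have fn: "(\<lambda>A. if A \<in> insert a S then (L(h a := y, a := x)) A + (L(h a := y, a := x)) (h A) else 0) =
     (\<lambda>A. if A \<in> S then L A + L (h A) else 0)(a := x + y)" for x y :: nat and L :: "'a \<Rightarrow> nat"
    using insert.prems insert.hyps nin by (auto simp: fun_eq_iff inj_on_def)
  have "map_pmf (\<lambda>L A. if A \<in> insert a S then L A + L (h A) else 0) (Pi_pmf (insert a (insert (h a) ?T)) 0 D) =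
    do {x \<leftarrow> D a; y \<leftarrow> D (h a); L \<leftarrow> Pi_pmf ?T 0 D;
      return_pmf (\<lambda>A. if A \<in> insert a S then (L(h a := y, a := x)) A + (L(h a := y, a := x)) (h A) else 0)}"
    using nin insert.hyps
    by (simp add: Pi_pmf_insert' map_bind_pmf bind_assoc_pmf bind_return_pmf)
  also have "\<dots> = do {x \<leftarrow> D a; y \<leftarrow> D (h a); f \<leftarrow> map_pmf (\<lambda>L A. if A \<in> S then L A + L (h A) else 0) (Pi_pmf ?T 0 D);
      return_pmf (f(a := x + y))}"
    unfolding fn by (simp add: bind_map_pmf)
  also have "\<dots> = Pi_pmf (insert a S) 0 (\<lambda>A. map_pmf (\<lambda>(x, y). x + y) (pair_pmf (D A) (D (h A))))"
    unfolding IH using insert.hyps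
    by (simp add: Pi_pmf_insert' bind_map_pmf pair_pmf_def bind_assoc_pmf bind_return_pmf)
  finally show ?case unfolding U .
qed

section \<open>Contraction of one vertex in a partly revealed hypergraph\<close>

lemma hg_restrict_vertex:
  assumes "finite W" "v \<in> W"
  shows "hg_restrict W L {v} = (\<lambda>A. if A \<in> Pow (W - {v}) then L A + L (insert v A) else 0)"
proof
  fix A
  show "hg_restrict W L {v} A = (if A \<in> Pow (W - {v}) then L A + L (insert v A) else 0)"
  proof (cases "A \<in> Pow (W - {v})")
    case True
    then have "{B. B \<subseteq> W \<and> B - {v} = A} = {A, insert v A}" "A \<noteq> insert v A"
      using assms by auto
    then show ?thesis using True by (simp add: hg_restrict_def)
  next
    case False
    then have "{B. B \<subseteq> W \<and> B - {v} = A} = {}" by auto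
    then show ?thesis using False by (simp only: hg_restrict_def) auto
  qed
qed

text \<open>The partially revealed hypergraph: the multiplicities of the empty edge and of the patches
  are known, those of the larger edges are still independent Poisson variables.\<close>

definition revealed :: "(nat \<Rightarrow> real) \<Rightarrow> (nat \<Rightarrow> nat) \<Rightarrow> nat \<Rightarrow> nat set \<Rightarrow> nat pmf" where
  "revealed lam c z A = (if A = {} then return_pmf z else if card A = 1 then return_pmf (c (the_elem A))
     else poisson0_pmf (lam (card A)))"

definition revealed_hg :: "(nat \<Rightarrow> real) \<Rightarrow> nat set \<Rightarrow> (nat \<Rightarrow> nat) \<Rightarrow> nat \<Rightarrow> (nat set \<Rightarrow> nat) pmf" where
  "revealed_hg lam W c z = Pi_pmf (Pow W) 0 (revealed lam c z)"

definition shift_rates :: "(nat \<Rightarrow> real) \<Rightarrow> nat \<Rightarrow> real" where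
  "shift_rates lam k = lam k + lam (Suc k)"

lemma shift_rates_nonneg: "(\<And>k. 0 \<le> lam k) \<Longrightarrow> 0 \<le> shift_rates lam k"
  by (simp add: shift_rates_def)

text \<open>Fresh patches arise as a field over all edges that is trivial off the singletons; this
  rereads it as one independent count per vertex.\<close>

lemma Pi_pmf_singletons:
  assumes "finite W"
  shows "map_pmf (\<lambda>f u. f {u}) (Pi_pmf (Pow W) (0::nat) (\<lambda>A. if card A = 1 then p else return_pmf 0))
    = Pi_pmf W 0 (\<lambda>_. p)"
proof -
  let ?S = "(\<lambda>u. {u}) ` W"
  have S: "?S = {A \<in> Pow W. card A = 1}" by (auto simp: card_1_singleton_iff)
  have "Pi_pmf (Pow W) (0::nat) (\<lambda>A. if card A = 1 then p else return_pmf 0)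
      = Pi_pmf ?S 0 (\<lambda>_. p)"
    unfolding S using assms Pi_pmf_if_set[of "Pow W" 0 "\<lambda>A. card A = 1" "\<lambda>_. p"] by simp
  also have "map_pmf (\<lambda>f u. f {u}) \<dots> = Pi_pmf W 0 (\<lambda>_. p)"
    using assms by (subst Pi_pmf_bij_betw[where h = "\<lambda>u. {u}" and B = ?S])
      (auto simp: o_def bij_betw_def inj_on_def)
  finally show ?thesis .
qed

text \<open>Merging \<open>A\<close> with \<open>insert v A\<close> adds the \<open>c v\<close>
  patches at \<open>v\<close> to the empty edge, turns each pair of \<open>u\<close> and
  \<open>v\<close> into a fresh patch at \<open>u\<close> (hence the rate \<open>lam 2\<close>), and
  adds two independent Poisson variables on every larger edge, which stays hidden.\<close>

lemma revealed_hg_restrict: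
  assumes "finite W" "v \<in> W" "\<And>k. 0 \<le> lam k"
  shows "map_pmf (\<lambda>L. hg_restrict W L {v}) (revealed_hg lam W c z) =
    do {X \<leftarrow> Pi_pmf (W - {v}) 0 (\<lambda>_. poisson0_pmf (lam 2));
        revealed_hg (shift_rates lam) (W - {v}) (\<lambda>u. c u + X u) (z + c v)}"
proof -
  let ?W = "W - {v}" let ?S = "Pow ?W" let ?h = "insert v"
  let ?P = "\<lambda>A::nat set. if card A = 1 then poisson0_pmf (lam 2) else return_pmf 0"
  let ?Q = "\<lambda>A x. if A = {} then return_pmf (z + c v) else if card A = 1 then return_pmf (c (the_elem A) + x)
      else poisson0_pmf (shift_rates lam (card A))"
  have fin: "finite ?S" using assms by simp
  have inj: "inj_on ?h ?S" by (auto simp: inj_on_def)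
  have disj: "?S \<inter> ?h ` ?S = {}" by auto
  have "?h ` ?S = {A. A \<subseteq> W \<and> v \<in> A}"
  proof safe
    fix A assume A: "A \<subseteq> W" "v \<in> A"
    then have "A = ?h (A - {v})" "A - {v} \<in> ?S" by auto
    then show "A \<in> ?h ` ?S" by (rule image_eqI)
  qed (use assms in auto)
  then have U: "Pow W = ?S \<union> ?h ` ?S" by auto
  \<comment> \<open>Each merged law is written in two stages, a fresh patch count from
    \<open>?P\<close> and then the coordinate given that count, so that \<open>Pi_pmf_bind\<close>
    can draw all fresh patches first.\<close>
  have comp: "map_pmf (\<lambda>(x, y). x + y) (pair_pmf (revealed lam c z A) (revealed lam c z (?h A))) =
     bind_pmf (?P A) (?Q A)" if "A \<in> ?S" for A
  proof -
    have fA: "finite A" and cA: "card (?h A) = Suc (card A)"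
      using that assms by (auto intro: finite_subset simp: card_insert_if finite_subset)
    consider "A = {}" | "card A = 1" | "A \<noteq> {}" "card A \<noteq> 1" by auto
    then show ?thesis
    proof cases
      case 1
      then show ?thesis by (simp add: revealed_def pair_return_pmf1 map_pmf_def bind_return_pmf)
    next
      case 2
      then obtain u where u: "A = {u}" by (auto simp: card_1_singleton_iff)
      have "card (?h A) = 2" using 2 cA by simp
      then show ?thesis using u
        by (simp add: revealed_def pair_return_pmf1 pmf.map_comp o_def) (simp add: map_pmf_def)
    next
      case 3
      then have "card A \<noteq> 0" using fA by simp
      then show ?thesis using 3 assms(3) cA
        by (simp add: revealed_def poisson0_add bind_return_pmf shift_rates_def)
    qed
  qed
  have "map_pmf (\<lambda>L. hg_restrict W L {v}) (revealed_hg lam W c z) =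
     map_pmf (\<lambda>L A. if A \<in> ?S then L A + L (?h A) else 0) (Pi_pmf (?S \<union> ?h ` ?S) 0 (revealed lam c z))"
    unfolding revealed_hg_def U[symmetric] hg_restrict_vertex[OF assms(1,2)] ..
  also have "\<dots> = Pi_pmf ?S 0 (\<lambda>A. map_pmf (\<lambda>(x, y). x + y) (pair_pmf (revealed lam c z A) (revealed lam c z (?h A))))"
    by (rule Pi_pmf_add_pairs[OF fin inj disj])
  also have "\<dots> = Pi_pmf ?S 0 (\<lambda>A. bind_pmf (?P A) (?Q A))"
    using comp by (intro Pi_pmf_cong) auto
  also have "\<dots> = bind_pmf (Pi_pmf ?S 0 ?P) (\<lambda>f. Pi_pmf ?S 0 (\<lambda>A. ?Q A (f A)))"
    by (rule Pi_pmf_bind[OF fin])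
  also have "\<dots> = bind_pmf (Pi_pmf ?S 0 ?P) (\<lambda>f. revealed_hg (shift_rates lam) ?W (\<lambda>u. c u + (\<lambda>u. f {u}) u) (z + c v))"
    unfolding revealed_hg_def
    by (intro bind_pmf_cong refl Pi_pmf_cong) (auto simp: revealed_def card_1_singleton_iff)
  also have "\<dots> = bind_pmf (map_pmf (\<lambda>f u. f {u}) (Pi_pmf ?S 0 ?P)) (\<lambda>X. revealed_hg (shift_rates lam) ?W (\<lambda>u. c u + X u) (z + c v))"
    by (simp add: bind_map_pmf)
  also have "map_pmf (\<lambda>f u. f {u}) (Pi_pmf ?S 0 ?P) = Pi_pmf ?W 0 (\<lambda>_. poisson0_pmf (lam 2))"
    using assms by (intro Pi_pmf_singletons) auto
  finally show ?thesis .
qed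

text \<open>Once all removed vertices have been contracted, the multiplicity of the empty edge counts the
  identifiable hyperedges.\<close>

definition collapse_result :: "nat set \<Rightarrow> (nat set \<Rightarrow> nat) \<Rightarrow> nat \<times> nat" where
  "collapse_result W L = (let R = (collapse_step ^^ card W) (W, L) in (card (fst R), snd R {}))"

section \<open>The collapse as a recursion on the revealed data\<close>

lemma funpow_collapse_step_fixed:
  assumes "\<not> (\<exists>v\<in>W. 1 \<le> L {v})"
  shows "(collapse_step ^^ n) (W, L) = (W, L)"
  using assms by (induction n) (auto simp: collapse_step_def)

lemma collapse_step_patch:
  assumes "\<exists>v\<in>W. 1 \<le> L {v}" "v = (LEAST v. v \<in> W \<and> 1 \<le> L {v})"
  shows "v \<in> W" "1 \<le> L {v}" "collapse_step (W, L) = (W - {v}, hg_restrict W L {v})"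
proof -
  have "v \<in> W \<and> 1 \<le> L {v}"
    using assms LeastI_ex[of "\<lambda>v. v \<in> W \<and> 1 \<le> L {v}"] by auto
  then show "v \<in> W" "1 \<le> L {v}" by auto
  show "collapse_step (W, L) = (W - {v}, hg_restrict W L {v})"
    using assms by (simp add: collapse_step_def Let_def)
qed

lemma collapse_result_step:
  assumes "finite W" "\<exists>v\<in>W. 1 \<le> L {v}" "v = (LEAST v. v \<in> W \<and> 1 \<le> L {v})"
  shows "collapse_result W L = collapse_result (W - {v}) (hg_restrict W L {v})"
proof -
  note s = collapse_step_patch[OF assms(2,3)]
  have "card W = Suc (card (W - {v}))" using assms(1) s(1) by (metis card_Suc_Diff1)
  then show ?thesis by (simp only: collapse_result_def funpow_Suc_right o_apply s(3))
qed

text \<open>Invariant: contracting vertices one by one gives the same multiplicities as removing the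
  whole set at once, that is, as summing over the removed part \<open>B\<close> of an edge. At
  \<open>A = {}\<close> the sum runs over the edges inside the removed set, which are the
  identifiable ones.\<close>

lemma funpow_collapse_step_edges:
  assumes "finite V"
  shows "fst ((collapse_step ^^ n) (V, L)) \<subseteq> V \<and>
    (\<forall>A \<subseteq> fst ((collapse_step ^^ n) (V, L)).
       snd ((collapse_step ^^ n) (V, L)) A = (\<Sum>B\<in>Pow (V - fst ((collapse_step ^^ n) (V, L))). L (B \<union> A)))"
proof (induction n)
  case 0
  show ?case by simp
next
  case (Suc n)
  obtain W M where WM: "(collapse_step ^^ n) (V, L) = (W, M)" by fastforce
  have W: "W \<subseteq> V" and M: "\<And>A. A \<subseteq> W \<Longrightarrow> M A = (\<Sum>B\<in>Pow (V - W). L (B \<union> A))"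
    using Suc WM by auto
  show ?case
  proof (cases "\<exists>v\<in>W. 1 \<le> M {v}")
    case False
    then have "collapse_step (W, M) = (W, M)" by (auto simp: collapse_step_def)
    then show ?thesis using Suc WM by simp
  next
    case True
    define v where "v = (LEAST v. v \<in> W \<and> 1 \<le> M {v})"
    note s = collapse_step_patch[OF True v_def]
    have fW: "finite W" using assms W finite_subset by blast
    have "hg_restrict W M {v} A = (\<Sum>B\<in>Pow (V - (W - {v})). L (B \<union> A))" if A: "A \<subseteq> W - {v}" for A
    proof -
      have V: "V - (W - {v}) = insert v (V - W)" using s(1) W by auto
      have nv: "v \<notin> V - W" using s(1) by auto
      have inj: "inj_on (insert v) (Pow (V - W))" using nv by (auto simp: inj_on_def)
      have "(\<Sum>B\<in>Pow (V - (W - {v})). L (B \<union> A)) =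
         (\<Sum>B\<in>Pow (V - W). L (B \<union> A)) + (\<Sum>B\<in>insert v ` Pow (V - W). L (B \<union> A))"
        unfolding V Pow_insert using assms nv by (intro sum.union_disjoint) auto
      also have "\<dots> = M A + M (insert v A)"
        using A s(1) by (simp add: sum.reindex[OF inj] M insert_absorb subset_Diff_insert)
      finally show ?thesis using A by (simp add: hg_restrict_vertex[OF fW s(1)])
    qed
    then show ?thesis using W by (simp add: WM s(3)) blast
  qed
qed

lemma collapse_result_correct:
  assumes "finite V"
  shows "card (identifiable_vertices V L) = card V - fst (collapse_result V L)"
    "identifiable_hyperedges V L = snd (collapse_result V L)"
proof -
  let ?R = "(collapse_step ^^ card V) (V, L)"
  have sub: "fst ?R \<subseteq> V" and e: "snd ?R {} = (\<Sum>B\<in>Pow (V - fst ?R). L (B \<union> {}))"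
    using funpow_collapse_step_edges[OF assms, of "card V" L] by blast+
  show "card (identifiable_vertices V L) = card V - fst (collapse_result V L)"
    using sub assms by (simp add: identifiable_vertices_def collapse_result_def Let_def card_Diff_subset finite_subset)
  show "identifiable_hyperedges V L = snd (collapse_result V L)"
    using e by (simp add: identifiable_hyperedges_def identifiable_vertices_def collapse_result_def Let_def)
qed

text \<open>Law of the final numbers of survivors and of counted edges for a collapse resumed
  midway, with \<open>z\<close> patches already spent. Hidden edges enter only through their rates,
  so these arguments determine the future.\<close>

definition chain :: "(nat \<Rightarrow> real) \<Rightarrow> nat set \<Rightarrow> (nat \<Rightarrow> nat) \<Rightarrow> nat \<Rightarrow> (nat \<times> nat) pmf" where
  "chain lam W c z = map_pmf (collapse_result W) (revealed_hg lam W c z)"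

lemma revealed_hg_support:
  assumes "finite W" "L \<in> set_pmf (revealed_hg lam W c z)"
  shows "L {} = z" "u \<in> W \<Longrightarrow> L {u} = c u"
  using assms unfolding revealed_hg_def
  by (auto simp: set_Pi_pmf PiE_dflt_def revealed_def dest: spec[of _ "{}"] spec[of _ "{u}"])

lemma chain_stop:
  assumes "finite W" "\<forall>u\<in>W. c u = 0"
  shows "chain lam W c z = return_pmf (card W, z)"
proof -
  have "chain lam W c z = map_pmf (\<lambda>_. (card W, z)) (revealed_hg lam W c z)"
    unfolding chain_def
  proof (rule map_pmf_cong[OF refl])
    fix L assume L: "L \<in> set_pmf (revealed_hg lam W c z)"
    then have "\<not> (\<exists>v\<in>W. 1 \<le> L {v})" using assms revealed_hg_support[OF assms(1) L] by auto
    then show "collapse_result W L = (card W, z)"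
      using revealed_hg_support(1)[OF assms(1) L]
      by (simp add: collapse_result_def Let_def funpow_collapse_step_fixed)
  qed
  then show ?thesis by simp
qed

text \<open>The vertex collapsed next can be read off \<open>c\<close>, so its choice reveals
  nothing about the hidden edges and \<open>revealed_hg_restrict\<close> applies with a fixed
  \<open>v\<close>. Only the fact that \<open>v\<close> is patched is passed on.\<close>

lemma chain_step:
  assumes "finite W" "\<exists>u\<in>W. c u \<noteq> 0" "\<And>k. 0 \<le> lam k"
  obtains v where "v \<in> W" "c v \<noteq> 0"
    "chain lam W c z = do {X \<leftarrow> Pi_pmf (W - {v}) 0 (\<lambda>_. poisson0_pmf (lam 2));
        chain (shift_rates lam) (W - {v}) (\<lambda>u. c u + X u) (z + c v)}"
proof
  define v where "v = (LEAST v. v \<in> W \<and> 1 \<le> c v)"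
  show v: "v \<in> W" "c v \<noteq> 0"
    using assms(2) LeastI_ex[of "\<lambda>v. v \<in> W \<and> 1 \<le> c v"]
    by (auto simp: v_def Suc_le_eq)
  have "chain lam W c z = map_pmf (\<lambda>L. collapse_result (W - {v}) (hg_restrict W L {v})) (revealed_hg lam W c z)"
    unfolding chain_def
  proof (rule map_pmf_cong[OF refl])
    fix L assume L: "L \<in> set_pmf (revealed_hg lam W c z)"
    have "(\<lambda>v. v \<in> W \<and> 1 \<le> L {v}) = (\<lambda>v. v \<in> W \<and> 1 \<le> c v)"
      using revealed_hg_support(2)[OF assms(1) L] by auto
    moreover have "\<exists>v\<in>W. 1 \<le> L {v}" using v revealed_hg_support(2)[OF assms(1) L] by force
    ultimately show "collapse_result W L = collapse_result (W - {v}) (hg_restrict W L {v})"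
      by (intro collapse_result_step assms(1)) (simp_all add: v_def)
  qed
  also have "\<dots> = map_pmf (collapse_result (W - {v})) (map_pmf (\<lambda>L. hg_restrict W L {v}) (revealed_hg lam W c z))"
    by (simp add: pmf.map_comp o_def)
  also have "\<dots> = do {X \<leftarrow> Pi_pmf (W - {v}) 0 (\<lambda>_. poisson0_pmf (lam 2));
        chain (shift_rates lam) (W - {v}) (\<lambda>u. c u + X u) (z + c v)}"
    by (subst revealed_hg_restrict[OF assms(1) v(1) assms(3)]) (simp add: map_bind_pmf chain_def)
  finally show "chain lam W c z = do {X \<leftarrow> Pi_pmf (W - {v}) 0 (\<lambda>_. poisson0_pmf (lam 2));
        chain (shift_rates lam) (W - {v}) (\<lambda>u. c u + X u) (z + c v)}" .
qed

text \<open>For \<open>k > N\<close> the division by zero gives the rate 0.\<close>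

definition initial_rates :: "(nat \<Rightarrow> real) \<Rightarrow> nat \<Rightarrow> nat \<Rightarrow> real" where
  "initial_rates \<beta> N k = real N * \<beta> k / real (N choose k)"

text \<open>The extra hyperedge at \<open>v0\<close> becomes the single initial patch. As \<beta>
  vanishes at 0 and 1, the empty edge and all other patches have multiplicity 0, so the start is a
  \<open>revealed_hg\<close> with known \<open>c\<close> and \<open>z\<close>.\<close>

lemma poisson_hypergraph_chain:
  assumes "\<beta> 0 = 0" "\<beta> 1 = 0" "v0 \<in> {1..N}"
  shows "map_pmf (\<lambda>L. (card (domain_of {1..N} L v0), identifiable_from {1..N} L v0)) (poisson_hypergraph \<beta> N) =
    map_pmf (\<lambda>(w, z). (N - w, z)) (chain (initial_rates \<beta> N) {1..N} (\<lambda>u. if u = v0 then 1 else 0) 0)"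
proof -
  let ?V = "{1..N}" let ?c = "\<lambda>u. if u = v0 then 1 else 0 :: nat"
  let ?D = "\<lambda>A::nat set. poisson0_pmf (real N * \<beta> (card A) / real (N choose card A))"
  let ?q = "\<lambda>(A::nat set) x. return_pmf (x + (if A = {v0} then 1 else 0))"
  have "revealed_hg (initial_rates \<beta> N) ?V ?c 0 = Pi_pmf (Pow ?V) 0 (\<lambda>A. bind_pmf (?D A) (?q A))"
    unfolding revealed_hg_def
  proof (intro Pi_pmf_cong refl)
    fix A assume "A \<in> Pow ?V"
    consider "A = {}" | u where "A = {u}" | "A \<noteq> {}" "card A \<noteq> 1"
      by (metis card_1_singletonE)
    then show "revealed (initial_rates \<beta> N) ?c 0 A = bind_pmf (?D A) (?q A)"
    proof cases
      case 1
      then show ?thesis using assms by (simp add: revealed_def poisson0_pmf_def bind_return_pmf)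
    next
      case 2
      then show ?thesis using assms by (simp add: revealed_def poisson0_pmf_def bind_return_pmf)
    next
      case 3
      then have "A \<noteq> {v0}" by auto
      then show ?thesis using 3 by (simp add: revealed_def initial_rates_def bind_return_pmf')
    qed
  qed
  also have "\<dots> = bind_pmf (Pi_pmf (Pow ?V) 0 ?D) (\<lambda>f. Pi_pmf (Pow ?V) 0 (\<lambda>A. ?q A (f A)))"
    by (rule Pi_pmf_bind) simp
  also have "\<dots> = map_pmf (\<lambda>f. add_patch f v0) (Pi_pmf (Pow ?V) 0 ?D)"
    unfolding map_pmf_def
  proof (intro bind_pmf_cong refl)
    fix f assume "f \<in> set_pmf (Pi_pmf (Pow ?V) 0 ?D)"
    then have "f A = 0" if "\<not> A \<subseteq> ?V" for A
      using set_Pi_pmf_subset[of "Pow ?V" 0 ?D] that by blast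
    then have "(\<lambda>A. if A \<in> Pow ?V then f A + (if A = {v0} then 1 else 0) else 0) = add_patch f v0"
      using assms(3) by (auto simp: fun_eq_iff add_patch_def)
    then show "Pi_pmf (Pow ?V) 0 (\<lambda>A. ?q A (f A)) = return_pmf (add_patch f v0)"
      by (subst Pi_pmf_return_pmf) auto
  qed
  finally have "revealed_hg (initial_rates \<beta> N) ?V ?c 0 = map_pmf (\<lambda>f. add_patch f v0) (poisson_hypergraph \<beta> N)"
    by (simp add: poisson_hypergraph_def)
  then show ?thesis
    by (simp add: chain_def pmf.map_comp o_def case_prod_unfold domain_of_def identifiable_from_def collapse_result_correct)
qed

section \<open>Exponential bounds\<close>


text \<open>Three properties inherited through \<open>chain_step\<close>: only vertices now
  unpatched can survive, every patch already created is counted in the end, and each removed vertex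
  spends at least one patch. The last yields \<open>T \<le> Z\<close>; the first two rule out
  impossible outcomes in the base cases of the exponential bounds.\<close>

lemma chain_support:
  assumes "finite W" "\<And>k. 0 \<le> lam k" "(f, Z) \<in> set_pmf (chain lam W c z)"
  shows "f \<le> card {u \<in> W. c u = 0} \<and> z + sum c W \<le> Z \<and> z + card W \<le> Z + f"
  using assms
proof (induction "card W" arbitrary: lam W c z)
  case 0
  then show ?case by (simp add: chain_stop)
next
  case (Suc n)
  show ?case
  proof (cases "\<exists>u\<in>W. c u \<noteq> 0")
    case False
    then have "{u \<in> W. c u = 0} = W" by auto
    then show ?thesis using False Suc.prems by (simp add: chain_stop)
  next
    case True
    obtain v where v: "v \<in> W" "c v \<noteq> 0" and
      ch: "chain lam W c z = do {X \<leftarrow> Pi_pmf (W - {v}) 0 (\<lambda>_. poisson0_pmf (lam 2));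
        chain (shift_rates lam) (W - {v}) (\<lambda>u. c u + X u) (z + c v)}"
      by (rule chain_step[where lam=lam and z=z, OF Suc.prems(1) True Suc.prems(2)])
    from Suc.prems(3) obtain X where
      X: "(f, Z) \<in> set_pmf (chain (shift_rates lam) (W - {v}) (\<lambda>u. c u + X u) (z + c v))"
      unfolding ch by auto
    have n: "n = card (W - {v})" using Suc.hyps(2) Suc.prems(1) v by simp
    have IH: "f \<le> card {u \<in> W - {v}. c u + X u = 0} \<and>
        (z + c v) + sum (\<lambda>u. c u + X u) (W - {v}) \<le> Z \<and> (z + c v) + card (W - {v}) \<le> Z + f"
      using Suc.hyps(1)[OF n _ _ X] Suc.prems(1,2) by (simp add: shift_rates_nonneg)
    moreover have "card {u \<in> W - {v}. c u + X u = 0} \<le> card {u \<in> W. c u = 0}"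
      using Suc.prems(1) by (intro card_mono) auto
    moreover have "sum c W = c v + sum c (W - {v})" using Suc.prems(1) v by (intro sum.remove) auto
    moreover have "sum c (W - {v}) \<le> sum (\<lambda>u. c u + X u) (W - {v})" by (intro sum_mono) auto
    moreover have "card W = Suc (card (W - {v}))" using Suc.hyps(2) n by simp
    ultimately show ?thesis using v(2) by linarith
  qed
qed

lemma emeasure_pmf_zero: "(\<And>x. x \<in> set_pmf p \<Longrightarrow> x \<notin> A) \<Longrightarrow> emeasure (measure_pmf p) A = 0"
  by (auto simp: measure_pmf.emeasure_eq_measure measure_pmf_zero_iff)

lemma emeasure_pmf_le: "1 \<le> x \<Longrightarrow> emeasure (measure_pmf p) A \<le> x"
  using measure_pmf.emeasure_le_1[of p A] order_trans by blast

text \<open>Combines the Chernoff factor \<open>(1 / s) ^ k\<close>, the factor \<open>s\<close> of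
  the seed patch at \<open>v0\<close> and the moment generating factor; the seed is the 1 in
  \<open>1 - real k\<close>.\<close>

lemma inverse_power_tilt:
  assumes "0 < (s::real)"
  shows "(1 / s) ^ k * (s * exp y) = exp ((1 - real k) * ln s + y)"
proof -
  have "s ^ k = exp (real k * ln s)" "s = exp (ln s)" using assms by (simp_all add: exp_of_nat_mult)
  then have "(1 / s) ^ k * (s * exp y) = inverse (exp (real k * ln s)) * (exp (ln s) * exp y)"
    by (metis inverse_eq_divide power_one_over)
  also have "\<dots> = exp ((1 - real k) * ln s + y)"
    by (simp only: exp_minus [symmetric] exp_add [symmetric]) (simp add: algebra_simps)
  finally show ?thesis .
qed

text \<open>The rates of a fresh patch accumulated over the first \<open>n\<close> collapses, for a fixed vertex
  and summed over the surviving vertices.\<close>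

definition patch_rate :: "(nat \<Rightarrow> real) \<Rightarrow> nat \<Rightarrow> real" where
  "patch_rate lam n = (\<Sum>j<n. (shift_rates ^^ j) lam 2)"

definition total_patch_rate :: "(nat \<Rightarrow> real) \<Rightarrow> nat \<Rightarrow> nat \<Rightarrow> real" where
  "total_patch_rate lam w n = (\<Sum>j<n. real (w - Suc j) * (shift_rates ^^ j) lam 2)"

lemma patch_rate_Suc: "patch_rate lam (Suc n) = lam 2 + patch_rate (shift_rates lam) n"
  by (simp add: patch_rate_def sum.lessThan_Suc_shift funpow_swap1 del: sum.lessThan_Suc)

lemma total_patch_rate_Suc:
  "total_patch_rate lam (Suc w) (Suc n) = real w * lam 2 + total_patch_rate (shift_rates lam) w n"
  by (simp add: total_patch_rate_def sum.lessThan_Suc_shift funpow_swap1 del: sum.lessThan_Suc)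

lemma power_card_eq_prod:
  "finite W \<Longrightarrow> (a :: 'b :: comm_monoid_mult) ^ card {u \<in> W. P u} = (\<Prod>u\<in>W. if P u then a else 1)"
  by (simp flip: prod.inter_filter)

lemma shift_rates_funpow_nonneg: "(\<And>k. 0 \<le> lam k) \<Longrightarrow> 0 \<le> (shift_rates ^^ j) lam k"
  by (induction j arbitrary: k) (auto simp: shift_rates_nonneg)

lemma patch_rate_nonneg: "(\<And>k. 0 \<le> lam k) \<Longrightarrow> 0 \<le> patch_rate lam n"
  by (auto simp: patch_rate_def intro!: sum_nonneg shift_rates_funpow_nonneg)

text \<open>An unpatched vertex stays unpatched during one collapse with probability \<open>exp (- lam 2)\<close>,
  independently of the others; hence \<open>s\<close> to the number of unpatched vertices
  has an explicit expectation.\<close>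

lemma chain_unpatched_bound:
  fixes C :: ennreal
  assumes s: "0 \<le> s" and G: "\<And>f Z. (f, Z) \<in> G \<Longrightarrow> f \<le> w'"
    and base: "\<And>lam W c z. finite W \<Longrightarrow> card W = w' \<Longrightarrow> (\<And>k. 0 \<le> lam k) \<Longrightarrow>
      emeasure (chain lam W c z) G \<le> C * ennreal (s ^ card {u \<in> W. c u = 0})"
    and W: "finite W" "card W = w' + n" and lam: "\<And>k. 0 \<le> lam k"
  shows "emeasure (chain lam W c z) G \<le>
    C * ennreal ((1 - exp (- patch_rate lam n) + exp (- patch_rate lam n) * s) ^ card {u \<in> W. c u = 0})"
  using W lam
proof (induction n arbitrary: lam W c z)
  case 0
  then show ?case using base[of W lam c z] by (simp add: patch_rate_def)
next
  case (Suc n)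
  show ?case
  proof (cases "\<exists>u\<in>W. c u \<noteq> 0")
    case False
    \<comment> \<open>Stopping now leaves more than \<open>w'\<close> survivors, so it contributes
      nothing to \<open>G\<close>.\<close>
    have "(card W, z) \<notin> G" using G[of "card W" z] Suc.prems by auto
    then show ?thesis using False Suc.prems by (simp add: chain_stop)
  next
    case True
    obtain v where v: "v \<in> W" "c v \<noteq> 0" and
      ch: "chain lam W c z = do {X \<leftarrow> Pi_pmf (W - {v}) 0 (\<lambda>_. poisson0_pmf (lam 2));
        chain (shift_rates lam) (W - {v}) (\<lambda>u. c u + X u) (z + c v)}"
      by (rule chain_step[where lam=lam and z=z, OF Suc.prems(1) True Suc.prems(3)])
    let ?W = "W - {v}"
    let ?q = "exp (- patch_rate (shift_rates lam) n)"
    define a where "a = 1 - ?q + ?q * s"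
    have a: "0 \<le> a" using s patch_rate_nonneg[of "shift_rates lam" n] Suc.prems(3)
      by (auto simp: a_def shift_rates_nonneg)
    have fin: "finite ?W" "card ?W = w' + n" using Suc.prems v by auto
    have "emeasure (chain lam W c z) G =
      (\<integral>\<^sup>+X. emeasure (chain (shift_rates lam) ?W (\<lambda>u. c u + X u) (z + c v)) G \<partial>Pi_pmf ?W 0 (\<lambda>_. poisson0_pmf (lam 2)))"
      unfolding ch by simp
    also have "\<dots> \<le> (\<integral>\<^sup>+X. C * ennreal (a ^ card {u \<in> ?W. c u + X u = 0}) \<partial>Pi_pmf ?W 0 (\<lambda>_. poisson0_pmf (lam 2)))"
      unfolding a_def using Suc.prems(3)
      by (intro nn_integral_mono Suc.IH fin) (auto simp: shift_rates_nonneg)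
    also have "\<dots> = C * (\<integral>\<^sup>+X. ennreal (a ^ card {u \<in> ?W. c u + X u = 0}) \<partial>Pi_pmf ?W 0 (\<lambda>_. poisson0_pmf (lam 2)))"
      by (intro nn_integral_cmult) auto
    also have "(\<integral>\<^sup>+X. ennreal (a ^ card {u \<in> ?W. c u + X u = 0}) \<partial>Pi_pmf ?W 0 (\<lambda>_. poisson0_pmf (lam 2)))
       = (\<integral>\<^sup>+X. (\<Prod>u\<in>?W. ennreal (if c u + X u = 0 then a else 1)) \<partial>Pi_pmf ?W 0 (\<lambda>_. poisson0_pmf (lam 2)))"
      using a fin by (intro nn_integral_cong, subst prod_ennreal, simp, subst power_card_eq_prod) auto
    also have "\<dots> = (\<Prod>u\<in>?W. \<integral>\<^sup>+x. ennreal (if c u + x = 0 then a else 1) \<partial>poisson0_pmf (lam 2))"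
      by (rule nn_integral_prod_Pi_pmf[OF fin(1)])
    also have "\<dots> = (\<Prod>u\<in>?W. ennreal (if c u = 0 then 1 - exp (- lam 2) + exp (- lam 2) * a else 1))"
      using nn_integral_poisson0_zero[OF Suc.prems(3) a, of 2] by (intro prod.cong refl) auto
    also have "\<dots> = ennreal ((1 - exp (- lam 2) + exp (- lam 2) * a) ^ card {u \<in> ?W. c u = 0})"
      using a fin Suc.prems(3)[of 2] by (subst prod_ennreal) (simp, subst power_card_eq_prod, auto)
    \<comment> \<open>The collapsed vertex was patched, so the exponent is unchanged and only the
      base evolves.\<close>
    also have "{u \<in> ?W. c u = 0} = {u \<in> W. c u = 0}" using v by auto
    also have "1 - exp (- lam 2) + exp (- lam 2) * a =
       1 - exp (- patch_rate lam (Suc n)) + exp (- patch_rate lam (Suc n)) * s"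
    proof -
      have e: "exp (- patch_rate lam (Suc n)) = exp (- lam 2) * ?q"
        by (simp add: patch_rate_Suc mult_exp_exp)
      show ?thesis by (simp add: a_def e algebra_simps)
    qed
    finally show ?thesis .
  qed
qed

text \<open>Here \<open>z + sum c W\<close> counts all patches created so far; one collapse adds a Poisson variable
  with mean \<open>(card W - 1) * lam 2\<close>.\<close>

lemma chain_patches_bound:
  fixes C :: ennreal
  assumes s: "0 \<le> s"
    and stop: "\<And>w z. w' < w \<Longrightarrow> (w, z) \<in> G \<Longrightarrow> 1 \<le> s \<and> 1 \<le> C * ennreal (s ^ z)"
    and base: "\<And>lam W c z. finite W \<Longrightarrow> card W = w' \<Longrightarrow> (\<And>k. 0 \<le> lam k) \<Longrightarrow>
      emeasure (chain lam W c z) G \<le> C * ennreal (s ^ (z + sum c W))"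
    and W: "finite W" "card W = w' + n" and lam: "\<And>k. 0 \<le> lam k"
  shows "emeasure (chain lam W c z) G \<le>
    C * ennreal (s ^ (z + sum c W) * exp (total_patch_rate lam (w' + n) n * (s - 1)))"
  using W lam
proof (induction n arbitrary: lam W c z)
  case 0
  then show ?case using base[of W lam c z] by (simp add: total_patch_rate_def)
next
  case (Suc n)
  show ?case
  proof (cases "\<exists>u\<in>W. c u \<noteq> 0")
    case False
    then have z: "sum c W = 0" by auto
    \<comment> \<open>An early stop inside \<open>G\<close> must be paid for by the bound itself.
      The premise \<open>stop\<close> forces \<open>1 \<le> s\<close> in that case, so the
      exponential factor is at least 1.\<close>
    have "0 \<le> total_patch_rate lam (w' + Suc n) (Suc n)"
      unfolding total_patch_rate_def using Suc.prems(3)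
      by (intro sum_nonneg mult_nonneg_nonneg shift_rates_funpow_nonneg) auto
    then have "1 \<le> C * ennreal (s ^ z * exp (total_patch_rate lam (w' + Suc n) (Suc n) * (s - 1)))"
      if "(card W, z) \<in> G"
    proof -
      have "1 \<le> s" "1 \<le> C * ennreal (s ^ z)" using stop[of "card W" z] that Suc.prems by auto
      moreover have "s ^ z * 1 \<le> s ^ z * exp (total_patch_rate lam (w' + Suc n) (Suc n) * (s - 1))"
        using \<open>1 \<le> s\<close> \<open>0 \<le> total_patch_rate lam (w' + Suc n) (Suc n)\<close> by (intro mult_left_mono) auto
      ultimately show ?thesis
        by (metis (no_types, lifting) ennreal_leI mult.right_neutral mult_left_mono order_trans zero_le)
    qed
    then show ?thesis using False Suc.prems by (auto simp: chain_stop z indicator_def)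
  next
    case True
    obtain v where v: "v \<in> W" "c v \<noteq> 0" and
      ch: "chain lam W c z = do {X \<leftarrow> Pi_pmf (W - {v}) 0 (\<lambda>_. poisson0_pmf (lam 2));
        chain (shift_rates lam) (W - {v}) (\<lambda>u. c u + X u) (z + c v)}"
      by (rule chain_step[where lam=lam and z=z, OF Suc.prems(1) True Suc.prems(3)])
    let ?W = "W - {v}" let ?P = "Pi_pmf ?W 0 (\<lambda>_. poisson0_pmf (lam 2))"
    define E where "E = exp (total_patch_rate (shift_rates lam) (w' + n) n * (s - 1))"
    have fin: "finite ?W" "card ?W = w' + n" using Suc.prems v by auto
    have sumW: "sum c W = c v + sum c ?W" using Suc.prems v by (intro sum.remove) auto
    have "emeasure (chain lam W c z) G =
      (\<integral>\<^sup>+X. emeasure (chain (shift_rates lam) ?W (\<lambda>u. c u + X u) (z + c v)) G \<partial>?P)"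
      unfolding ch by simp
    also have "\<dots> \<le> (\<integral>\<^sup>+X. C * ennreal (s ^ (z + c v + sum (\<lambda>u. c u + X u) ?W) * E) \<partial>?P)"
      unfolding E_def using Suc.prems(3)
      by (intro nn_integral_mono Suc.IH fin) (auto simp: shift_rates_nonneg)
    also have "\<dots> = (\<integral>\<^sup>+X. (C * ennreal (s ^ (z + sum c W) * E)) * (\<Prod>u\<in>?W. ennreal (s ^ X u)) \<partial>?P)"
      using s by (intro nn_integral_cong)
        (auto simp: sumW sum.distrib power_add power_sum ennreal_mult [symmetric] prod_ennreal prod_nonneg
          E_def mult_ac)
    also have "\<dots> = (C * ennreal (s ^ (z + sum c W) * E)) * (\<integral>\<^sup>+X. (\<Prod>u\<in>?W. ennreal (s ^ X u)) \<partial>?P)"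
      by (intro nn_integral_cmult) auto
    also have "(\<integral>\<^sup>+X. (\<Prod>u\<in>?W. ennreal (s ^ X u)) \<partial>?P) = (\<Prod>u\<in>?W. ennreal (exp (lam 2 * (s - 1))))"
      by (subst nn_integral_prod_Pi_pmf[OF fin(1)]) (simp add: nn_integral_poisson0_power[OF Suc.prems(3) s])
    also have "\<dots> = ennreal (exp (real (w' + n) * lam 2 * (s - 1)))"
      using fin by (simp add: ennreal_power exp_of_nat_mult [symmetric] mult.assoc)
    also have "(C * ennreal (s ^ (z + sum c W) * E)) * \<dots> =
      C * ennreal (s ^ (z + sum c W) * (E * exp (real (w' + n) * lam 2 * (s - 1))))"
      using s by (simp add: mult.assoc ennreal_mult [symmetric] E_def)
    also have "E * exp (real (w' + n) * lam 2 * (s - 1)) =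
       exp (total_patch_rate lam (w' + Suc n) (Suc n) * (s - 1))"
      by (simp add: E_def total_patch_rate_Suc mult_exp_exp algebra_simps)
    finally show ?thesis .
  qed
qed

section \<open>Closed forms of the accumulated rates\<close>

text \<open>With E the shift on rate sequences, \<open>shift_rates\<close> is 1 + E, so its powers
  expand binomially; the induction is Pascal's rule.\<close>

lemma shift_rates_funpow:
  "(shift_rates ^^ n) lam k = (\<Sum>i\<le>n. real (n choose i) * lam (k + i))"
proof (induction n arbitrary: k)
  case 0
  then show ?case by simp
next
  case (Suc n)
  have "(shift_rates ^^ Suc n) lam k = (\<Sum>i\<le>n. real (n choose i) * lam (k + i)) + (\<Sum>i\<le>n. real (n choose i) * lam (Suc k + i))"
    by (simp add: shift_rates_def Suc)
  also have "(\<Sum>i\<le>n. real (n choose i) * lam (k + i)) = lam k + (\<Sum>i\<le>n. real (n choose Suc i) * lam (k + Suc i))"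
  proof -
    have "(\<Sum>i\<le>n. real (n choose i) * lam (k + i)) = (\<Sum>i\<le>Suc n. real (n choose i) * lam (k + i))"
      by simp
    also have "\<dots> = lam k + (\<Sum>i\<le>n. real (n choose Suc i) * lam (k + Suc i))"
      by (subst sum.atMost_Suc_shift) simp
    finally show ?thesis .
  qed
  finally have "(shift_rates ^^ Suc n) lam k = lam k + (\<Sum>i\<le>n. real (Suc n choose Suc i) * lam (k + Suc i))"
    by (simp add: sum.distrib algebra_simps)
  then show ?case by (subst sum.atMost_Suc_shift) simp
qed

lemma shift_rates_funpow_Suc:
  "(shift_rates ^^ Suc n) lam k = (shift_rates ^^ n) lam k + (shift_rates ^^ n) lam (Suc k)"
  by (simp add: shift_rates_def)

text \<open>Telescoping: one shift raises the entry at size 1 by exactly the entry at size 2. The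
  entry at size 1 is pure bookkeeping, since \<open>revealed\<close> treats patches as
  known.\<close>

lemma patch_rate_eq: "lam 1 = 0 \<Longrightarrow> patch_rate lam n = (shift_rates ^^ n) lam 1"
  by (induction n) (simp_all add: patch_rate_def shift_rates_funpow_Suc numeral_2_eq_2 del: funpow.simps(2))

text \<open>Discrete form of \<beta> x + (1 - x) \<beta>' x: edges inside the collapsed set plus
  patches seen by the survivors. In each step, what the second term loses with the removed vertex is
  gained by the first.\<close>

lemma total_patch_rate_eq:
  assumes "lam 0 = 0" "lam 1 = 0" "n \<le> w"
  shows "total_patch_rate lam w n = (shift_rates ^^ n) lam 0 + real (w - n) * (shift_rates ^^ n) lam 1"
  using assms(3)
proof (induction n)
  case 0
  then show ?case using assms by (simp add: total_patch_rate_def)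
next
  case (Suc n)
  then have "total_patch_rate lam w (Suc n) = (shift_rates ^^ n) lam 0 + real (w - n) * (shift_rates ^^ n) lam 1
     + real (w - Suc n) * (shift_rates ^^ n) lam 2"
    by (simp add: total_patch_rate_def)
  moreover have "real (w - n) = real (w - Suc n) + 1" using Suc.prems by simp
  ultimately show ?case by (simp add: shift_rates_funpow_Suc numeral_2_eq_2 algebra_simps del: funpow.simps(2))
qed

definition domain_law :: "(nat \<Rightarrow> real) \<Rightarrow> nat \<Rightarrow> nat \<Rightarrow> (nat \<times> nat) pmf" where
  "domain_law \<beta> v0 N = map_pmf (\<lambda>L. (card (domain_of {1..N} L v0), identifiable_from {1..N} L v0))
     (poisson_hypergraph \<beta> N)"

section \<open>Chernoff bounds for the domain size and the edge count\<close>

locale poisson_parameters =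
  fixes \<beta> :: "nat \<Rightarrow> real" and v0 :: nat
  assumes \<beta>_nonneg: "0 \<le> \<beta> k" and \<beta>0: "\<beta> 0 = 0" and \<beta>1: "\<beta> (Suc 0) = 0" and v0_pos: "1 \<le> v0"
begin

abbreviation "rates \<equiv> initial_rates \<beta>"
abbreviation "seed \<equiv> \<lambda>u. if u = v0 then 1 else 0 :: nat"

lemma rates_nonneg: "0 \<le> rates N k"
  by (simp add: initial_rates_def \<beta>_nonneg)

lemma prob_domain_law:
  assumes "v0 \<le> N"
  shows "measure_pmf.prob (domain_law \<beta> v0 N) A =
    measure_pmf.prob (chain (rates N) {1..N} seed 0) {(f, Z). (N - f, Z) \<in> A}"
proof -
  have "domain_law \<beta> v0 N = map_pmf (\<lambda>(w, z). (N - w, z)) (chain (rates N) {1..N} seed 0)"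
    unfolding domain_law_def using assms \<beta>0 \<beta>1 v0_pos by (intro poisson_hypergraph_chain) auto
  then show ?thesis by (simp add: vimage_def case_prod_unfold)
qed

lemma seed_unpatched: "v0 \<le> N \<Longrightarrow> card {u \<in> {1..N}. seed u = 0} = N - 1"
proof -
  assume "v0 \<le> N"
  have "{u \<in> {1..N}. seed u = 0} = {1..N} - {v0}" by auto
  then show ?thesis using \<open>v0 \<le> N\<close> v0_pos by simp
qed

lemma seed_sum: "v0 \<le> N \<Longrightarrow> sum seed {1..N} = 1"
  using v0_pos by simp

lemma set_domain_law:
  assumes "v0 \<le> N" "(T, Z) \<in> set_pmf (domain_law \<beta> v0 N)"
  shows "T \<le> N" "T \<le> Z"
proof -
  have "domain_law \<beta> v0 N = map_pmf (\<lambda>(w, z). (N - w, z)) (chain (rates N) {1..N} seed 0)"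
    unfolding domain_law_def using assms \<beta>0 \<beta>1 v0_pos by (intro poisson_hypergraph_chain) auto
  then obtain f where "(f, Z) \<in> set_pmf (chain (rates N) {1..N} seed 0)" "T = N - f"
    using assms(2) by auto
  then show "T \<le> N" "T \<le> Z"
    using chain_support[of "{1..N}" "rates N" f Z seed 0] rates_nonneg by auto
qed

abbreviation "patch_prob N n \<equiv> 1 - exp (- patch_rate (rates N) n)"

text \<open>With \<open>p\<close> the chance of having been patched, each of the
  \<open>N - 1\<close> initially unpatched vertices contributes
  \<open>(1 + p * (t - 1)) / t\<close>, bounded through \<open>1 + x \<le> exp x\<close>. Against
  \<open>t ^ (N - b)\<close> the powers of \<open>t\<close> cancel down to the term
  \<open>(1 - real b) * ln t\<close>.\<close>

lemma power_tilt_bound: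
  assumes "0 < (t::real)" "0 \<le> p" "p \<le> 1" "b \<le> N" "1 \<le> N"
  shows "t ^ (N - b) * (1 - (1 - p) + (1 - p) * (1 / t)) ^ (N - 1) \<le>
    exp ((1 - real b) * ln t + (real N - 1) * p * (t - 1))" 
  (is "?L \<le> ?R")
proof -
  have "1 - (1 - p) + (1 - p) * (1 / t) = (1 + p * (t - 1)) / t"
    using assms by (simp add: field_simps)
  also have "\<dots> \<le> exp (p * (t - 1)) / t" using assms
    by (intro divide_right_mono exp_ge_add_one_self) auto
  finally have "1 - (1 - p) + (1 - p) * (1 / t) \<le> exp (p * (t - 1)) / t" .
  then have "?L \<le> t ^ (N - b) * (exp (p * (t - 1)) / t) ^ (N - 1)"
    using assms by (intro mult_left_mono power_mono add_nonneg_nonneg mult_nonneg_nonneg) auto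
  also have "\<dots> = ?R"
  proof -
    have N: "real (N - 1) = real N - 1" "real (N - b) = real N - real b" using assms by auto
    have "t ^ (N - b) * (exp (p * (t - 1)) / t) ^ (N - 1) =
      exp (real (N - b) * ln t) * (exp (real (N - 1) * (p * (t - 1))) / exp (real (N - 1) * ln t))"
      using assms(1) by (simp add: power_divide exp_of_nat_mult)
    also have "\<dots> = ?R"
      unfolding N by (simp only: exp_diff [symmetric] exp_add [symmetric]) (simp add: algebra_simps)
    finally show ?thesis .
  qed
  finally show ?thesis .
qed

text \<open>A collapse that reaches step \<open>a\<close> and ends with \<open>T \<le> b\<close> has
  at least \<open>N - b\<close> unpatched vertices after \<open>a\<close> collapses. An exponential
  Markov bound with weight \<open>1 / t \<ge> 1\<close> per unpatched vertex makes this unlikely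
  when \<open>b\<close> is below the expected number patched by then.\<close>

lemma prob_domain_between:
  assumes N: "v0 \<le> N" and ab: "1 \<le> a" "a \<le> b" "b \<le> N" and t: "0 < t" "t \<le> 1"
  shows "measure_pmf.prob (domain_law \<beta> v0 N) {(T, Z). a \<le> T \<and> T \<le> b} \<le>
    exp ((1 - real b) * ln t + (real N - 1) * patch_prob N a * (t - 1))"
proof -
  let ?G = "{(f, Z). f \<le> N - a \<and> N - b \<le> f}"
  have st: "1 \<le> 1 / t" using t by simp
  have "emeasure (chain (rates N) {1..N} seed 0) ?G \<le> ennreal (t ^ (N - b)) *
    ennreal ((1 - exp (- patch_rate (rates N) a) + exp (- patch_rate (rates N) a) * (1 / t)) ^ card {u \<in> {1..N}. seed u = 0})"
  proof (rule chain_unpatched_bound[where w' = "N - a" and n = a])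
    fix lam :: "nat \<Rightarrow> real" and W :: "nat set" and c :: "nat \<Rightarrow> nat" and z :: nat
    assume W: "finite W" "card W = N - a" and lam: "\<And>k. 0 \<le> lam k"
    show "emeasure (chain lam W c z) ?G \<le> ennreal (t ^ (N - b)) * ennreal ((1 / t) ^ card {u \<in> W. c u = 0})"
    proof (cases "N - b \<le> card {u \<in> W. c u = 0}")
      case True
      have "1 = t ^ (N - b) * (1 / t) ^ (N - b)" using t by (simp add: power_one_over)
      also have "\<dots> \<le> t ^ (N - b) * (1 / t) ^ card {u \<in> W. c u = 0}"
        using t st True by (intro mult_left_mono power_increasing) auto
      finally have "1 \<le> ennreal (t ^ (N - b)) * ennreal ((1 / t) ^ card {u \<in> W. c u = 0})"
        using t by (simp add: ennreal_mult' [symmetric])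
      then show ?thesis by (rule emeasure_pmf_le)
    next
      case False
      have "x \<notin> ?G" if "x \<in> set_pmf (chain lam W c z)" for x
        using chain_support[of W lam "fst x" "snd x" c z, OF W(1) lam] that False by auto
      then show ?thesis by (simp add: emeasure_pmf_zero)
    qed
  qed (use ab t rates_nonneg in auto)
  also have "\<dots> = ennreal (t ^ (N - b) * (1 - (1 - patch_prob N a) + (1 - patch_prob N a) * (1 / t)) ^ (N - 1))"
    using t patch_rate_nonneg[OF rates_nonneg] unfolding seed_unpatched[OF N]
    by (simp add: ennreal_mult' [symmetric])
  also have "\<dots> \<le> ennreal (exp ((1 - real b) * ln t + (real N - 1) * patch_prob N a * (t - 1)))"
    using t ab N v0_pos patch_rate_nonneg[of "rates N" a, OF rates_nonneg]
    by (intro ennreal_leI power_tilt_bound) auto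
  finally have "measure_pmf.prob (chain (rates N) {1..N} seed 0) ?G \<le>
      exp ((1 - real b) * ln t + (real N - 1) * patch_prob N a * (t - 1))"
    by (simp add: measure_pmf.emeasure_eq_measure)
  moreover have "{(f, Z :: nat). (N - f, Z) \<in> {(T, Z). a \<le> T \<and> T \<le> b}} = ?G"
    using ab by auto
  ultimately show ?thesis unfolding prob_domain_law[OF N] by (simp only:)
qed

text \<open>Dual argument: at step \<open>a\<close> all unpatched vertices are among the
  \<open>N - a\<close> survivors, so there are few of them, which the weight
  \<open>1 / t \<le> 1\<close> detects.\<close>

lemma prob_domain_ge:
  assumes N: "v0 \<le> N" and a: "a \<le> N" and t: "1 \<le> t"
  shows "measure_pmf.prob (domain_law \<beta> v0 N) {(T, Z). a \<le> T} \<le>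
    exp ((1 - real a) * ln t + (real N - 1) * patch_prob N a * (t - 1))"
\<comment> \<open>By truncated subtraction \<open>0 \<le> N - f\<close> also holds for
  \<open>f > N\<close>, so the identification with \<open>?G\<close> at the end needs
  \<open>a \<noteq> 0\<close>. For \<open>a = 0\<close> the bound is at least 1.\<close>
proof (cases "a = 0")
  case True
  have "0 \<le> ln t" using t by simp
  then have "1 \<le> exp ((1 - real a) * ln t + (real N - 1) * patch_prob N a * (t - 1))"
    using True by (simp add: patch_rate_def)
  then show ?thesis using order_trans measure_pmf.prob_le_1 by blast
next
  case False
  let ?G = "{(f, Z). f \<le> N - a}"
  have "emeasure (chain (rates N) {1..N} seed 0) ?G \<le> ennreal (t ^ (N - a)) *
    ennreal ((1 - exp (- patch_rate (rates N) a) + exp (- patch_rate (rates N) a) * (1 / t)) ^ card {u \<in> {1..N}. seed u = 0})"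
  proof (rule chain_unpatched_bound[where w' = "N - a" and n = a])
    fix lam :: "nat \<Rightarrow> real" and W :: "nat set" and c :: "nat \<Rightarrow> nat" and z :: nat
    assume W: "finite W" "card W = N - a"
    have "1 = t ^ (N - a) * (1 / t) ^ (N - a)" using t by (simp add: power_one_over)
    also have "\<dots> \<le> t ^ (N - a) * (1 / t) ^ card {u \<in> W. c u = 0}"
      using t W card_mono[of W "{u \<in> W. c u = 0}"] by (intro mult_left_mono power_decreasing) auto
    finally have "1 \<le> ennreal (t ^ (N - a)) * ennreal ((1 / t) ^ card {u \<in> W. c u = 0})"
      using t by (simp add: ennreal_mult' [symmetric])
    then show "emeasure (chain lam W c z) ?G \<le> ennreal (t ^ (N - a)) * ennreal ((1 / t) ^ card {u \<in> W. c u = 0})"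
      by (rule emeasure_pmf_le)
  qed (use a t rates_nonneg in auto)
  also have "\<dots> = ennreal (t ^ (N - a) * (1 - (1 - patch_prob N a) + (1 - patch_prob N a) * (1 / t)) ^ (N - 1))"
    using t patch_rate_nonneg[OF rates_nonneg] unfolding seed_unpatched[OF N]
    by (simp add: ennreal_mult' [symmetric])
  also have "\<dots> \<le> ennreal (exp ((1 - real a) * ln t + (real N - 1) * patch_prob N a * (t - 1)))"
    using t a N v0_pos patch_rate_nonneg[of "rates N" a, OF rates_nonneg]
    by (intro ennreal_leI power_tilt_bound) auto
  finally have "measure_pmf.prob (chain (rates N) {1..N} seed 0) ?G \<le>
      exp ((1 - real a) * ln t + (real N - 1) * patch_prob N a * (t - 1))"
    by (simp add: measure_pmf.emeasure_eq_measure)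
  moreover have "{(f, Z :: nat). (N - f, Z) \<in> {(T, Z). a \<le> T}} = ?G"
    using a False by auto
  ultimately show ?thesis unfolding prob_domain_law[OF N] by (simp only:)
qed

text \<open>All patches created in the first \<open>a\<close> collapses count towards
  \<open>Z\<close>, so few edges means few patches by then. The event excludes stopping before step
  \<open>a\<close>, which is why \<open>s \<le> 1\<close> is admissible in
  \<open>chain_patches_bound\<close>.\<close>

lemma prob_edges_le:
  assumes N: "v0 \<le> N" and a: "a \<le> N" "1 \<le> a" and s: "0 < s" "s \<le> 1"
  shows "measure_pmf.prob (domain_law \<beta> v0 N) {(T, Z). a \<le> T \<and> Z \<le> \<zeta>} \<le>
    exp ((1 - real \<zeta>) * ln s + total_patch_rate (rates N) N a * (s - 1))"
proof -
  let ?G = "{(f, Z). f \<le> N - a \<and> Z \<le> \<zeta>}"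
  have Na: "N - a + a = N" using a by simp
  have "emeasure (chain (rates N) {1..N} seed 0) ?G \<le> ennreal ((1 / s) ^ \<zeta>) *
    ennreal (s ^ (0 + sum seed {1..N}) * exp (total_patch_rate (rates N) (N - a + a) a * (s - 1)))"
  proof (rule chain_patches_bound[where w' = "N - a" and n = a])
    fix lam :: "nat \<Rightarrow> real" and W :: "nat set" and c :: "nat \<Rightarrow> nat" and z :: nat
    assume W: "finite W" "card W = N - a" and lam: "\<And>k. 0 \<le> lam k"
    show "emeasure (chain lam W c z) ?G \<le> ennreal ((1 / s) ^ \<zeta>) * ennreal (s ^ (z + sum c W))"
    proof (cases "z + sum c W \<le> \<zeta>")
      case True
      have "1 = (1 / s) ^ \<zeta> * s ^ \<zeta>" using s by (simp add: power_one_over)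
      also have "\<dots> \<le> (1 / s) ^ \<zeta> * s ^ (z + sum c W)"
        using s True by (intro mult_left_mono power_decreasing) auto
      finally have "1 \<le> ennreal ((1 / s) ^ \<zeta>) * ennreal (s ^ (z + sum c W))"
        using s by (simp add: ennreal_mult' [symmetric])
      then show ?thesis by (rule emeasure_pmf_le)
    next
      case False
      have "x \<notin> ?G" if "x \<in> set_pmf (chain lam W c z)" for x
        using chain_support[of W lam "fst x" "snd x" c z, OF W(1) lam] that False by auto
      then show ?thesis by (simp add: emeasure_pmf_zero)
    qed
  qed (use a s rates_nonneg in auto)
  also have "\<dots> = ennreal (exp ((1 - real \<zeta>) * ln s + total_patch_rate (rates N) N a * (s - 1)))"
    unfolding seed_sum[OF N] Na using s
    by (simp add: ennreal_mult' [symmetric] inverse_power_tilt[symmetric] del: times_divide_eq_left power_one_over)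
  finally have "measure_pmf.prob (chain (rates N) {1..N} seed 0) ?G \<le>
      exp ((1 - real \<zeta>) * ln s + total_patch_rate (rates N) N a * (s - 1))"
    by (simp add: measure_pmf.emeasure_eq_measure)
  moreover have "{(f, Z :: nat). (N - f, Z) \<in> {(T, Z). a \<le> T \<and> Z \<le> \<zeta>}} = ?G"
    using a by auto
  ultimately show ?thesis unfolding prob_domain_law[OF N] by (simp only:)
qed

text \<open>Here the collapse may stop before step \<open>b\<close>; since \<open>s \<ge> 1\<close>,
  continuing the bound up to step \<open>b\<close> only enlarges it.\<close>

lemma prob_edges_ge:
  assumes N: "v0 \<le> N" and b: "b \<le> N" and s: "1 \<le> s"
  shows "measure_pmf.prob (domain_law \<beta> v0 N) {(T, Z). T \<le> b \<and> \<zeta> \<le> Z} \<le>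
    exp ((1 - real \<zeta>) * ln s + total_patch_rate (rates N) N b * (s - 1))"
proof -
  let ?G = "{(f, Z). N - b \<le> f \<and> \<zeta> \<le> Z}"
  have Nb: "N - b + b = N" using b by simp
  have one: "1 \<le> ennreal ((1 / s) ^ \<zeta>) * ennreal (s ^ k)" if "\<zeta> \<le> k" for k
  proof -
    have "1 = (1 / s) ^ \<zeta> * s ^ \<zeta>" using s by (simp add: power_one_over)
    also have "\<dots> \<le> (1 / s) ^ \<zeta> * s ^ k"
      using s that by (intro mult_left_mono power_increasing) auto
    finally show ?thesis using s by (simp add: ennreal_mult' [symmetric])
  qed
  have "emeasure (chain (rates N) {1..N} seed 0) ?G \<le> ennreal ((1 / s) ^ \<zeta>) *
    ennreal (s ^ (0 + sum seed {1..N}) * exp (total_patch_rate (rates N) (N - b + b) b * (s - 1)))"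
  proof (rule chain_patches_bound[where w' = "N - b" and n = b])
    fix lam :: "nat \<Rightarrow> real" and W :: "nat set" and c :: "nat \<Rightarrow> nat" and z :: nat
    assume W: "finite W" "card W = N - b" and lam: "\<And>k. 0 \<le> lam k"
    show "emeasure (chain lam W c z) ?G \<le> ennreal ((1 / s) ^ \<zeta>) * ennreal (s ^ (z + sum c W))"
    \<comment> \<open>With \<open>N - b\<close> vertices left, \<open>?G\<close> allows no further
      removal: the collapse must stop here, with edge count \<open>z\<close>.\<close>
    proof (cases "(\<forall>u\<in>W. c u = 0) \<and> \<zeta> \<le> z")
      case True
      then have "sum c W = 0" by simp
      then show ?thesis using one[of z] True by (intro emeasure_pmf_le) simp
    next
      case False
      have "x \<notin> ?G" if x: "x \<in> set_pmf (chain lam W c z)" for x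
      proof (cases "\<forall>u\<in>W. c u = 0")
        case True
        then show ?thesis using False W x by (auto simp: chain_stop)
      next
        case nz: False
        then obtain u where "u \<in> W" "c u \<noteq> 0" by auto
        then have "u \<notin> {u \<in> W. c u = 0}" by simp
        with \<open>u \<in> W\<close> have "{u \<in> W. c u = 0} \<subset> W" by (metis (no_types, lifting) mem_Collect_eq psubsetI subsetI)
        then have "card {u \<in> W. c u = 0} < N - b" using W psubset_card_mono by metis
        then show ?thesis using chain_support[of W lam "fst x" "snd x" c z, OF W(1) lam] x by auto
      qed
      then show ?thesis by (simp add: emeasure_pmf_zero)
    qed
  qed (use b s rates_nonneg one in auto)
  also have "\<dots> = ennreal (exp ((1 - real \<zeta>) * ln s + total_patch_rate (rates N) N b * (s - 1)))"
    unfolding seed_sum[OF N] Nb using s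
    by (simp add: ennreal_mult' [symmetric] inverse_power_tilt[symmetric] del: times_divide_eq_left power_one_over)
  finally have "measure_pmf.prob (chain (rates N) {1..N} seed 0) ?G \<le>
      exp ((1 - real \<zeta>) * ln s + total_patch_rate (rates N) N b * (s - 1))"
    by (simp add: measure_pmf.emeasure_eq_measure)
  moreover have "{(f, Z :: nat). (N - f, Z) \<in> {(T, Z). T \<le> b \<and> \<zeta> \<le> Z}} \<subseteq> ?G"
    using b by auto
  ultimately show ?thesis unfolding prob_domain_law[OF N]
    by - (rule order_trans[OF measure_pmf.finite_measure_mono], assumption, simp, assumption)
qed

end

section \<open>The local limit\<close>


text \<open>Law of the first hitting time of 0 for the walk with increments -1 + Poisson(l) started
  at \<open>r\<close>, by first-step decomposition. The sum may end at \<open>k = n\<close>: the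
  walk descends by at most 1 per step, so larger \<open>k\<close> cannot reach 0 in \<open>n\<close>
  further steps. Being finite, the sum passes to limits termwise.\<close>

primrec hit_prob :: "real \<Rightarrow> nat \<Rightarrow> nat \<Rightarrow> real" where
  "hit_prob l 0 r = (if r = 0 then 1 else 0)"
| "hit_prob l (Suc n) r =
    (if r = 0 then 0 else \<Sum>k\<le>n. pmf (poisson0_pmf l) k * hit_prob l n (r - 1 + k))"

lemma hit_prob_eq_0: "n < r \<Longrightarrow> hit_prob l n r = 0"
  by (induction n arbitrary: r) auto

lemma hit_prob_nonzero: "hit_prob l n r \<noteq> 0 \<Longrightarrow> r \<le> n"
  using hit_prob_eq_0 not_le by blast

lemma hit_prob_nonneg: "0 \<le> hit_prob l n r"
  by (induction n arbitrary: r) (auto intro!: sum_nonneg)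

lemma expectation_hit_prob:
  "measure_pmf.expectation (poisson0_pmf l) (\<lambda>k. hit_prob l' n (r + k)) =
     (\<Sum>k\<le>n. pmf (poisson0_pmf l) k * hit_prob l' n (r + k))"
  by (subst integral_measure_pmf[of "{..n}"]) (auto dest: hit_prob_nonzero)

lemma hit_prob_le_1: "hit_prob l n r \<le> 1"
proof (induction n arbitrary: r)
  case (Suc n)
  have "(\<Sum>k\<le>n. pmf (poisson0_pmf l) k * hit_prob l n (r - 1 + k)) \<le> (\<Sum>k\<le>n. pmf (poisson0_pmf l) k * 1)"
    using Suc by (intro sum_mono mult_left_mono) auto
  also have "\<dots> = measure_pmf.prob (poisson0_pmf l) {..n}"
    by (simp add: measure_measure_pmf_finite)
  also have "\<dots> \<le> 1" by simp
  finally show ?case by (cases "r = 0") (simp, simp only: hit_prob.simps if_False)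
qed auto

lemma prob_poisson0_ge_1: "0 \<le> r \<Longrightarrow> measure_pmf.prob (poisson0_pmf r) {x. x \<noteq> 0} \<le> r"
proof -
  assume r: "0 \<le> r"
  have "{x::nat. x \<noteq> 0} = UNIV - {0}" by auto
  then have "measure_pmf.prob (poisson0_pmf r) {x. x \<noteq> 0} = 1 - exp (- r)"
    using measure_pmf.prob_compl[of "{0::nat}" "poisson0_pmf r"] r
    by (simp add: measure_pmf_single pmf_poisson0)
  also have "\<dots> \<le> r" using exp_ge_add_one_self[of "- r"] by simp
  finally show ?thesis .
qed

lemma prob_poisson0_ge_2: "0 \<le> r \<Longrightarrow> measure_pmf.prob (poisson0_pmf r) {x. 2 \<le> x} \<le> r\<^sup>2"
proof -
  assume r: "0 \<le> r"
  have "{x::nat. 2 \<le> x} = UNIV - {0, 1}" by auto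
  then have "measure_pmf.prob (poisson0_pmf r) {x. 2 \<le> x} = 1 - (1 + r) * exp (- r)"
    using measure_pmf.prob_compl[of "{0, 1::nat}" "poisson0_pmf r"] r
    by (simp add: measure_measure_pmf_finite pmf_poisson0 algebra_simps)
  also have "\<dots> \<le> 1 - (1 + r) * (1 - r)"
    using exp_ge_add_one_self[of "- r"] r by (intro diff_left_mono mult_left_mono) auto
  finally show ?thesis by (simp add: power2_eq_square algebra_simps)
qed

lemma card_filter_split: "finite W \<Longrightarrow> card W = card {u \<in> W. P u} + card {u \<in> W. \<not> P u}"
proof -
  assume W: "finite W"
  have "W = {u \<in> W. P u} \<union> {u \<in> W. \<not> P u}" by blast
  moreover have "card ({u \<in> W. P u} \<union> {u \<in> W. \<not> P u}) = card {u \<in> W. P u} + card {u \<in> W. \<not> P u}"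
    using W by (intro card_Un_disjoint) auto
  ultimately show ?thesis by simp
qed

lemma card_newly_patched_eq_sum:
  assumes "finite W" "\<And>u. u \<in> W \<Longrightarrow> X u \<le> 1" "\<And>u. u \<in> W \<Longrightarrow> c u \<noteq> 0 \<Longrightarrow> X u = (0::nat)"
  shows "card {u \<in> W. c u = 0 \<and> X u \<noteq> 0} = sum X W"
proof -
  have "sum X W = (\<Sum>u\<in>W. if c u = 0 \<and> X u \<noteq> 0 then 1 else 0)"
    using assms(2,3) by (intro sum.cong) (force simp: le_Suc_eq)+
  also have "\<dots> = card {u \<in> W. c u = 0 \<and> X u \<noteq> 0}"
    using assms(1) by (simp add: sum.If_cases Int_def)
  finally show ?thesis by simp
qed

text \<open>A mismatch requires two fresh patches on one vertex, of probability at most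
  \<open>\<mu>\<^sup>2\<close> for each vertex, or a fresh patch on a vertex already patched. With
  \<mu> of order 1 / N and a fixed number of active vertices, both sums vanish in the limit.\<close>

lemma prob_collision_bound:
  assumes "finite W" "0 \<le> \<mu>"
  shows "measure_pmf.prob (Pi_pmf W 0 (\<lambda>_. poisson0_pmf \<mu>))
      {X. card {u \<in> W. c u = 0 \<and> X u \<noteq> 0} \<noteq> sum X W} \<le>
    real (card W) * \<mu>\<^sup>2 + real (card {u \<in> W. c u \<noteq> 0}) * \<mu>"
proof -
  let ?P = "Pi_pmf W 0 (\<lambda>_. poisson0_pmf \<mu>)"
  have comp: "measure_pmf.prob ?P {X. Q (X u)} = measure_pmf.prob (poisson0_pmf \<mu>) {x. Q x}"
    if "u \<in> W" for u Q
  proof -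
    have "poisson0_pmf \<mu> = map_pmf (\<lambda>X. X u) ?P"
      using Pi_pmf_component[OF assms(1), of u 0 "\<lambda>_. poisson0_pmf \<mu>"] that by simp
    then show ?thesis by (metis measure_map_pmf vimage_Collect_eq)
  qed
  let ?A = "\<lambda>u. {X :: _ \<Rightarrow> nat. 2 \<le> X u}" let ?B = "\<lambda>u. {X :: _ \<Rightarrow> nat. X u \<noteq> 0}"
  let ?C = "{u \<in> W. c u \<noteq> 0}"
  have "{X. card {u \<in> W. c u = 0 \<and> X u \<noteq> 0} \<noteq> sum X W} \<subseteq> (\<Union>u\<in>W. ?A u) \<union> (\<Union>u\<in>?C. ?B u)"
  proof (rule subsetI, rule ccontr)
    fix X assume X: "X \<in> {X. card {u \<in> W. c u = 0 \<and> X u \<noteq> 0} \<noteq> sum X W}"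
      "X \<notin> (\<Union>u\<in>W. ?A u) \<union> (\<Union>u\<in>?C. ?B u)"
    then have "\<And>u. u \<in> W \<Longrightarrow> X u \<le> 1" "\<And>u. u \<in> W \<Longrightarrow> c u \<noteq> 0 \<Longrightarrow> X u = 0" by force+
    then show False using card_newly_patched_eq_sum[OF assms(1), of X c] X(1) by simp
  qed
  then have "measure_pmf.prob ?P {X. card {u \<in> W. c u = 0 \<and> X u \<noteq> 0} \<noteq> sum X W} \<le>
     measure_pmf.prob ?P ((\<Union>u\<in>W. ?A u) \<union> (\<Union>u\<in>?C. ?B u))"
    by (intro measure_pmf.finite_measure_mono) auto
  also have "\<dots> \<le> measure_pmf.prob ?P (\<Union>u\<in>W. ?A u) + measure_pmf.prob ?P (\<Union>u\<in>?C. ?B u)"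
    by (intro measure_Un_le) auto
  also have "\<dots> \<le> (\<Sum>u\<in>W. measure_pmf.prob ?P (?A u)) + (\<Sum>u\<in>?C. measure_pmf.prob ?P (?B u))"
    using assms(1) by (intro add_mono measure_pmf.finite_measure_subadditive_finite) auto
  also have "\<dots> \<le> (\<Sum>u\<in>W. \<mu>\<^sup>2) + (\<Sum>u\<in>?C. \<mu>)"
    using assms(2) by (intro add_mono sum_mono)
      (simp_all only: comp[where Q = "\<lambda>x. 2 \<le> x"] comp[where Q = "\<lambda>x. x \<noteq> 0"] mem_Collect_eq
        conjunct1 prob_poisson0_ge_1 prob_poisson0_ge_2)
  finally show ?thesis by simp
qed

lemma expectation_approx:
  fixes f g :: "'a \<Rightarrow> real"
  assumes "\<And>x. x \<in> set_pmf p \<Longrightarrow> \<bar>f x - g x\<bar> \<le> e + indicator A x"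
    and "\<And>x. \<bar>f x\<bar> \<le> B" "\<And>x. \<bar>g x\<bar> \<le> B'"
  shows "\<bar>measure_pmf.expectation p f - measure_pmf.expectation p g\<bar> \<le> e + measure_pmf.prob p A"
proof -
  have int: "integrable p F" if "\<And>x. \<bar>F x\<bar> \<le> C" for F :: "'a \<Rightarrow> real" and C
    using that by (intro measure_pmf.integrable_const_bound[where B = C]) auto
  have f: "integrable p f" and g: "integrable p g" and h: "integrable p (\<lambda>x. e + indicator A x :: real)"
    by (rule int[OF assms(2)], rule int[OF assms(3)], rule int[of _ "\<bar>e\<bar> + 1"])
      (use abs_triangle_ineq[of e 1] in \<open>simp add: indicator_def\<close>)
  have "measure_pmf.expectation p f - measure_pmf.expectation p g = measure_pmf.expectation p (\<lambda>x. f x - g x)"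
    using f g by simp
  also have "\<bar>\<dots>\<bar> \<le> measure_pmf.expectation p (\<lambda>x. \<bar>f x - g x\<bar>)"
    by (rule integral_abs_bound)
  also have "\<dots> \<le> measure_pmf.expectation p (\<lambda>x. e + indicator A x)"
    using f g h assms(1) by (intro integral_mono_AE) (auto simp: AE_measure_pmf_iff)
  also have "\<dots> = e + measure_pmf.prob p A"
    using int[of "indicator A" 1] int[of "\<lambda>_. e" "\<bar>e\<bar>"]
    by (subst Bochner_Integration.integral_add) (simp_all add: indicator_def)
  finally show ?thesis .
qed

text \<open>Given the patches, one collapse changes the number of active vertices by the number of newly
  patched ones, which is the number of new patches unless two of them meet.\<close>

lemma chain_local_step:
  fixes W :: "nat set" and c :: "nat \<Rightarrow> nat"
  assumes W: "finite W" and lam: "\<And>k. 0 \<le> lam k" and r: "card {u \<in> W. c u \<noteq> 0} = r" "r \<noteq> 0"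
    and IH: "\<And>W c z. finite W \<Longrightarrow> Suc (card W) = w \<Longrightarrow> card {u \<in> W. c u \<noteq> 0} \<le> n \<Longrightarrow>
      \<bar>measure_pmf.prob (chain (shift_rates lam) W c z) {(f, Z). f + n = card W} - hit_prob l n (card {u \<in> W. c u \<noteq> 0})\<bar> \<le> e \<and>
      \<bar>measure_pmf.prob (chain (shift_rates lam) W c z) {(f, Z). f + n = card W \<and> Z + card {u \<in> W. c u \<noteq> 0} = z + sum c W + n}
        - hit_prob l n (card {u \<in> W. c u \<noteq> 0})\<bar> \<le> e"
    and w: "card W = w" and e: "0 \<le> e"
  defines "\<mu> \<equiv> lam 2"
  defines "d \<equiv> e + (real (w - 1) * \<mu>\<^sup>2 + real r * \<mu>)"
  defines "m \<equiv> (\<Sum>k\<le>n. pmf (poisson0_pmf (real (w - 1) * \<mu>)) k * hit_prob l n (r - 1 + k))"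
  shows "\<bar>measure_pmf.prob (chain lam W c z) {(f, Z). f + Suc n = card W} - m\<bar> \<le> d"
    and "\<bar>measure_pmf.prob (chain lam W c z) {(f, Z). f + Suc n = card W \<and> Z + r = z + sum c W + Suc n} - m\<bar> \<le> d"
proof -
  have "\<exists>u\<in>W. c u \<noteq> 0" using r by (metis (mono_tags, lifting) Collect_empty_eq card.empty)
  from chain_step[where lam = lam and z = z, OF W this lam]
  obtain v where v: "v \<in> W" "c v \<noteq> 0" and
      ch: "chain lam W c z = do {X \<leftarrow> Pi_pmf (W - {v}) 0 (\<lambda>_. poisson0_pmf (lam 2));
        chain (shift_rates lam) (W - {v}) (\<lambda>u. c u + X u) (z + c v)}" .
  let ?W = "W - {v}" let ?P = "Pi_pmf ?W 0 (\<lambda>_. poisson0_pmf \<mu>)"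
  let ?ch = "\<lambda>X. chain (shift_rates lam) ?W (\<lambda>u. c u + X u) (z + c v)"
  let ?new = "\<lambda>X. card {u \<in> ?W. c u = 0 \<and> X u \<noteq> 0}"
  let ?coll = "{X. ?new X \<noteq> sum X ?W}"
  let ?A = "\<lambda>X. measure_pmf.prob (?ch X) {(f, Z). f + Suc n = card W}"
  \<comment> \<open>Of the \<open>Suc n\<close> removed vertices, \<open>r\<close> were active at
    the start; without collisions exactly \<open>Suc n - r\<close> further patches are created.
    Hence the edge condition, written without subtraction.\<close>
  let ?B = "\<lambda>X. measure_pmf.prob (?ch X) {(f, Z). f + Suc n = card W \<and> Z + r = z + sum c W + Suc n}"
  let ?h = "\<lambda>X. hit_prob l n (r - 1 + sum X ?W)"
  have fin: "finite ?W" and cW: "card W = Suc (card ?W)"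
    using W card_Suc_Diff1[OF W v(1)] by simp_all
  have mu: "0 \<le> \<mu>" unfolding \<mu>_def by (rule lam)
  have act: "card {u \<in> ?W. c u + X u \<noteq> 0} = r - 1 + ?new X" for X
  proof -
    have 1: "{u \<in> ?W. c u + X u \<noteq> 0} = ({u \<in> W. c u \<noteq> 0} - {v}) \<union> {u \<in> ?W. c u = 0 \<and> X u \<noteq> 0}"
      by auto
    have 2: "card ({u \<in> W. c u \<noteq> 0} - {v}) = r - 1"
      unfolding r(1)[symmetric] using v by (intro card_Diff_singleton) simp
    show ?thesis unfolding 1 2[symmetric] using W by (intro card_Un_disjoint) auto
  qed
  have cr: "card {u \<in> ?W. c u \<noteq> 0} \<le> r"
    unfolding r(1)[symmetric] using W by (intro card_mono) auto
  have sumW: "sum c W = c v + sum c ?W" using W v by (intro sum.remove) auto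
  have bounds: "\<bar>?A X - ?h X\<bar> \<le> e + indicator ?coll X \<and> \<bar>?B X - ?h X\<bar> \<le> e + indicator ?coll X" for X
  proof (cases "X \<in> ?coll")
    case True
    have "\<bar>measure_pmf.prob (?ch X) S - ?h X\<bar> \<le> 1" for S
      using hit_prob_nonneg[of l n "r - 1 + sum X ?W"] hit_prob_le_1[of l n "r - 1 + sum X ?W"]
        measure_pmf.prob_le_1[of "?ch X" S] measure_nonneg[of "?ch X" S]
      by linarith
    then show ?thesis using True e by (simp add: add_increasing)
  next
    case False
    then have new: "?new X = sum X ?W" by simp
    let ?r = "card {u \<in> ?W. c u + X u \<noteq> 0}"
    have r': "?r = r - 1 + sum X ?W" using act[of X] new by simp
    have eA: "{(f, Z :: nat). f + Suc n = card W} = {(f, Z). f + n = card ?W}" using cW by auto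
    have eB: "{(f, Z). f + Suc n = card W \<and> Z + r = z + sum c W + Suc n} =
       {(f, Z). f + n = card ?W \<and> Z + ?r = z + c v + sum (\<lambda>u. c u + X u) ?W + n}"
      unfolding r' sumW sum.distrib using cW r(2) by auto
    show ?thesis
    proof (cases "?r \<le> n")
      case True
      have "Suc (card ?W) = w" using cW w by simp
      note IH[OF fin this True, of "z + c v"]
      then show ?thesis unfolding eA eB unfolding r' using False by (simp add: indicator_def)
    next
      \<comment> \<open>With more than \<open>n\<close> active vertices both probabilities and
        \<open>hit_prob\<close> vanish, so \<open>IH\<close> is needed for finitely many active
        counts only. This is what later allows a common threshold for \<open>N\<close>.\<close>
      case gt: False
      have "emeasure (?ch X) {(f, Z). f + n = card ?W} = 0"
      proof (rule emeasure_pmf_zero)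
        fix x assume x: "x \<in> set_pmf (?ch X)"
        have "card ?W = card {u \<in> ?W. c u + X u = 0} + ?r"
          by (rule card_filter_split[OF fin])
        moreover have "fst x \<le> card {u \<in> ?W. c u + X u = 0}"
          using chain_support[of ?W "shift_rates lam" "fst x" "snd x" "\<lambda>u. c u + X u" "z + c v"] x fin lam
          by (auto simp: shift_rates_nonneg)
        ultimately show "x \<notin> {(f, Z). f + n = card ?W}" using gt by auto
      qed
      then have A0: "?A X = 0" unfolding eA by (simp add: measure_pmf.emeasure_eq_measure)
      moreover have "?B X \<le> ?A X" by (intro measure_pmf.finite_measure_mono) auto
      then have "?B X = 0" using A0 by (simp add: measure_le_0_iff)
      moreover have "?h X = 0" using gt unfolding r' by (intro hit_prob_eq_0) simp
      ultimately show ?thesis using e by simp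
    qed
  qed
  have "m = measure_pmf.expectation (poisson0_pmf (real (w - 1) * \<mu>)) (\<lambda>k. hit_prob l n (r - 1 + k))"
    unfolding m_def by (rule expectation_hit_prob[symmetric])
  also have "poisson0_pmf (real (w - 1) * \<mu>) = map_pmf (\<lambda>X. sum X ?W) ?P"
    using sum_Pi_pmf_poisson0[OF fin mu] cW w by simp
  finally have m: "m = measure_pmf.expectation ?P ?h" by simp
  have coll: "measure_pmf.prob ?P ?coll \<le> real (w - 1) * \<mu>\<^sup>2 + real r * \<mu>"
  proof -
    have "measure_pmf.prob ?P ?coll \<le> real (card ?W) * \<mu>\<^sup>2 + real (card {u \<in> ?W. c u \<noteq> 0}) * \<mu>"
      by (rule prob_collision_bound[OF fin mu])
    also have "\<dots> \<le> real (w - 1) * \<mu>\<^sup>2 + real r * \<mu>"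
      using cW w cr mu by (intro add_mono mult_right_mono) auto
    finally show ?thesis .
  qed
  have bind: "measure_pmf.prob (chain lam W c z) S = measure_pmf.expectation ?P (\<lambda>X. measure_pmf.prob (?ch X) S)" for S
  proof -
    have "emeasure (chain lam W c z) S = (\<integral>\<^sup>+X. ennreal (measure_pmf.prob (?ch X) S) \<partial>?P)"
      unfolding ch \<mu>_def emeasure_bind_pmf by (simp add: measure_pmf.emeasure_eq_measure)
    also have "\<dots> = ennreal (measure_pmf.expectation ?P (\<lambda>X. measure_pmf.prob (?ch X) S))"
      by (intro nn_integral_eq_integral measure_pmf.integrable_const_bound[where B = 1]) auto
    finally show ?thesis by (simp add: measure_pmf.emeasure_eq_measure)
  qed
  have b1: "\<bar>measure_pmf.prob q S\<bar> \<le> 1" for q :: "(nat \<times> nat) pmf" and S by simp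
  have b2: "\<bar>hit_prob l n k\<bar> \<le> 1" for k using hit_prob_nonneg[of l n k] hit_prob_le_1[of l n k] by simp
  have EA: "\<bar>measure_pmf.expectation ?P ?A - measure_pmf.expectation ?P ?h\<bar> \<le> e + measure_pmf.prob ?P ?coll"
    by (rule expectation_approx[where B = 1 and B' = 1]) (use bounds b1 b2 in blast)+
  have EB: "\<bar>measure_pmf.expectation ?P ?B - measure_pmf.expectation ?P ?h\<bar> \<le> e + measure_pmf.prob ?P ?coll"
    by (rule expectation_approx[where B = 1 and B' = 1]) (use bounds b1 b2 in blast)+
  show "\<bar>measure_pmf.prob (chain lam W c z) {(f, Z). f + Suc n = card W} - m\<bar> \<le> d"
    using EA coll unfolding bind m d_def by linarith
  show "\<bar>measure_pmf.prob (chain lam W c z) {(f, Z). f + Suc n = card W \<and> Z + r = z + sum c W + Suc n} - m\<bar> \<le> d"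
    using EB coll unfolding bind m d_def by linarith
qed

lemma tendsto_pmf_poisson0:
  assumes "\<And>n. 0 \<le> f n" "f \<longlonglongrightarrow> l"
  shows "(\<lambda>n. pmf (poisson0_pmf (f n)) k) \<longlonglongrightarrow> pmf (poisson0_pmf l) k"
proof -
  have "0 \<le> l" using assms by (meson LIMSEQ_le_const)
  then have "(\<lambda>n. f n ^ k / fact k * exp (- f n)) \<longlonglongrightarrow> pmf (poisson0_pmf l) k"
    by (simp only: pmf_poisson0) (intro tendsto_intros assms, simp)
  then show ?thesis using assms(1) by (simp add: pmf_poisson0)
qed

section \<open>Limits for a fixed number of collapses\<close>

context poisson_parameters
begin

text \<open>For fixed \<open>k\<close> the product is of order N ^ (2 - k), so during boundedly many
  collapses only edges of size 2 feed the walk.\<close>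

lemma rates_limit:
  assumes "2 \<le> k"
  shows "(\<lambda>N. real N * rates N k) \<longlonglongrightarrow> (if k = 2 then 2 * \<beta> 2 else 0)"
proof (cases "k = 2")
  case True
  have "eventually (\<lambda>N. real N * rates N 2 = 2 * \<beta> 2 * (real N / (real N - 1))) sequentially"
  proof (rule eventually_sequentiallyI[of 2])
    fix N :: nat assume N: "2 \<le> N"
    have C: "real (N choose 2) = real N * (real N - 1) / 2"
      using N by (simp add: binomial_gbinomial gbinomial_prod_rev numeral_2_eq_2 field_simps)
    have "real N - 1 \<noteq> 0" using N by simp
    then show "real N * rates N 2 = 2 * \<beta> 2 * (real N / (real N - 1))"
      unfolding initial_rates_def C using N by (simp add: divide_simps)
  qed
  moreover have "(\<lambda>N. 2 * \<beta> 2 * (real N / (real N - 1))) \<longlonglongrightarrow> 2 * \<beta> 2"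
    by real_asymp
  ultimately show ?thesis using True by (simp add: tendsto_cong)
next
  case False
  have "(\<lambda>N. real N * rates N k) \<longlonglongrightarrow> 0"
  proof (rule tendsto_sandwich[of "\<lambda>_. 0"])
    show "eventually (\<lambda>N. 0 \<le> real N * rates N k) sequentially" by (simp add: rates_nonneg)
    show "eventually (\<lambda>N. real N * rates N k \<le> \<beta> k * real k ^ k * (1 / real N)) sequentially"
    proof (rule eventually_sequentiallyI[of "k"])
      fix N assume N: "k \<le> N"
      have k: "3 \<le> k" using assms False by simp
      have "(real N / real k) ^ k \<le> real (N choose k)"
        using binomial_ge_n_over_k_pow_k[OF N, where ?'a = real] .
      moreover have "0 < (real N / real k) ^ k" using k N by (intro zero_less_power) simp
      ultimately have "real N * rates N k \<le> real N * (real N * \<beta> k / (real N / real k) ^ k)"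
        unfolding initial_rates_def
        by (intro mult_left_mono divide_left_mono mult_pos_pos) (use N in \<open>auto simp: \<beta>_nonneg\<close>)
      also have "\<dots> = \<beta> k * real k ^ k * (real N ^ 2 / real N ^ k)"
        by (simp add: power_divide power2_eq_square)
      also have "real N ^ 2 / real N ^ k \<le> 1 / real N"
      proof -
        have "real N ^ 3 \<le> real N ^ k" using k N by (intro power_increasing) auto
        then show ?thesis using k N by (simp add: field_simps power3_eq_cube power2_eq_square)
      qed
      finally show "real N * rates N k \<le> \<beta> k * real k ^ k * (1 / real N)"
        by (simp add: mult_left_mono \<beta>_nonneg)
    qed
    show "(\<lambda>N. \<beta> k * real k ^ k * (1 / real N)) \<longlonglongrightarrow> 0" by real_asymp
  qed auto
  then show ?thesis using False by simp
qed

lemma shifted_rates_limit: "(\<lambda>N. real N * (shift_rates ^^ j) (rates N) 2) \<longlonglongrightarrow> 2 * \<beta> 2"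
proof -
  have "(\<lambda>N. \<Sum>i\<le>j. real (j choose i) * (real N * rates N (2 + i))) \<longlonglongrightarrow>
     (\<Sum>i\<le>j. real (j choose i) * (if 2 + i = 2 then 2 * \<beta> 2 else 0))"
    by (intro tendsto_sum tendsto_mult_left rates_limit) simp
  also have "(\<Sum>i\<le>j. real (j choose i) * (if 2 + i = 2 then 2 * \<beta> 2 else 0)) = (\<Sum>i\<le>j. if i = 0 then 2 * \<beta> 2 else 0)"
    by (intro sum.cong) auto
  finally show ?thesis by (simp add: shift_rates_funpow sum_distrib_left mult_ac)
qed

text \<open>Uniformity over all states with \<open>r\<close> active vertices is essential, because
  the recursion evaluates the next probability at a random state. The offset \<open>j\<close> counts
  the collapses already made.\<close>

lemma chain_local_limit:
  assumes "0 < e"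
  shows "eventually (\<lambda>N. \<forall>W c z. finite W \<and> card W = N - j \<and> card {u \<in> W. c u \<noteq> 0} = r \<longrightarrow>
      \<bar>measure_pmf.prob (chain ((shift_rates ^^ j) (rates N)) W c z) {(f, Z). f + n = card W} - hit_prob (2 * \<beta> 2) n r\<bar> \<le> e \<and>
      \<bar>measure_pmf.prob (chain ((shift_rates ^^ j) (rates N)) W c z) {(f, Z). f + n = card W \<and> Z + r = z + sum c W + n}
        - hit_prob (2 * \<beta> 2) n r\<bar> \<le> e) sequentially"
  using assms
proof (induction n arbitrary: j r e)
  case 0
  show ?case
  proof (intro always_eventually allI impI, elim conjE)
    fix N W and c :: "nat \<Rightarrow> nat" and z
    assume W: "finite W" "card W = N - j" "card {u \<in> W. c u \<noteq> 0} = r"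
    let ?lam = "(shift_rates ^^ j) (rates N)"
    have lam: "\<And>k. 0 \<le> ?lam k" by (intro shift_rates_funpow_nonneg rates_nonneg)
    show "\<bar>measure_pmf.prob (chain ?lam W c z) {(f, Z). f + 0 = card W} - hit_prob (2 * \<beta> 2) 0 r\<bar> \<le> e \<and>
      \<bar>measure_pmf.prob (chain ?lam W c z) {(f, Z). f + 0 = card W \<and> Z + r = z + sum c W + 0} - hit_prob (2 * \<beta> 2) 0 r\<bar> \<le> e"
    proof (cases "r = 0")
      case True
      then have "\<forall>u\<in>W. c u = 0" using W by auto
      then show ?thesis using True W 0 by (simp add: chain_stop)
    next
      case False
      have "card W = card {u \<in> W. c u = 0} + card {u \<in> W. c u \<noteq> 0}"
        by (rule card_filter_split[OF W(1)])
      then have lt: "card {u \<in> W. c u = 0} < card W" using False W by simp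
      have "x \<notin> {(f, Z). f + 0 = card W}" if "x \<in> set_pmf (chain ?lam W c z)" for x
        using chain_support[of W ?lam "fst x" "snd x" c z, OF W(1) lam] that lt by auto
      then have "emeasure (chain ?lam W c z) {(f, Z). f + 0 = card W} = 0"
        "emeasure (chain ?lam W c z) {(f, Z). f + 0 = card W \<and> Z + r = z + sum c W + 0} = 0"
        by (auto intro!: emeasure_pmf_zero)
      then show ?thesis using False 0 by (simp add: measure_pmf.emeasure_eq_measure)
    qed
  qed
next
  case (Suc n)
  let ?l = "2 * \<beta> 2"
  show ?case
  proof (cases "r = 0")
    case True
    show ?thesis
    proof (intro always_eventually allI impI, elim conjE)
      fix N W and c :: "nat \<Rightarrow> nat" and z
      assume W: "finite W" "card W = N - j" "card {u \<in> W. c u \<noteq> 0} = r"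
      then have "\<forall>u\<in>W. c u = 0" using True by auto
      then show "\<bar>measure_pmf.prob (chain ((shift_rates ^^ j) (rates N)) W c z) {(f, Z). f + Suc n = card W} - hit_prob ?l (Suc n) r\<bar> \<le> e \<and>
        \<bar>measure_pmf.prob (chain ((shift_rates ^^ j) (rates N)) W c z) {(f, Z). f + Suc n = card W \<and> Z + r = z + sum c W + Suc n} - hit_prob ?l (Suc n) r\<bar> \<le> e"
        using True W Suc.prems by (simp add: chain_stop)
    qed
  next
    case False
    define \<mu> where "\<mu> N = (shift_rates ^^ j) (rates N) 2" for N
    define d where "d N = real (N - j - 1) * (\<mu> N)\<^sup>2 + real r * \<mu> N" for N
    define m where "m N = (\<Sum>k\<le>n. pmf (poisson0_pmf (real (N - j - 1) * \<mu> N)) k * hit_prob ?l n (r - 1 + k))" for N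
    have mu0: "0 \<le> \<mu> N" for N unfolding \<mu>_def by (intro shift_rates_funpow_nonneg rates_nonneg)
    have Nmu: "(\<lambda>N. real N * \<mu> N) \<longlonglongrightarrow> ?l" unfolding \<mu>_def by (rule shifted_rates_limit)
    have "(\<lambda>N. (real N * \<mu> N) * (1 / real N)) \<longlonglongrightarrow> ?l * 0"
      by (intro tendsto_mult Nmu lim_1_over_n)
    then have mu: "\<mu> \<longlonglongrightarrow> 0"
      by (rule tendsto_eq_rhs[OF Lim_transform_eventually])
        (auto simp: eventually_sequentially intro!: exI[of _ 1])
    have "(\<lambda>N. real (N - j - 1) * \<mu> N) \<longlonglongrightarrow> ?l"
    proof -
      have "(\<lambda>N. real N * \<mu> N - real (j + 1) * \<mu> N) \<longlonglongrightarrow> ?l - real (j + 1) * 0"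
        by (intro tendsto_diff Nmu tendsto_mult_left mu)
      then show ?thesis
        by (rule tendsto_eq_rhs[OF Lim_transform_eventually])
          (auto simp: eventually_sequentially of_nat_diff algebra_simps intro!: exI[of _ "j + 1"])
    qed note wmu = this
    have "m \<longlonglongrightarrow> (\<Sum>k\<le>n. pmf (poisson0_pmf ?l) k * hit_prob ?l n (r - 1 + k))"
      unfolding m_def by (intro tendsto_intros tendsto_pmf_poisson0 wmu) (simp add: mu0)
    then have m: "m \<longlonglongrightarrow> hit_prob ?l (Suc n) r" using False by simp
    have "(\<lambda>N. (real (N - j - 1) * \<mu> N) * \<mu> N + real r * \<mu> N) \<longlonglongrightarrow> ?l * 0 + real r * 0"
      by (intro tendsto_intros wmu mu)
    then have d: "d \<longlonglongrightarrow> 0" unfolding d_def by (simp add: power2_eq_square mult.assoc)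
    have e3: "0 < e / 3" using Suc.prems by simp
    have ev1: "eventually (\<lambda>N. \<bar>m N - hit_prob ?l (Suc n) r\<bar> < e / 3) sequentially"
      using tendstoD[OF m e3] by (simp add: dist_real_def)
    have ev2: "eventually (\<lambda>N. d N < e / 3) sequentially"
      using order_tendstoD(2)[OF d e3] .
    \<comment> \<open>One threshold for each \<open>r' \<le> n\<close>; finitely many can be
      merged.\<close>
    have ev3: "eventually (\<lambda>N. \<forall>r'\<in>{..n}. \<forall>W c z. finite W \<and> card W = N - Suc j \<and> card {u \<in> W. c u \<noteq> 0} = r' \<longrightarrow>
      \<bar>measure_pmf.prob (chain ((shift_rates ^^ Suc j) (rates N)) W c z) {(f, Z). f + n = card W} - hit_prob ?l n r'\<bar> \<le> e / 3 \<and>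
      \<bar>measure_pmf.prob (chain ((shift_rates ^^ Suc j) (rates N)) W c z) {(f, Z). f + n = card W \<and> Z + r' = z + sum c W + n}
        - hit_prob ?l n r'\<bar> \<le> e / 3) sequentially"
      by (intro eventually_ball_finite ballI Suc.IH e3) simp
    show ?thesis
      using ev1 ev2 ev3 eventually_gt_at_top[of j]
    proof eventually_elim
      case (elim N)
      show ?case
      proof (intro allI impI, elim conjE)
        fix W and c :: "nat \<Rightarrow> nat" and z
        assume W: "finite W" "card W = N - j" "card {u \<in> W. c u \<noteq> 0} = r"
        let ?lam = "(shift_rates ^^ j) (rates N)"
        have lam: "\<And>k. 0 \<le> ?lam k" by (intro shift_rates_funpow_nonneg rates_nonneg)
        have sh: "(shift_rates ^^ Suc j) (rates N) = shift_rates ?lam" by simp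
        have step: "\<bar>measure_pmf.prob (chain (shift_rates ?lam) W c z) {(f, Z). f + n = card W} - hit_prob ?l n (card {u \<in> W. c u \<noteq> 0})\<bar> \<le> e / 3 \<and>
          \<bar>measure_pmf.prob (chain (shift_rates ?lam) W c z) {(f, Z). f + n = card W \<and> Z + card {u \<in> W. c u \<noteq> 0} = z + sum c W + n}
            - hit_prob ?l n (card {u \<in> W. c u \<noteq> 0})\<bar> \<le> e / 3"
          if "finite W" "Suc (card W) = N - j" "card {u \<in> W. c u \<noteq> 0} \<le> n" for W and c :: "nat \<Rightarrow> nat" and z
        proof -
          have "card W = N - Suc j" using that by simp
          then show ?thesis using elim(3) that unfolding sh by blast
        qed
        have "0 \<le> e / 3" using e3 by simp
        note st = chain_local_step[where lam = ?lam and w = "N - j" and l = ?l and n = n and e = "e / 3",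
            OF W(1) lam W(3) False step W(2) this, of z]
        have "\<bar>measure_pmf.prob (chain ?lam W c z) {(f, Z). f + Suc n = card W} - m N\<bar> \<le> e / 3 + d N"
          using st(1) unfolding m_def d_def \<mu>_def by simp
        moreover have "\<bar>measure_pmf.prob (chain ?lam W c z) {(f, Z). f + Suc n = card W \<and> Z + r = z + sum c W + Suc n} - m N\<bar> \<le> e / 3 + d N"
          using st(2) unfolding m_def d_def \<mu>_def by simp
        ultimately show "\<bar>measure_pmf.prob (chain ?lam W c z) {(f, Z). f + Suc n = card W} - hit_prob ?l (Suc n) r\<bar> \<le> e \<and>
          \<bar>measure_pmf.prob (chain ?lam W c z) {(f, Z). f + Suc n = card W \<and> Z + r = z + sum c W + Suc n} - hit_prob ?l (Suc n) r\<bar> \<le> e"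
          using elim(1,2) by linarith
      qed
    qed
  qed
qed

text \<open>The two limits coincide, so asymptotically \<open>Z = n\<close> on the event
  \<open>T = n\<close>. The last argument 1 is the single active vertex \<open>v0\<close>.\<close>

lemma domain_law_local_limit:
  shows "(\<lambda>N. measure_pmf.prob (domain_law \<beta> v0 N) {(T, Z). T = n}) \<longlonglongrightarrow> hit_prob (2 * \<beta> 2) n 1"
    and "(\<lambda>N. measure_pmf.prob (domain_law \<beta> v0 N) {(n, n)}) \<longlonglongrightarrow> hit_prob (2 * \<beta> 2) n 1"
proof -
  let ?ch = "\<lambda>N. chain (rates N) {1..N} seed 0"
  have ev: "eventually (\<lambda>N. \<bar>measure_pmf.prob (domain_law \<beta> v0 N) {(T, Z). T = n} - hit_prob (2 * \<beta> 2) n 1\<bar> \<le> e \<and>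
     \<bar>measure_pmf.prob (domain_law \<beta> v0 N) {(n, n)} - hit_prob (2 * \<beta> 2) n 1\<bar> \<le> e) sequentially" if "0 < e" for e
    using chain_local_limit[OF that, of 0 1 n] eventually_ge_at_top[of v0] eventually_gt_at_top[of n]
  proof eventually_elim
    case (elim N)
    have "{u \<in> {1..N}. seed u \<noteq> 0} = {v0}" using elim(2) v0_pos by auto
    then have 1: "card {u \<in> {1..N}. seed u \<noteq> 0} = 1" by simp
    \<comment> \<open>The extra sets with \<open>N < f\<close> come from truncated subtraction at
      \<open>n = 0\<close>; the fact \<open>f\<close> below shows that they are null.\<close>
    have E: "{(f, Z :: nat). (N - f, Z) \<in> {(T, Z). T = n}} = {(f, Z). f + n = card {1..N}} \<union> {(f, Z). n = 0 \<and> N < f}"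
      "{(f, Z). (N - f, Z) \<in> {(n, n)}} = {(f, Z). f + n = card {1..N} \<and> Z + 1 = 0 + sum seed {1..N} + n} \<union> {(f, Z). n = 0 \<and> N < f \<and> Z = 0}"
      using elim(2,3) seed_sum[OF elim(2)] by auto
    have f: "f \<le> N" if "(f, Z) \<in> set_pmf (?ch N)" for f Z
      using chain_support[of "{1..N}" "rates N" f Z seed 0] that rates_nonneg seed_unpatched[OF elim(2)] by auto
    have P: "measure_pmf.prob (domain_law \<beta> v0 N) {(T, Z). T = n} = measure_pmf.prob (?ch N) {(f, Z). f + n = card {1..N}}"
      "measure_pmf.prob (domain_law \<beta> v0 N) {(n, n)} =
        measure_pmf.prob (?ch N) {(f, Z). f + n = card {1..N} \<and> Z + 1 = 0 + sum seed {1..N} + n}"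
      unfolding prob_domain_law[OF elim(2)] E using f
      by - (rule measure_pmf.finite_measure_eq_AE, force simp: AE_measure_pmf_iff, simp, simp)+
    have "finite {1..N} \<and> card {1..N} = N - 0 \<and> card {u \<in> {1..N}. seed u \<noteq> 0} = 1" using 1 by simp
    from elim(1)[rule_format, OF this, of 0] show ?case unfolding P by simp
  qed
  show "(\<lambda>N. measure_pmf.prob (domain_law \<beta> v0 N) {(T, Z). T = n}) \<longlonglongrightarrow> hit_prob (2 * \<beta> 2) n 1"
  proof (rule tendstoI)
    fix e :: real assume "0 < e"
    then show "eventually (\<lambda>N. dist (measure_pmf.prob (domain_law \<beta> v0 N) {(T, Z). T = n}) (hit_prob (2 * \<beta> 2) n 1) < e) sequentially"
      using ev[of "e / 2"] by (auto elim!: eventually_mono simp: dist_real_def)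
  qed
  show "(\<lambda>N. measure_pmf.prob (domain_law \<beta> v0 N) {(n, n)}) \<longlonglongrightarrow> hit_prob (2 * \<beta> 2) n 1"
  proof (rule tendstoI)
    fix e :: real assume "0 < e"
    then show "eventually (\<lambda>N. dist (measure_pmf.prob (domain_law \<beta> v0 N) {(n, n)}) (hit_prob (2 * \<beta> 2) n 1) < e) sequentially"
      using ev[of "e / 2"] by (auto elim!: eventually_mono simp: dist_real_def)
  qed
qed

end

section \<open>The limiting random walk\<close>


definition hits_at :: "nat \<Rightarrow> nat \<Rightarrow> (nat \<Rightarrow> nat) \<Rightarrow> bool" where
  "hits_at n r \<omega> \<longleftrightarrow> int r + (\<Sum>i<n. int (\<omega> i) - 1) = 0 \<and> (\<forall>m<n. int r + (\<Sum>i<m. int (\<omega> i) - 1) \<noteq> 0)"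

lemma hits_at_0: "hits_at 0 r \<omega> \<longleftrightarrow> r = 0"
  by (simp add: hits_at_def)

lemma hits_at_Suc: "hits_at (Suc n) r (case_nat s \<omega>) \<longleftrightarrow> r \<noteq> 0 \<and> hits_at n (r - 1 + s) \<omega>"
proof (cases "r = 0")
  case True
  then show ?thesis by (auto simp: hits_at_def)
next
  case False
  have A: "int r + (\<Sum>i<Suc m. int (case_nat s \<omega> i) - 1) = int (r - 1 + s) + (\<Sum>i<m. int (\<omega> i) - 1)" for m
    using False by (simp add: sum.lessThan_Suc_shift of_nat_diff del: sum.lessThan_Suc)
  have B: "(\<forall>m<Suc n. int r + (\<Sum>i<m. int (case_nat s \<omega> i) - 1) \<noteq> 0) \<longleftrightarrow>
      (\<forall>m<n. int r + (\<Sum>i<Suc m. int (case_nat s \<omega> i) - 1) \<noteq> 0)"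
    using False by (auto simp: All_less_Suc2 simp del: sum.lessThan_Suc)
  show ?thesis unfolding hits_at_def B A using False by simp
qed

lemma sets_hits_at: "{\<omega>. hits_at n r \<omega>} \<in> sets (iid_poisson_space l)"
proof -
  let ?S = "iid_poisson_space l"
  have sp: "space ?S = UNIV" by (simp add: iid_poisson_space_def space_PiM)
  have comp: "(\<lambda>\<omega>. real (\<omega> i)) \<in> borel_measurable ?S" for i
    unfolding iid_poisson_space_def
    by (rule measurable_compose[OF measurable_component_singleton]) auto
  have real: "int r + (\<Sum>i<m. int (\<omega> i) - 1) = 0 \<longleftrightarrow> real r + (\<Sum>i<m. real (\<omega> i) - 1) = 0" for m \<omega>
  proof -
    have e: "real_of_int (int r + (\<Sum>i<m. int (\<omega> i) - 1)) = real r + (\<Sum>i<m. real (\<omega> i) - 1)" by simp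
    show ?thesis unfolding e[symmetric] of_int_eq_0_iff ..
  qed
  have "{\<omega> \<in> space ?S. hits_at n r \<omega>} \<in> sets ?S"
    unfolding hits_at_def real using comp by measurable
  then show ?thesis using sp by simp
qed

text \<open>\<open>PiM_iter\<close> splits the sequence space into the first increment and an
  independent copy of the space itself, which reproduces the recursion of
  \<open>hit_prob\<close>.\<close>

lemma prob_hits_at: "emeasure (iid_poisson_space l) {\<omega>. hits_at n r \<omega>} = ennreal (hit_prob l n r)"
proof (induction n arbitrary: r)
  case 0
  have "prob_space (iid_poisson_space l)"
    unfolding iid_poisson_space_def by (intro prob_space_PiM prob_space_measure_pmf)
  then have "emeasure (iid_poisson_space l) UNIV = 1"
    using prob_space.emeasure_space_1[of "iid_poisson_space l"]
    by (simp add: iid_poisson_space_def space_PiM)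
  then show ?case by (simp add: hits_at_0)
next
  case (Suc n)
  let ?M = "measure_pmf (poisson0_pmf l)" let ?S = "iid_poisson_space l"
  interpret product_prob_space "\<lambda>_::nat. ?M" UNIV ..
  interpret ss: sequence_space ?M by standard
  interpret S: prob_space ?S
    unfolding iid_poisson_space_def by (intro prob_space_PiM prob_space_measure_pmf)
  have meas: "(\<lambda>(s, \<omega>). case_nat s \<omega>) \<in> measurable (?M \<Otimes>\<^sub>M ?S) ?S"
    unfolding iid_poisson_space_def by measurable
  have sp: "space (?M \<Otimes>\<^sub>M ?S) = UNIV"
    by (simp add: space_pair_measure iid_poisson_space_def space_PiM)
  have "emeasure ?S {\<omega>. hits_at (Suc n) r \<omega>} =
    emeasure (distr (?M \<Otimes>\<^sub>M ?S) ?S (\<lambda>(s, \<omega>). case_nat s \<omega>)) {\<omega>. hits_at (Suc n) r \<omega>}"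
    using ss.PiM_iter by (simp add: iid_poisson_space_def)
  also have "\<dots> = emeasure (?M \<Otimes>\<^sub>M ?S) {(s, \<omega>). r \<noteq> 0 \<and> hits_at n (r - 1 + s) \<omega>}"
    by (subst emeasure_distr[OF meas sets_hits_at])
      (auto simp: sp hits_at_Suc vimage_def case_prod_unfold intro!: arg_cong2[of _ _ _ _ emeasure])
  also have "\<dots> = (\<integral>\<^sup>+s. emeasure ?S {\<omega>. r \<noteq> 0 \<and> hits_at n (r - 1 + s) \<omega>} \<partial>?M)"
  proof (subst S.emeasure_pair_measure_alt)
    have "{(s, \<omega>). r \<noteq> 0 \<and> hits_at n (r - 1 + s) \<omega>} =
       (if r = 0 then {} else \<Union>s. {s} \<times> {\<omega>. hits_at n (r - 1 + s) \<omega>})" by auto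
    also have "\<dots> \<in> sets (?M \<Otimes>\<^sub>M ?S)"
      by (auto intro!: sets.countable_UN pair_measureI sets_hits_at)
    finally show "{(s, \<omega>). r \<noteq> 0 \<and> hits_at n (r - 1 + s) \<omega>} \<in> sets (?M \<Otimes>\<^sub>M ?S)" .
  qed (simp add: vimage_def)
  also have "\<dots> = (\<integral>\<^sup>+s. ennreal (if r = 0 then 0 else hit_prob l n (r - 1 + s)) \<partial>?M)"
    by (intro nn_integral_cong) (simp add: Suc)
  also have "\<dots> = ennreal (measure_pmf.expectation (poisson0_pmf l) (\<lambda>s. if r = 0 then 0 else hit_prob l n (r - 1 + s)))"
    using hit_prob_nonneg hit_prob_le_1
    by (intro nn_integral_eq_integral measure_pmf.integrable_const_bound[where B = 1]) auto
  also have "measure_pmf.expectation (poisson0_pmf l) (\<lambda>s. if r = 0 then 0 else hit_prob l n (r - 1 + s)) = hit_prob l (Suc n) r"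
    by (cases "r = 0") (simp, simp only: if_False expectation_hit_prob hit_prob.simps)
  finally show ?case .
qed

lemma rw_hitting_time_eq: "rw_hitting_time \<omega> = enat n \<longleftrightarrow> hits_at n 1 \<omega>"
proof
  assume h: "rw_hitting_time \<omega> = enat n"
  then have ex: "\<exists>n. rw_walk \<omega> n = 0" and n: "n = (LEAST n. rw_walk \<omega> n = 0)"
    by (auto simp: rw_hitting_time_def split: if_splits)
  show "hits_at n 1 \<omega>"
    using LeastI_ex[OF ex] not_less_Least[of _ "\<lambda>n. rw_walk \<omega> n = 0"]
    unfolding n hits_at_def by (auto simp: rw_walk_def)
next
  assume h: "hits_at n 1 \<omega>"
  then have z: "rw_walk \<omega> n = 0" and nz: "\<And>m. m < n \<Longrightarrow> rw_walk \<omega> m \<noteq> 0"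
    by (auto simp: hits_at_def rw_walk_def)
  have "(LEAST n. rw_walk \<omega> n = 0) = n"
    using z nz by (intro Least_equality) (auto simp: not_less[symmetric])
  then show "rw_hitting_time \<omega> = enat n" using z by (auto simp: rw_hitting_time_def)
qed

lemma iid_poisson_space_prob: "prob_space (iid_poisson_space l)"
  unfolding iid_poisson_space_def by (intro prob_space_PiM prob_space_measure_pmf)

lemma measure_rw_hitting_time:
  "measure (iid_poisson_space l) {\<omega>. rw_hitting_time \<omega> = enat n} = hit_prob l n 1"
  by (simp add: rw_hitting_time_eq measure_def prob_hits_at hit_prob_nonneg)

lemma rw_hitting_time_measurable:
  "rw_hitting_time \<in> measurable (iid_poisson_space l) (count_space UNIV)"
proof -
  have sp: "space (iid_poisson_space l) = UNIV" by (simp add: iid_poisson_space_def space_PiM)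
  have fin: "rw_hitting_time -` {enat n} \<in> sets (iid_poisson_space l)" for n
    using sets_hits_at[of n 1 l] by (simp add: vimage_def rw_hitting_time_eq)
  have "rw_hitting_time -` {\<infinity>} = UNIV - (\<Union>n. rw_hitting_time -` {enat n})"
    using not_enat_eq by (auto simp: set_eq_iff)
  also have "\<dots> \<in> sets (iid_poisson_space l)"
    unfolding sp[symmetric] using fin by (intro sets.Diff sets.countable_UN) auto
  finally have inf: "rw_hitting_time -` {\<infinity>} \<in> sets (iid_poisson_space l)" .
  show ?thesis
  proof (subst measurable_count_space_eq2_countable, simp, safe)
    fix a :: enat
    show "rw_hitting_time -` {a} \<inter> space (iid_poisson_space l) \<in> sets (iid_poisson_space l)"
      using fin inf by (cases a) (auto simp: sp)
  qed
qed

text \<open>All three parts rest on the disjoint events that the hitting time equals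
  \<open>n\<close>. Their total mass may fall short of 1, and the defect is the probability of never
  hitting 0.\<close>

lemma hit_prob_summable: "summable (\<lambda>n. hit_prob l n 1)"
  and hit_prob_suminf_le: "(\<Sum>n. hit_prob l n 1) \<le> 1"
  and integral_rw_hitting_time:
    "(\<And>x. \<bar>F x\<bar> \<le> B) \<Longrightarrow> (\<integral>\<omega>. F (rw_hitting_time \<omega>) \<partial>iid_poisson_space l) =
      (\<Sum>n. hit_prob l n 1 * F (enat n)) + (1 - (\<Sum>n. hit_prob l n 1)) * F \<infinity>"
proof -
  let ?S = "iid_poisson_space l"
  interpret S: prob_space ?S by (rule iid_poisson_space_prob)
  let ?E = "\<lambda>n. {\<omega>. rw_hitting_time \<omega> = enat n}"
  have sp: "space ?S = UNIV" by (simp add: iid_poisson_space_def space_PiM)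
  have E: "?E n \<in> sets ?S" for n using sets_hits_at[of n 1 l] by (simp add: rw_hitting_time_eq)
  have disj: "disjoint_family ?E" by (auto simp: disjoint_family_on_def)
  have sums: "(\<lambda>n. measure ?S (?E n)) sums measure ?S (\<Union>n. ?E n)"
    using E disj by (intro S.finite_measure_UNION) auto
  then show summ: "summable (\<lambda>n. hit_prob l n 1)" and "(\<Sum>n. hit_prob l n 1) \<le> 1"
    unfolding measure_rw_hitting_time by (auto simp: sums_iff)
  assume B: "\<And>x. \<bar>F x\<bar> \<le> B"
  \<comment> \<open>Centring at \<open>F \<infinity>\<close> makes every term vanish on paths that
    never hit 0, so a single series represents the integrand everywhere.\<close>
  let ?f = "\<lambda>n \<omega>. indicator (?E n) \<omega> * (F (enat n) - F \<infinity>)"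
  have point: "(\<lambda>n. ?f n \<omega>) sums (F (rw_hitting_time \<omega>) - F \<infinity>)" for \<omega>
  proof (cases "rw_hitting_time \<omega>")
    case (enat k)
    have "(\<lambda>n. ?f n \<omega>) = (\<lambda>n. if n = k then F (enat n) - F \<infinity> else 0)"
      by (auto simp: enat fun_eq_iff indicator_def)
    then show ?thesis using sums_single[of k "\<lambda>n. F (enat n) - F \<infinity>"] by (simp add: enat)
  next
    case infinity
    then show ?thesis by (simp add: indicator_def)
  qed
  have int: "integrable ?S (?f n)" for n
    using E by (intro integrable_mult_left S.integrable_const_bound[where B = 1]) auto
  have val: "(\<integral>\<omega>. ?f n \<omega> \<partial>?S) = hit_prob l n 1 * (F (enat n) - F \<infinity>)" for n
    using E by (simp add: measure_rw_hitting_time sp)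
  have norm: "(\<integral>\<omega>. norm (?f n \<omega>) \<partial>?S) = hit_prob l n 1 * \<bar>F (enat n) - F \<infinity>\<bar>" for n
    using E by (simp add: abs_mult measure_rw_hitting_time sp)
  have bd: "\<bar>F (enat n) - F \<infinity>\<bar> \<le> 2 * B" for n using B[of "enat n"] B[of \<infinity>] by linarith
  have sumF: "summable (\<lambda>n. hit_prob l n 1 * F (enat n))"
  proof (rule summable_comparison_test')
    show "summable (\<lambda>n. B * hit_prob l n 1)" using summ by (rule summable_mult)
    show "norm (hit_prob l n 1 * F (enat n)) \<le> B * hit_prob l n 1" for n
      using mult_right_mono[OF B[of "enat n"] hit_prob_nonneg[of l n 1]]
      by (simp add: abs_mult hit_prob_nonneg mult.commute)
  qed
  have sumn: "summable (\<lambda>n. \<integral>\<omega>. norm (?f n \<omega>) \<partial>?S)"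
    unfolding norm
  proof (rule summable_comparison_test')
    show "summable (\<lambda>n. (2 * B) * hit_prob l n 1)" using summ by (rule summable_mult)
    show "norm (hit_prob l n 1 * \<bar>F (enat n) - F \<infinity>\<bar>) \<le> (2 * B) * hit_prob l n 1" for n
      using mult_right_mono[OF bd[of n] hit_prob_nonneg[of l n 1]]
      by (simp add: abs_mult hit_prob_nonneg mult.commute)
  qed
  have ae: "AE \<omega> in ?S. summable (\<lambda>n. norm (?f n \<omega>))"
  proof (intro AE_I2)
    fix \<omega>
    show "summable (\<lambda>n. norm (?f n \<omega>))"
    proof (rule summable_finite[of "{n. rw_hitting_time \<omega> = enat n}"])
      have "{n. rw_hitting_time \<omega> = enat n} \<subseteq> {the_enat (rw_hitting_time \<omega>)}" by auto
      then show "finite {n. rw_hitting_time \<omega> = enat n}" by (rule finite_subset) simp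
    qed auto
  qed
  have "(\<integral>\<omega>. F (rw_hitting_time \<omega>) \<partial>?S) - F \<infinity> = (\<integral>\<omega>. F (rw_hitting_time \<omega>) - F \<infinity> \<partial>?S)"
  proof -
    have "(\<lambda>\<omega>. F (rw_hitting_time \<omega>)) \<in> borel_measurable ?S"
      by (rule measurable_compose[OF rw_hitting_time_measurable]) simp
    then have "integrable ?S (\<lambda>\<omega>. F (rw_hitting_time \<omega>))"
      using B by (intro S.integrable_const_bound[where B = B]) auto
    then show ?thesis by (simp add: S.prob_space)
  qed
  also have "\<dots> = (\<integral>\<omega>. (\<Sum>n. ?f n \<omega>) \<partial>?S)"
    using point by (simp add: sums_iff)
  also have "\<dots> = (\<Sum>n. \<integral>\<omega>. ?f n \<omega> \<partial>?S)"
    by (rule integral_suminf[OF int ae sumn])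
  also have "\<dots> = (\<Sum>n. hit_prob l n 1 * F (enat n) - hit_prob l n 1 * F \<infinity>)"
    by (simp only: val) (simp only: right_diff_distrib)
  also have "\<dots> = (\<Sum>n. hit_prob l n 1 * F (enat n)) - (\<Sum>n. hit_prob l n 1) * F \<infinity>"
    using sumF summ by (subst suminf_diff[symmetric]) (auto simp: suminf_mult2 summable_mult2)
  finally show "(\<integral>\<omega>. F (rw_hitting_time \<omega>) \<partial>?S) =
      (\<Sum>n. hit_prob l n 1 * F (enat n)) + (1 - (\<Sum>n. hit_prob l n 1)) * F \<infinity>"
    by (simp add: algebra_simps)
qed

text \<open>For \<open>\<theta> > 0\<close> and \<open>\<phi> = E (exp (- \<theta> (\<xi>\<^sub>1 - \<xi>\<^sub>0)))\<close> the process \<open>exp (- \<theta> \<xi>\<^sub>n) / \<phi> ^ n\<close>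
  is a martingale; \<open>\<phi> > 1\<close> when the walk has no positive drift.\<close>

lemma hit_prob_martingale:
  fixes \<theta> l :: real
  assumes "0 < \<theta>" "0 \<le> l" "l \<le> 1"
  defines "\<phi> \<equiv> exp (\<theta> + l * (exp (- \<theta>) - 1))"
  shows "exp (- \<theta> * real r) \<le> (\<Sum>n\<le>K. hit_prob l n r * (1 / \<phi>) ^ n) + (1 / \<phi>) ^ K"
proof (induction K arbitrary: r)
  case 0
  \<comment> \<open>At \<open>K = 0\<close> the error term is 1 and already dominates.\<close>
  show ?case using assms by (simp add: hit_prob_nonneg)
next
  case (Suc K)
  show ?case
  proof (cases "r = 0")
    case True
    have "1 \<le> (\<Sum>n\<le>Suc K. hit_prob l n r * (1 / \<phi>) ^ n)"
      using True by (subst sum.atMost_Suc_shift) (auto intro!: sum_nonneg)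
    moreover have "0 \<le> (1 / \<phi>) ^ Suc K" by (simp add: \<phi>_def)
    ultimately show ?thesis using True by simp
  next
    case False
    let ?p = "poisson0_pmf l"
    have phi: "0 < \<phi>" by (simp add: \<phi>_def)
    have mono: "1 / \<phi> * x \<le> 1 / \<phi> * y" if "x \<le> y" for x y
      using phi that by (intro mult_left_mono) auto
    have ge: "0 \<le> exp (- \<theta>)" by simp
    have mean: "measure_pmf.expectation ?p (\<lambda>k. exp (- \<theta>) ^ k) = exp (l * (exp (- \<theta>) - 1))"
    proof -
      have "ennreal (measure_pmf.expectation ?p (\<lambda>k. exp (- \<theta>) ^ k)) = (\<integral>\<^sup>+k. ennreal (exp (- \<theta>) ^ k) \<partial>?p)"
        using assms
        by (intro nn_integral_eq_integral[symmetric] measure_pmf.integrable_const_bound[where B = 1])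
          (auto intro!: power_le_one)
      then show ?thesis using nn_integral_poisson0_power[OF assms(2) ge]
        by (simp add: Bochner_Integration.integral_nonneg)
    qed
    have int1: "integrable ?p (\<lambda>k. exp (- \<theta>) ^ k)"
      using assms by (intro measure_pmf.integrable_const_bound[where B = 1]) (auto intro!: power_le_one)
    have int2: "integrable ?p (\<lambda>k. hit_prob l n (r - 1 + k))" for n
      using hit_prob_nonneg hit_prob_le_1 by (intro measure_pmf.integrable_const_bound[where B = 1]) auto
    \<comment> \<open>The martingale identity for one step; the induction hypothesis is then
      averaged over the first increment.\<close>
    have "exp (- \<theta> * real r) = (1 / \<phi>) * (exp (- \<theta> * real (r - 1)) * exp (l * (exp (- \<theta>) - 1)))"
    proof -
      have "1 / \<phi> = exp (- (\<theta> + l * (exp (- \<theta>) - 1)))"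
        unfolding \<phi>_def by (simp only: exp_minus divide_inverse mult_1)
      moreover have "real (r - 1) = real r - 1" using False by simp
      ultimately show ?thesis by (simp only: exp_add [symmetric]) (simp add: algebra_simps)
    qed
    also have "exp (- \<theta> * real (r - 1)) * exp (l * (exp (- \<theta>) - 1)) =
        measure_pmf.expectation ?p (\<lambda>k. exp (- \<theta> * real (r - 1)) * exp (- \<theta>) ^ k)"
      using int1 by (simp add: mean)
    also have "\<dots> = measure_pmf.expectation ?p (\<lambda>k. exp (- \<theta> * real (r - 1 + k)))"
      by (simp add: exp_of_nat_mult[symmetric] exp_add[symmetric] algebra_simps)
    also have "\<dots> \<le> measure_pmf.expectation ?p (\<lambda>k. (\<Sum>n\<le>K. hit_prob l n (r - 1 + k) * (1 / \<phi>) ^ n) + (1 / \<phi>) ^ K)"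
    proof (rule integral_mono)
      show "integrable ?p (\<lambda>k. exp (- \<theta> * real (r - 1 + k)))"
        using assms by (intro measure_pmf.integrable_const_bound[where B = 1]) auto
      show "integrable ?p (\<lambda>k. (\<Sum>n\<le>K. hit_prob l n (r - 1 + k) * (1 / \<phi>) ^ n) + (1 / \<phi>) ^ K)"
        using int2 by (intro Bochner_Integration.integrable_add Bochner_Integration.integrable_sum integrable_mult_left) auto
    qed (rule Suc)
    also have "\<dots> = (\<Sum>n\<le>K. hit_prob l (Suc n) r * (1 / \<phi>) ^ n) + (1 / \<phi>) ^ K"
    proof -
      have e: "measure_pmf.expectation ?p (\<lambda>k. hit_prob l n (r - 1 + k)) = hit_prob l (Suc n) r" for n
        using False by (simp only: expectation_hit_prob hit_prob.simps if_False)
      have "measure_pmf.expectation ?p (\<lambda>k. (\<Sum>n\<le>K. hit_prob l n (r - 1 + k) * (1 / \<phi>) ^ n) + (1 / \<phi>) ^ K) =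
        measure_pmf.expectation ?p (\<lambda>k. \<Sum>n\<le>K. hit_prob l n (r - 1 + k) * (1 / \<phi>) ^ n) + (1 / \<phi>) ^ K"
        using int2 by (subst Bochner_Integration.integral_add)
          (auto intro!: Bochner_Integration.integrable_sum integrable_mult_left)
      also have "measure_pmf.expectation ?p (\<lambda>k. \<Sum>n\<le>K. hit_prob l n (r - 1 + k) * (1 / \<phi>) ^ n) =
        (\<Sum>n\<le>K. measure_pmf.expectation ?p (\<lambda>k. hit_prob l n (r - 1 + k)) * (1 / \<phi>) ^ n)"
        using int2 by (subst Bochner_Integration.integral_sum) (auto simp del: hit_prob.simps)
      finally show ?thesis unfolding e .
    qed
    also have "(1 / \<phi>) * \<dots> = (\<Sum>n\<le>K. hit_prob l (Suc n) r * (1 / \<phi>) ^ Suc n) + (1 / \<phi>) ^ Suc K"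
      by (simp add: distrib_left sum_distrib_left mult_ac del: hit_prob.simps)
    also have "(\<Sum>n\<le>K. hit_prob l (Suc n) r * (1 / \<phi>) ^ Suc n) = (\<Sum>n\<le>Suc K. hit_prob l n r * (1 / \<phi>) ^ n)"
      using False by (subst sum.atMost_Suc_shift) simp
    finally show ?thesis using mono by blast
  qed
qed

text \<open>For \<open>l \<le> 1\<close> the base \<phi> exceeds 1, so letting \<open>K\<close> grow
  removes the error term and leaves \<open>exp (- \<theta>)\<close> as a lower bound; then \<theta>
  tends to 0. Strictness of \<open>1 - \<theta> < exp (- \<theta>)\<close> covers the critical value
  \<open>l = 1\<close> too.\<close>

lemma hit_prob_sum_eq_1:
  assumes "0 \<le> l" "l \<le> 1"
  shows "(\<Sum>n. hit_prob l n 1) = 1"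
proof (rule antisym)
  show "(\<Sum>n. hit_prob l n 1) \<le> 1" by (rule hit_prob_suminf_le)
  have le: "exp (- \<theta>) \<le> (\<Sum>n. hit_prob l n 1)" if \<theta>: "0 < \<theta>" for \<theta> :: real
  proof -
    define \<phi> where "\<phi> = exp (\<theta> + l * (exp (- \<theta>) - 1))"
    have "0 < \<theta> + l * (exp (- \<theta>) - 1)"
    proof -
      have "1 - \<theta> < exp (- \<theta>)" using exp_minus_greater[of \<theta>] \<theta> by simp
      moreover have "1 * (exp (- \<theta>) - 1) \<le> l * (exp (- \<theta>) - 1)"
        using assms \<theta> by (intro mult_right_mono_neg) auto
      ultimately show ?thesis by simp
    qed
    then have phi: "1 < \<phi>" by (simp add: \<phi>_def)
    have "exp (- \<theta>) \<le> (\<Sum>n. hit_prob l n 1) + (1 / \<phi>) ^ K" for K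
    proof -
      have "exp (- \<theta>) \<le> (\<Sum>n\<le>K. hit_prob l n 1 * (1 / \<phi>) ^ n) + (1 / \<phi>) ^ K"
        using hit_prob_martingale[OF \<theta> assms, of 1 K] by (simp add: \<phi>_def)
      also have "(\<Sum>n\<le>K. hit_prob l n 1 * (1 / \<phi>) ^ n) \<le> (\<Sum>n\<le>K. hit_prob l n 1 * 1)"
        using phi by (intro sum_mono mult_left_mono power_le_one hit_prob_nonneg) auto
      also have "\<dots> \<le> (\<Sum>n. hit_prob l n 1)"
        using sum_le_suminf[OF hit_prob_summable, of "{..K}" l] by (simp add: hit_prob_nonneg)
      finally show ?thesis by simp
    qed
    moreover have "(\<lambda>K. (\<Sum>n. hit_prob l n 1) + (1 / \<phi>) ^ K) \<longlonglongrightarrow> (\<Sum>n. hit_prob l n 1) + 0"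
      using phi by (intro tendsto_intros LIMSEQ_power_zero) auto
    ultimately show ?thesis by (intro LIMSEQ_le_const[of _ "(\<Sum>n. hit_prob l n 1)"]) auto
  qed
  have "((\<lambda>\<theta>. exp (- \<theta>)) \<longlongrightarrow> exp (- 0)) (at_right (0::real))"
    by (intro tendsto_intros)
  then have "((\<lambda>\<theta>. exp (- \<theta>)) \<longlongrightarrow> 1) (at_right (0::real))" by simp
  then show "1 \<le> (\<Sum>n. hit_prob l n 1)"
    by (rule tendsto_upperbound) (auto intro!: eventually_mono[OF eventually_at_right_less] le[simplified])
qed

section \<open>A limit criterion for pairs that are either bounded or giant\<close>

text \<open>Serves both convergence statements. By \<open>diag\<close> and \<open>marg\<close>, mass
  at bounded \<open>T\<close> concentrates on the diagonal; the remaining mass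
  \<open>1 - suminf h\<close> has large \<open>T\<close>, where \<open>tail\<close> keeps
  \<open>F\<close> close to \<open>b\<close>.\<close>

lemma expectation_two_point_limit:
  fixes P :: "nat \<Rightarrow> (nat \<times> nat) pmf" and F :: "nat \<Rightarrow> nat \<times> nat \<Rightarrow> real"
  assumes bounded: "\<And>N x. \<bar>F N x\<bar> \<le> B" and b: "\<bar>b\<bar> \<le> B"
    and diag: "\<And>n. (\<lambda>N. measure_pmf.prob (P N) {(n, n)}) \<longlonglongrightarrow> h n"
    and marg: "\<And>n. (\<lambda>N. measure_pmf.prob (P N) {(T, Z). T = n}) \<longlonglongrightarrow> h n"
    and a: "\<And>n. (\<lambda>N. F N (n, n)) \<longlonglongrightarrow> a n"
    and tail: "\<And>e. 0 < e \<Longrightarrow> \<exists>K. \<forall>\<^sub>F N in sequentially.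
        measure_pmf.prob (P N) {(T, Z). K < T \<and> e < \<bar>F N (T, Z) - b\<bar>} \<le> e"
    and h: "summable h"
  shows "(\<lambda>N. measure_pmf.expectation (P N) (F N)) \<longlonglongrightarrow> (\<Sum>n. h n * a n) + (1 - suminf h) * b"
proof -
  have B0: "0 \<le> B" using b by linarith
  have h0: "0 \<le> h n" for n using diag by (rule LIMSEQ_le_const) auto
  have aB: "\<bar>a n\<bar> \<le> B" for n
    by (rule LIMSEQ_le_const2[OF tendsto_rabs[OF a]]) (use bounded in auto)
  let ?D = "\<lambda>n. h n * (a n - b)"
  have abB: "\<bar>a n - b\<bar> \<le> 2 * B" for n using aB[of n] b by linarith
  have sD: "summable ?D"
  proof (rule summable_comparison_test')
    show "summable (\<lambda>n. (2 * B) * h n)" using h by (rule summable_mult)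
    show "norm (?D n) \<le> (2 * B) * h n" for n
      using mult_right_mono[OF abB[of n] h0[of n]] h0 by (simp add: abs_mult mult.commute)
  qed
  have sa: "summable (\<lambda>n. h n * a n)"
    using summable_add[OF sD summable_mult2[OF h, of b]] by (simp add: algebra_simps)
  \<comment> \<open>Subtracting \<open>b\<close> from the values absorbs the escaping mass, so only
    a finite part of a series has to be approximated.\<close>
  have target: "(\<Sum>n. h n * a n) + (1 - suminf h) * b = suminf ?D + b"
  proof -
    have "suminf ?D = (\<Sum>n. h n * a n - h n * b)" by (simp add: right_diff_distrib)
    also have "\<dots> = (\<Sum>n. h n * a n) - suminf h * b"
      using sa h by (subst suminf_diff[symmetric]) (auto simp: suminf_mult2 summable_mult2)
    finally show ?thesis by (simp add: algebra_simps)
  qed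
  have "\<forall>\<^sub>F N in sequentially. \<bar>measure_pmf.expectation (P N) (F N) - (suminf ?D + b)\<bar> < e" if e: "0 < e" for e
  proof -
    \<comment> \<open>Error budget: \<open>d\<close> from the tail tolerance,
      \<open>4 * B * d\<close> from the two exceptional events, and \<open>d\<close> each from the
      limit in \<open>N\<close> and from truncating the series.\<close>
    define d where "d = e / (4 + 4 * B)"
    have d: "0 < d" using e B0 by (simp add: d_def)
    obtain K0 where K0: "\<forall>\<^sub>F N in sequentially. measure_pmf.prob (P N) {(T, Z). K0 < T \<and> d < \<bar>F N (T, Z) - b\<bar>} \<le> d"
      using tail[OF d] by blast
    have "(\<lambda>n. \<Sum>i<n. ?D i) \<longlonglongrightarrow> suminf ?D" using sD by (rule summable_LIMSEQ)
    then have "\<forall>\<^sub>F n in sequentially. \<bar>(\<Sum>i<n. ?D i) - suminf ?D\<bar> < d"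
      using tendstoD[OF _ d] by (fastforce simp: dist_real_def)
    then obtain K1 where K1: "\<And>n. n \<ge> K1 \<Longrightarrow> \<bar>(\<Sum>i<n. ?D i) - suminf ?D\<bar> < d"
      by (auto simp: eventually_sequentially)
    define K where "K = max (Suc K0) K1"
    have KD: "\<bar>(\<Sum>i<K. ?D i) - suminf ?D\<bar> < d" using K1 by (simp add: K_def)
    let ?off = "{(T, Z). T < K \<and> Z \<noteq> T}"
    let ?bad = "\<lambda>N. {(T, Z). K0 < T \<and> d < \<bar>F N (T, Z) - b\<bar>}"
    let ?S = "\<lambda>N. \<Sum>n<K. measure_pmf.prob (P N) {(n, n)} * (F N (n, n) - b)"
    have "?S \<longlonglongrightarrow> (\<Sum>n<K. ?D n)" by (intro tendsto_intros diag a)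
    then have ev1: "\<forall>\<^sub>F N in sequentially. \<bar>?S N - (\<Sum>n<K. ?D n)\<bar> < d"
      using tendstoD[OF _ d] by (fastforce simp: dist_real_def)
    have "(\<lambda>N. \<Sum>n<K. measure_pmf.prob (P N) {(T, Z). T = n} - measure_pmf.prob (P N) {(n, n)}) \<longlonglongrightarrow> (\<Sum>n<K. h n - h n)"
      by (intro tendsto_intros diag marg)
    then have "\<forall>\<^sub>F N in sequentially. (\<Sum>n<K. measure_pmf.prob (P N) {(T, Z). T = n} - measure_pmf.prob (P N) {(n, n)}) < d"
      using d by (intro order_tendstoD(2)) auto
    then have ev2: "\<forall>\<^sub>F N in sequentially. measure_pmf.prob (P N) ?off < d"
    proof eventually_elim
      case (elim N)
      have "measure_pmf.prob (P N) ?off \<le> measure_pmf.prob (P N) (\<Union>n<K. {(T, Z). T = n} - {(n, n)})"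
        by (intro measure_pmf.finite_measure_mono) auto
      also have "\<dots> \<le> (\<Sum>n<K. measure_pmf.prob (P N) ({(T, Z). T = n} - {(n, n)}))"
        by (intro measure_pmf.finite_measure_subadditive_finite) auto
      also have "\<dots> = (\<Sum>n<K. measure_pmf.prob (P N) {(T, Z). T = n} - measure_pmf.prob (P N) {(n, n)})"
        by (intro sum.cong refl measure_pmf.finite_measure_Diff) auto
      finally show ?case using elim by simp
    qed
    show ?thesis using ev1 ev2 K0
    proof eventually_elim
      case (elim N)
      let ?E = "measure_pmf.expectation (P N)"
      let ?g = "\<lambda>x. \<Sum>n<K. indicator {(n, n)} x * (F N (n, n) - b)"
      have int: "integrable (P N) G" if "\<And>x. \<bar>G x\<bar> \<le> C" for G :: "nat \<times> nat \<Rightarrow> real" and C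
        using that by (intro measure_pmf.integrable_const_bound[where B = C]) auto
      have iF: "integrable (P N) (F N)" using bounded by (rule int)
      have ig: "integrable (P N) ?g" by (intro Bochner_Integration.integrable_sum integrable_mult_left) (auto intro: int[of _ 1] simp: indicator_def)
      have FB: "\<bar>F N x - b\<bar> \<le> 2 * B" for x using bounded[of N x] b by linarith
      have point: "\<bar>(F N x - b) - ?g x\<bar> \<le> d + 2 * B * indicator ?off x + 2 * B * indicator (?bad N) x" for x
      proof (cases x)
        case (Pair T Z)
        consider "T < K" "Z = T" | "T < K" "Z \<noteq> T" | "K \<le> T" by linarith
        then show ?thesis
        proof cases
          case 1
          have "?g x = (\<Sum>n<K. if n = T then F N (n, n) - b else 0)"
            using 1 Pair by (intro sum.cong) (auto simp: indicator_def)
          also have "\<dots> = F N x - b" using 1 Pair by simp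
          finally show ?thesis using d B0 by simp
        next
          case 2
          have g0: "?g x = 0" using 2 Pair by (intro sum.neutral) (auto simp: indicator_def)
          have o1: "indicator ?off x = (1::real)" using 2 Pair by simp
          have "0 \<le> 2 * B * indicator (?bad N) x" using B0 by simp
          then show ?thesis unfolding g0 o1 using d FB[of x] by linarith
        next
          case 3
          have g0: "?g x = 0" using 3 Pair by (intro sum.neutral) (auto simp: indicator_def)
          have o0: "indicator ?off x = (0::real)" using 3 Pair by simp
          show ?thesis
          proof (cases "d < \<bar>F N x - b\<bar>")
            case True
            then have "x \<in> ?bad N" using 3 Pair by (auto simp: K_def)
            then show ?thesis using g0 o0 d FB[of x] by simp
          next
            case False
            then show ?thesis using g0 o0 B0 by (simp add: add_increasing2)
          qed
        qed
      qed
      have "?E (F N) - b - ?S N = ?E (\<lambda>x. (F N x - b) - ?g x)"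
      proof -
        have iI: "integrable (P N) (\<lambda>x. indicator {(n, n)} x * (F N (n, n) - b))" for n
          by (intro integrable_mult_left int[of _ 1]) (simp add: indicator_def)
        have "?E ?g = ?S N"
          using iI by (subst Bochner_Integration.integral_sum) simp_all
        then show ?thesis using iF ig by simp
      qed
      also have "\<bar>\<dots>\<bar> \<le> ?E (\<lambda>x. \<bar>(F N x - b) - ?g x\<bar>)" by (rule integral_abs_bound)
      also have "\<dots> \<le> ?E (\<lambda>x. d + 2 * B * indicator ?off x + 2 * B * indicator (?bad N) x)"
        using iF ig point by (intro integral_mono) (auto intro!: Bochner_Integration.integrable_add integrable_mult_right intro: int[of _ 1] simp: indicator_def)
      also have "\<dots> = d + 2 * B * measure_pmf.prob (P N) ?off + 2 * B * measure_pmf.prob (P N) (?bad N)"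
      proof -
        have ind: "integrable (P N) (\<lambda>x. 2 * B * indicator A x)" for A
          by (intro integrable_mult_right int[of _ 1]) (simp add: indicator_def)
        have c: "integrable (P N) (\<lambda>x. d)" by simp
        show ?thesis
          by (simp only: Bochner_Integration.integral_add[OF Bochner_Integration.integrable_add[OF c ind] ind]
            Bochner_Integration.integral_add[OF c ind]) simp
      qed
      also have "\<dots> \<le> d + 2 * B * d + 2 * B * d"
        using elim B0 by (intro add_mono mult_left_mono) auto
      finally have "\<bar>?E (F N) - b - ?S N\<bar> \<le> d + 4 * B * d" by simp
      then have "\<bar>?E (F N) - (suminf ?D + b)\<bar> < d + 4 * B * d + d + d"
        using elim(1) KD by linarith
      also have "\<dots> \<le> (4 + 4 * B) * d" using d by (simp add: algebra_simps)
      also have "\<dots> = e" using B0 by (simp add: d_def)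
      finally show ?case .
    qed
  qed
  then show ?thesis unfolding target by (intro tendstoI) (simp add: dist_real_def)
qed

section \<open>The fluid limit\<close>


text \<open>The tilt \<open>t = y / p\<close> minimises the rate \<open>p * (t - 1) - y * ln t\<close>, and the minimum
  \<open>y - p - y * ln (y / p)\<close> is negative unless \<open>y = p\<close>.\<close>

lemma chernoff_limit:
  fixes A Q :: "nat \<Rightarrow> real"
  assumes A: "(\<lambda>N. A N / real N) \<longlonglongrightarrow> y" and Q: "(\<lambda>N. Q N / real N) \<longlonglongrightarrow> p"
    and pos: "0 < y" "0 < p" "y \<noteq> p"
  shows "(\<lambda>N. exp ((1 - A N) * ln (y / p) + Q N * (y / p - 1))) \<longlonglongrightarrow> 0"
proof -
  let ?E = "\<lambda>N. (1 - A N) * ln (y / p) + Q N * (y / p - 1)"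
  let ?c = "(0 - y) * ln (y / p) + p * (y / p - 1)"
  have "ln (p / y) < p / y - 1"
    using ln_le_minus_one[of "p / y"] ln_eq_minus_one[of "p / y"] pos by fastforce
  then have "y * ln (p / y) < y * (p / y - 1)" using pos by (intro mult_strict_left_mono) auto
  moreover have "ln (y / p) = - ln (p / y)" using pos by (simp add: ln_div)
  moreover have "y * (p / y - 1) = p - y" "p * (y / p - 1) = y - p" using pos by (auto simp: field_simps)
  ultimately have c: "?c < 0" by simp
  have "(\<lambda>N. (1 / real N - A N / real N) * ln (y / p) + Q N / real N * (y / p - 1)) \<longlonglongrightarrow> ?c"
    by (intro tendsto_intros A Q lim_1_over_n)
  then have "LIM N sequentially. ((1 / real N - A N / real N) * ln (y / p) + Q N / real N * (y / p - 1)) * real N :> at_bot"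
    by (rule filterlim_tendsto_neg_mult_at_bot[OF _ c filterlim_real_sequentially])
  moreover have "\<forall>\<^sub>F N in sequentially.
      ((1 / real N - A N / real N) * ln (y / p) + Q N / real N * (y / p - 1)) * real N = ?E N"
    using eventually_gt_at_top[of 0] by eventually_elim (simp add: field_simps)
  ultimately have "LIM N sequentially. ?E N :> at_bot"
    by (simp add: filterlim_cong[OF refl refl])
  then show ?thesis by (rule filterlim_compose[OF exp_at_bot])
qed

definition scaled :: "real \<Rightarrow> nat \<Rightarrow> nat" where
  "scaled x N = nat \<lfloor>x * real N\<rfloor>"

lemma scaled_le: "0 \<le> x \<Longrightarrow> real (scaled x N) \<le> x * real N"
  by (simp add: scaled_def)

lemma scaled_gt: "x * real N < real (scaled x N) + 1"
  by (cases "0 \<le> x * real N") (auto simp: scaled_def)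

lemma scaled_limit:
  assumes "0 \<le> x"
  shows "(\<lambda>N. real (scaled x N) / real N) \<longlonglongrightarrow> x"
proof (rule tendsto_sandwich[of "\<lambda>N. x - 1 / real N" _ _ "\<lambda>_. x"])
  show "\<forall>\<^sub>F N in sequentially. x - 1 / real N \<le> real (scaled x N) / real N"
    using eventually_gt_at_top[of 0]
  proof eventually_elim
    case (elim N)
    have "x \<le> (real (scaled x N) + 1) / real N"
      using scaled_gt[of x N] elim by (simp add: pos_le_divide_eq)
    then show ?case by (simp add: add_divide_distrib)
  qed
  show "\<forall>\<^sub>F N in sequentially. real (scaled x N) / real N \<le> x"
    using eventually_gt_at_top[of 0]
    by eventually_elim (use scaled_le[OF assms] in \<open>simp add: field_simps\<close>)
  show "(\<lambda>N. x - 1 / real N) \<longlonglongrightarrow> x" by real_asymp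
qed auto

lemma eventually_scaled_ge:
  assumes "0 < x"
  shows "\<forall>\<^sub>F N in sequentially. k \<le> scaled x N"
proof -
  have "filterlim (\<lambda>N. x * real N) at_top sequentially"
    using assms by real_asymp
  then have "\<forall>\<^sub>F N in sequentially. real k + 1 \<le> x * real N"
    by (simp add: filterlim_at_top)
  then show ?thesis
  proof eventually_elim
    case (elim N)
    then show ?case using scaled_gt[of x N] by linarith
  qed
qed

lemma eventually_scaled_less:
  assumes "0 \<le> x" "x < 1"
  shows "\<forall>\<^sub>F N in sequentially. Suc (scaled x N) \<le> N"
  using eventually_gt_at_top[of 0]
proof eventually_elim
  case (elim N)
  have "x * real N < 1 * real N" using assms elim by (intro mult_strict_right_mono) auto
  then show ?case using scaled_le[OF assms(1), of N] by linarith
qed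

section \<open>Limits of binomial ratios and of weighted binomial sums\<close>

lemma binomial_power_limit:
  assumes "(\<lambda>N. real (a N) / real N) \<longlonglongrightarrow> x"
  shows "(\<lambda>N. real (a N choose i) / real N ^ i) \<longlonglongrightarrow> x ^ i / fact i"
proof (induction i)
  case (Suc i)
  have e: "real (a N choose Suc i) = real (a N choose i) * (real (a N) - real i) / real (Suc i)" for N
  proof (cases "i \<le> a N")
    case True
    have "Suc i * (a N choose Suc i) = (a N choose i) * (a N - i)"
      using trans[OF binomial_absorption[of i "a N"] binomial_absorb_comp[of "a N" i, symmetric]]
      by (subst (2) mult.commute)
    then have "real (Suc i) * real (a N choose Suc i) = real (a N choose i) * (real (a N) - real i)"
      using True by (metis of_nat_diff of_nat_mult)
    then show ?thesis by (simp add: field_simps)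
  qed (simp add: binomial_eq_0)
  have lim: "(\<lambda>N. real (a N choose i) / real N ^ i * (real (a N) / real N - real i * (1 / real N)) / real (Suc i))
      \<longlonglongrightarrow> x ^ i / fact i * (x - real i * 0) / real (Suc i)"
    by (intro tendsto_intros Suc assms lim_1_over_n) auto
  have eq: "x ^ i / fact i * (x - real i * 0) / real (Suc i) = x ^ Suc i / fact (Suc i)"
    by (simp add: field_simps)
  have ev: "\<forall>\<^sub>F N in sequentially. real (a N choose i) / real N ^ i * (real (a N) / real N - real i * (1 / real N)) / real (Suc i)
      = real (a N choose Suc i) / real N ^ Suc i"
    using eventually_gt_at_top[of 0]
    by eventually_elim (simp add: e field_simps)
  show ?case using Lim_transform_eventually[OF lim ev] unfolding eq .
qed simp

lemma binomial_ratio_limit: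
  assumes "(\<lambda>N. real (a N) / real N) \<longlonglongrightarrow> x" "(\<lambda>N. real (m N) / real N) \<longlonglongrightarrow> 1"
  shows "(\<lambda>N. real (a N choose i) / real (m N choose i)) \<longlonglongrightarrow> x ^ i"
proof -
  have "(\<lambda>N. (real (a N choose i) / real N ^ i) / (real (m N choose i) / real N ^ i)) \<longlonglongrightarrow> (x ^ i / fact i) / (1 ^ i / fact i)"
    by (intro tendsto_divide binomial_power_limit assms) auto
  moreover have "\<forall>\<^sub>F N in sequentially. (real (a N choose i) / real N ^ i) / (real (m N choose i) / real N ^ i)
      = real (a N choose i) / real (m N choose i)"
    using eventually_gt_at_top[of 0] by eventually_elim simp
  ultimately show ?thesis by (auto intro: Lim_transform_eventually)
qed

text \<open>Tannery's theorem: each ratio tends to \<open>x ^ i\<close> and is at most 1 because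
  \<open>a N \<le> m N\<close>, so the weights dominate. They will be the coefficients of \<beta>
  and of \<beta>', which is where finiteness of \<beta>' at 1 enters.\<close>

lemma weighted_binomial_limit:
  assumes a: "(\<lambda>N. real (a N) / real N) \<longlonglongrightarrow> x" and m: "(\<lambda>N. real (m N) / real N) \<longlonglongrightarrow> 1"
    and le: "\<forall>\<^sub>F N in sequentially. a N \<le> m N"
    and w: "\<And>i. 0 \<le> w i" "summable w"
  shows "(\<lambda>N. \<Sum>i\<le>a N. w i * (real (a N choose i) / real (m N choose i))) \<longlonglongrightarrow> (\<Sum>i. w i * x ^ i)"
proof -
  let ?t = "\<lambda>i N. w i * (real (a N choose i) / real (m N choose i))"
  have "\<forall>\<^sub>F (i :: nat, N) in at_top \<times>\<^sub>F sequentially. a N \<le> m N"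
    using le by (subst eventually_prod2) auto
  then have bound: "\<forall>\<^sub>F (i, N) in at_top \<times>\<^sub>F sequentially. norm (?t i N) \<le> w i"
  proof eventually_elim
    case (elim p)
    obtain i N where p: "p = (i, N)" by fastforce
    have "a N choose i \<le> m N choose i" using elim p by (simp add: binomial_right_mono)
    then have "real (a N choose i) / real (m N choose i) \<le> 1" by (auto simp: divide_le_eq_1)
    then have "?t i N \<le> w i" using w(1)[of i] by (intro mult_left_le)
    moreover have "0 \<le> ?t i N" using w(1)[of i] by (intro mult_nonneg_nonneg) auto
    ultimately show ?case by (simp only: p case_prod_conv real_norm_def abs_of_nonneg)
  qed
  have "(\<lambda>N. \<Sum>i. ?t i N) \<longlonglongrightarrow> (\<Sum>i. w i * x ^ i)"
    by (rule conjunct2[OF conjunct2[OF tannerys_theorem[OF tendsto_mult_left[OF binomial_ratio_limit[OF a m]] bound w(2)]]])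
      simp
  moreover have "(\<Sum>i. ?t i N) = (\<Sum>i\<le>a N. ?t i N)" for N
    by (rule suminf_finite) auto
  ultimately show ?thesis by simp
qed

section \<open>Fluid profiles and their probabilistic consequences\<close>

locale collapse_parameters = poisson_parameters +
  fixes g :: real
  assumes \<beta>2: "0 < \<beta> 2"
    and deriv_summable: "summable (\<lambda>k. real k * \<beta> k)"
    and g_Inf: "g = Inf {x \<in> {0..<1}. (\<Sum>k. real k * \<beta> k * x ^ (k - 1)) + ln (1 - x) < 0}"
    and below_g: "\<And>x. 0 < x \<Longrightarrow> x < g \<Longrightarrow> 0 < (\<Sum>k. real k * \<beta> k * x ^ (k - 1)) + ln (1 - x)"
begin

definition gen :: "real \<Rightarrow> real" where "gen x = (\<Sum>k. \<beta> k * x ^ k)"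
definition gen' :: "real \<Rightarrow> real" where "gen' x = (\<Sum>k. real k * \<beta> k * x ^ (k - 1))"
text \<open>Limits per vertex at collapse time \<open>x * N\<close>: patches created here, vertices
  patched at least once in \<open>hit_density\<close>. The collapse is sustained while
  \<open>hit_density x\<close> exceeds \<open>x\<close>.\<close>

definition edge_density :: "real \<Rightarrow> real" where "edge_density x = gen x + (1 - x) * gen' x"
definition hit_density :: "real \<Rightarrow> real" where "hit_density x = 1 - exp (- gen' x)"

lemma \<beta>_summable: "summable \<beta>"
proof (rule summable_comparison_test'[OF deriv_summable])
  fix k :: nat assume "1 \<le> k"
  then have "1 * \<beta> k \<le> real k * \<beta> k" by (intro mult_right_mono) (auto simp: \<beta>_nonneg)
  then show "norm (\<beta> k) \<le> real k * \<beta> k" by (simp add: \<beta>_nonneg)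
qed

lemma deriv_summable_Suc: "summable (\<lambda>k. real (Suc k) * \<beta> (Suc k))"
  using deriv_summable by (subst summable_Suc_iff)

lemma gen_summable: "0 \<le> x \<Longrightarrow> x \<le> 1 \<Longrightarrow> summable (\<lambda>k. \<beta> k * x ^ k)"
  by (rule summable_comparison_test'[OF \<beta>_summable])
    (auto simp: abs_mult \<beta>_nonneg power_abs intro!: mult_left_le power_le_one)

lemma gen'_summable: "0 \<le> x \<Longrightarrow> x \<le> 1 \<Longrightarrow> summable (\<lambda>k. real k * \<beta> k * x ^ (k - 1))"
  by (rule summable_comparison_test'[OF deriv_summable])
    (auto simp: abs_mult \<beta>_nonneg power_abs intro!: mult_left_le power_le_one)

text \<open>The \<open>k = 0\<close> term has exponent \<open>0 - 1 = 0\<close> but coefficient 0;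
  dropping it leaves a genuine power series, for which \<open>isCont_powser\<close> gives
  continuity.\<close>

lemma gen'_altdef: "0 \<le> x \<Longrightarrow> x \<le> 1 \<Longrightarrow> gen' x = (\<Sum>k. real (Suc k) * \<beta> (Suc k) * x ^ k)"
  unfolding gen'_def using suminf_split_head[OF gen'_summable] by simp

lemma isCont_gen: assumes "0 < x" "x < 1" shows "isCont gen x"
  unfolding gen_def using \<beta>_summable assms by (intro isCont_powser[where K = 1]) auto

lemma isCont_gen': assumes "0 < x" "x < 1" shows "isCont gen' x"
proof -
  have c: "isCont (\<lambda>x. \<Sum>k. real (Suc k) * \<beta> (Suc k) * x ^ k) x"
    using deriv_summable_Suc assms by (intro isCont_powser[where K = 1]) (auto simp del: of_nat_Suc)
  have "\<forall>\<^sub>F y in nhds x. y \<in> {0<..<1}"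
    using assms by (intro eventually_nhds_in_open) auto
  then have "\<forall>\<^sub>F y in nhds x. gen' y = (\<Sum>k. real (Suc k) * \<beta> (Suc k) * y ^ k)"
    by eventually_elim (simp add: gen'_altdef del: of_nat_Suc)
  from iffD2[OF isCont_cong[OF this] c] show ?thesis .
qed

lemma isCont_hit_density: "0 < x \<Longrightarrow> x < 1 \<Longrightarrow> isCont hit_density x"
  unfolding hit_density_def by (intro continuous_intros isCont_gen')

lemma isCont_edge_density: "0 < x \<Longrightarrow> x < 1 \<Longrightarrow> isCont edge_density x"
  unfolding edge_density_def by (intro continuous_intros isCont_gen isCont_gen')

lemma gen'_ge: assumes "0 \<le> x" "x \<le> 1" shows "2 * \<beta> 2 * x \<le> gen' x"
proof -
  have "sum (\<lambda>k. real k * \<beta> k * x ^ (k - 1)) {2} \<le> gen' x"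
    unfolding gen'_def using assms
    by (intro sum_le_suminf gen'_summable) (auto simp: \<beta>_nonneg)
  then show ?thesis by simp
qed

lemma gen_nonneg: "0 \<le> x \<Longrightarrow> x \<le> 1 \<Longrightarrow> 0 \<le> gen x"
  unfolding gen_def by (intro suminf_nonneg gen_summable) (auto simp: \<beta>_nonneg)

lemma hit_density_pos: assumes "0 < x" "x \<le> 1" shows "0 < hit_density x"
proof -
  have "0 < 2 * \<beta> 2 * x" using \<beta>2 assms by simp
  also have "\<dots> \<le> gen' x" using assms by (intro gen'_ge) auto
  finally show ?thesis by (simp add: hit_density_def)
qed

lemma edge_density_pos: assumes "0 < x" "x < 1" shows "0 < edge_density x"
proof -
  have "0 < 2 * \<beta> 2 * x" using \<beta>2 assms by simp
  also have "\<dots> \<le> gen' x" using assms by (intro gen'_ge) auto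
  finally have "0 < gen' x" .
  then show ?thesis using gen_nonneg[of x] assms by (simp add: edge_density_def add_nonneg_pos)
qed

lemma gt_hit_density_iff: "x < 1 \<Longrightarrow> x < hit_density x \<longleftrightarrow> 0 < gen' x + ln (1 - x)"
proof -
  assume x: "x < 1"
  have "x < hit_density x \<longleftrightarrow> exp (- gen' x) < exp (ln (1 - x))"
    using x by (auto simp: hit_density_def)
  then show ?thesis by (simp only: exp_less_cancel_iff) auto
qed

lemma lt_hit_density_iff: "x < 1 \<Longrightarrow> hit_density x < x \<longleftrightarrow> gen' x + ln (1 - x) < 0"
proof -
  assume x: "x < 1"
  have "hit_density x < x \<longleftrightarrow> exp (ln (1 - x)) < exp (- gen' x)"
    using x by (auto simp: hit_density_def)
  then show ?thesis by (simp only: exp_less_cancel_iff) auto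
qed

lemma scaled_patch_rate_limit:
  assumes "0 < x" "x < 1"
  shows "(\<lambda>N. patch_rate (rates N) (scaled x N)) \<longlonglongrightarrow> gen' x"
proof -
  have m: "(\<lambda>N. real (N - 1) / real N) \<longlonglongrightarrow> 1"
  proof (rule Lim_transform_eventually)
    show "(\<lambda>N. (real N - 1) / real N) \<longlonglongrightarrow> 1" by real_asymp
    show "\<forall>\<^sub>F N in sequentially. (real N - 1) / real N = real (N - 1) / real N"
      using eventually_gt_at_top[of 0] by eventually_elim auto
  qed
  have le: "\<forall>\<^sub>F N in sequentially. scaled x N \<le> N - 1"
    using eventually_scaled_less[of x] assms by (auto elim: eventually_mono)
  have "(\<lambda>N. \<Sum>i\<le>scaled x N. real (Suc i) * \<beta> (Suc i) * (real (scaled x N choose i) / real (N - 1 choose i)))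
      \<longlonglongrightarrow> (\<Sum>i. real (Suc i) * \<beta> (Suc i) * x ^ i)"
    using assms by (intro weighted_binomial_limit scaled_limit m le deriv_summable_Suc) (auto simp: \<beta>_nonneg)
  moreover have "\<forall>\<^sub>F N in sequentially.
      (\<Sum>i\<le>scaled x N. real (Suc i) * \<beta> (Suc i) * (real (scaled x N choose i) / real (N - 1 choose i)))
      = patch_rate (rates N) (scaled x N)"
    using eventually_gt_at_top[of 0]
  proof eventually_elim
    case (elim N)
    \<comment> \<open>Binomial absorption moves the factor \<open>Suc i\<close> out of
      \<open>N choose Suc i\<close> and so replaces it by \<open>N - 1 choose i\<close>.\<close>
    have "real (Suc i) * \<beta> (Suc i) * (real (scaled x N choose i) / real (N - 1 choose i)) =
       real (scaled x N choose i) * rates N (1 + i)" for i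
    proof -
      have "Suc i * (N choose Suc i) = N * (N - 1 choose i)"
        using elim binomial_absorption[of i N] by simp
      then have "real (Suc i) * real (N choose Suc i) = real N * real (N - 1 choose i)"
        by (metis of_nat_mult)
      note eq = this
      show ?thesis
      proof (cases "N - 1 choose i = 0")
        \<comment> \<open>For \<open>i > N - 1\<close> both sides are 0 through division by
          0.\<close>
        case True
        then have "N choose Suc i = 0" using eq by simp
        then have "real (N choose Suc i) = 0" "real (N - 1 choose i) = 0" using True by simp_all
        then show ?thesis unfolding initial_rates_def by (simp only: plus_1_eq_Suc) simp
      next
        case False
        then have "real (N choose Suc i) \<noteq> 0" using eq elim by (metis mult_zero_right of_nat_eq_0_iff mult_eq_0_iff not_gr_zero)
        then show ?thesis using False eq by (simp add: initial_rates_def field_simps del: of_nat_Suc)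
      qed
    qed
    then show ?case
      by (subst patch_rate_eq) (auto simp: initial_rates_def \<beta>1 shift_rates_funpow)
  qed
  ultimately show ?thesis using assms by (auto simp: gen'_altdef intro: Lim_transform_eventually)
qed

lemma scaled_patch_prob_limit:
  assumes "0 < x" "x < 1"
  shows "(\<lambda>N. (real N - 1) * patch_prob N (scaled x N) / real N) \<longlonglongrightarrow> hit_density x"
proof -
  have "(\<lambda>N. ((real N - 1) / real N) * patch_prob N (scaled x N)) \<longlonglongrightarrow> 1 * hit_density x"
    unfolding hit_density_def
    by (intro tendsto_intros scaled_patch_rate_limit assms) real_asymp
  then show ?thesis by (simp add: mult_ac)
qed

lemma scaled_total_patch_rate_limit:
  assumes "0 < x" "x < 1"
  shows "(\<lambda>N. total_patch_rate (rates N) N (scaled x N) / real N) \<longlonglongrightarrow> edge_density x"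
proof -
  have m: "(\<lambda>N. real N / real N) \<longlonglongrightarrow> 1" by real_asymp
  have le: "\<forall>\<^sub>F N in sequentially. scaled x N \<le> N"
    using eventually_scaled_less[of x] assms by (auto elim: eventually_mono)
  have "(\<lambda>N. \<Sum>i\<le>scaled x N. \<beta> i * (real (scaled x N choose i) / real (N choose i))) \<longlonglongrightarrow> gen x"
    unfolding gen_def using assms
    by (intro weighted_binomial_limit scaled_limit m le \<beta>_summable) (auto simp: \<beta>_nonneg)
  then have "(\<lambda>N. (\<Sum>i\<le>scaled x N. \<beta> i * (real (scaled x N choose i) / real (N choose i)))
      + (1 - real (scaled x N) / real N) * patch_rate (rates N) (scaled x N)) \<longlonglongrightarrow> edge_density x"
    unfolding edge_density_def using assms by (intro tendsto_intros scaled_patch_rate_limit scaled_limit) auto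
  moreover have "\<forall>\<^sub>F N in sequentially. (\<Sum>i\<le>scaled x N. \<beta> i * (real (scaled x N choose i) / real (N choose i)))
      + (1 - real (scaled x N) / real N) * patch_rate (rates N) (scaled x N)
      = total_patch_rate (rates N) N (scaled x N) / real N"
    using eventually_gt_at_top[of 0] le
  proof eventually_elim
    case (elim N)
    have z: "rates N 0 = 0" "rates N 1 = 0" by (auto simp: initial_rates_def \<beta>0 \<beta>1)
    have "total_patch_rate (rates N) N (scaled x N) =
        (\<Sum>i\<le>scaled x N. real (scaled x N choose i) * rates N i)
        + (real N - real (scaled x N)) * patch_rate (rates N) (scaled x N)"
      using elim by (simp add: total_patch_rate_eq[where lam = "rates N", OF z] patch_rate_eq[where lam = "rates N", OF z(2)] shift_rates_funpow of_nat_diff)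
    also have "(\<Sum>i\<le>scaled x N. real (scaled x N choose i) * rates N i) =
        real N * (\<Sum>i\<le>scaled x N. \<beta> i * (real (scaled x N choose i) / real (N choose i)))"
      by (simp add: initial_rates_def sum_distrib_left mult_ac)
    finally show ?case using elim by (simp add: field_simps)
  qed
  ultimately show ?thesis by (auto intro: Lim_transform_eventually)
qed

abbreviation "law \<equiv> domain_law \<beta> v0"

lemma tendsto_0_le:
  fixes f h :: "nat \<Rightarrow> real"
  assumes "h \<longlonglongrightarrow> 0" "\<forall>\<^sub>F N in sequentially. f N \<le> h N" "\<And>N. 0 \<le> f N"
  shows "f \<longlonglongrightarrow> 0"
  using assms by (intro tendsto_sandwich[of "\<lambda>_. 0" f _ h]) auto

lemma prob_domain_ge_limit:
  assumes x: "0 < x" "x < 1" "hit_density x < x"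
  shows "(\<lambda>N. measure_pmf.prob (law N) {(T, Z). scaled x N \<le> T}) \<longlonglongrightarrow> 0"
proof (rule tendsto_0_le)
  let ?t = "x / hit_density x"
  show "(\<lambda>N. exp ((1 - real (scaled x N)) * ln ?t + (real N - 1) * patch_prob N (scaled x N) * (?t - 1))) \<longlonglongrightarrow> 0"
    using x hit_density_pos[of x]
    by (intro chernoff_limit scaled_limit scaled_patch_prob_limit) auto
  show "\<forall>\<^sub>F N in sequentially. measure_pmf.prob (law N) {(T, Z). scaled x N \<le> T} \<le>
     exp ((1 - real (scaled x N)) * ln ?t + (real N - 1) * patch_prob N (scaled x N) * (?t - 1))"
    using eventually_ge_at_top[of v0] eventually_scaled_less[OF less_imp_le[OF x(1)] x(2)]
    by eventually_elim (use x hit_density_pos[of x] in \<open>intro prob_domain_ge; simp\<close>)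
qed simp

text \<open>By time \<open>x * N\<close> about \<open>hit_density x * N\<close> vertices have been
  patched, more than \<open>y * N\<close>, and all of them must be collapsed before the process
  stops. The margin therefore compares the profile at the left end of the window with its right
  end.\<close>

lemma prob_domain_between_limit:
  assumes x: "0 < x" "x \<le> y" "y < 1" "y < hit_density x"
  shows "(\<lambda>N. measure_pmf.prob (law N) {(T, Z). scaled x N \<le> T \<and> T \<le> scaled y N}) \<longlonglongrightarrow> 0"
proof (rule tendsto_0_le)
  let ?t = "y / hit_density x"
  show "(\<lambda>N. exp ((1 - real (scaled y N)) * ln ?t + (real N - 1) * patch_prob N (scaled x N) * (?t - 1))) \<longlonglongrightarrow> 0"
    using x hit_density_pos[of x]
    by (intro chernoff_limit scaled_limit scaled_patch_prob_limit) auto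
  have y: "0 \<le> y" using x by simp
  show "\<forall>\<^sub>F N in sequentially. measure_pmf.prob (law N) {(T, Z). scaled x N \<le> T \<and> T \<le> scaled y N} \<le>
     exp ((1 - real (scaled y N)) * ln ?t + (real N - 1) * patch_prob N (scaled x N) * (?t - 1))"
    using eventually_ge_at_top[of v0] eventually_scaled_less[OF y x(3)] eventually_scaled_ge[OF x(1), of 1]
  proof eventually_elim
    case (elim N)
    have "scaled x N \<le> scaled y N" unfolding scaled_def using x by (intro nat_mono floor_mono mult_right_mono) auto
    then show ?case using elim x hit_density_pos[of x] by (intro prob_domain_between) auto
  qed
qed simp

text \<open>A collapse lasting until time \<open>x * N\<close> has by then created about
  \<open>edge_density x * N\<close> patches, all of which are counted in \<open>Z\<close>.\<close>

lemma prob_edges_le_limit: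
  assumes x: "0 < x" "x < 1" "0 < \<zeta>" "\<zeta> < edge_density x"
  shows "(\<lambda>N. measure_pmf.prob (law N) {(T, Z). scaled x N \<le> T \<and> Z \<le> scaled \<zeta> N}) \<longlonglongrightarrow> 0"
proof (rule tendsto_0_le)
  let ?t = "\<zeta> / edge_density x"
  show "(\<lambda>N. exp ((1 - real (scaled \<zeta> N)) * ln ?t + total_patch_rate (rates N) N (scaled x N) * (?t - 1))) \<longlonglongrightarrow> 0"
    using x edge_density_pos[of x]
    by (intro chernoff_limit scaled_limit scaled_total_patch_rate_limit) auto
  show "\<forall>\<^sub>F N in sequentially. measure_pmf.prob (law N) {(T, Z). scaled x N \<le> T \<and> Z \<le> scaled \<zeta> N} \<le>
     exp ((1 - real (scaled \<zeta> N)) * ln ?t + total_patch_rate (rates N) N (scaled x N) * (?t - 1))"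
    using eventually_ge_at_top[of v0] eventually_scaled_less[OF less_imp_le[OF x(1)] x(2)] eventually_scaled_ge[OF x(1), of 1]
    by eventually_elim (use x edge_density_pos[of x] in \<open>intro prob_edges_le; simp\<close>)
qed simp

lemma prob_edges_ge_limit:
  assumes x: "0 < x" "x < 1" "edge_density x < \<zeta>"
  shows "(\<lambda>N. measure_pmf.prob (law N) {(T, Z). T \<le> scaled x N \<and> scaled \<zeta> N \<le> Z}) \<longlonglongrightarrow> 0"
proof (rule tendsto_0_le)
  let ?t = "\<zeta> / edge_density x"
  show "(\<lambda>N. exp ((1 - real (scaled \<zeta> N)) * ln ?t + total_patch_rate (rates N) N (scaled x N) * (?t - 1))) \<longlonglongrightarrow> 0"
    using x edge_density_pos[of x]
    by (intro chernoff_limit scaled_limit scaled_total_patch_rate_limit) auto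
  show "\<forall>\<^sub>F N in sequentially. measure_pmf.prob (law N) {(T, Z). T \<le> scaled x N \<and> scaled \<zeta> N \<le> Z} \<le>
     exp ((1 - real (scaled \<zeta> N)) * ln ?t + total_patch_rate (rates N) N (scaled x N) * (?t - 1))"
    using eventually_ge_at_top[of v0] eventually_scaled_less[OF less_imp_le[OF x(1)] x(2)]
    by eventually_elim (use x edge_density_pos[of x] in \<open>intro prob_edges_ge; simp\<close>)
qed simp

text \<open>The claim is additive over adjacent windows and holds for every short enough window
  around a point, because \<open>hit_density\<close> is continuous and exceeds the identity on (0,
  g). \<open>Bolzano\<close> is the bisection principle that combines the two.\<close>

lemma prob_domain_gap_limit:
  assumes uv: "0 < u" "u \<le> v" "v < g" "g < 1"
  shows "(\<lambda>N. measure_pmf.prob (law N) {(T, Z). scaled u N \<le> T \<and> T \<le> scaled v N}) \<longlonglongrightarrow> 0"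
    (is "?P u v")
proof (rule Bolzano[OF uv(2), where P = ?P])
  fix a b c assume ab: "?P a b" and bc: "?P b c"
  show "?P a c"
  proof (rule tendsto_0_le)
    show "(\<lambda>N. measure_pmf.prob (law N) {(T, Z). scaled a N \<le> T \<and> T \<le> scaled b N} +
        measure_pmf.prob (law N) {(T, Z). scaled b N \<le> T \<and> T \<le> scaled c N}) \<longlonglongrightarrow> 0"
      using tendsto_add[OF ab bc] by simp
    show "\<forall>\<^sub>F N in sequentially. measure_pmf.prob (law N) {(T, Z). scaled a N \<le> T \<and> T \<le> scaled c N} \<le>
        measure_pmf.prob (law N) {(T, Z). scaled a N \<le> T \<and> T \<le> scaled b N} +
        measure_pmf.prob (law N) {(T, Z). scaled b N \<le> T \<and> T \<le> scaled c N}"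
    proof (intro always_eventually allI)
      fix N
      have "measure_pmf.prob (law N) {(T, Z). scaled a N \<le> T \<and> T \<le> scaled c N} \<le>
        measure_pmf.prob (law N) ({(T, Z). scaled a N \<le> T \<and> T \<le> scaled b N} \<union> {(T, Z). scaled b N \<le> T \<and> T \<le> scaled c N})"
        by (intro measure_pmf.finite_measure_mono) auto
      also have "\<dots> \<le> measure_pmf.prob (law N) {(T, Z). scaled a N \<le> T \<and> T \<le> scaled b N} +
        measure_pmf.prob (law N) {(T, Z). scaled b N \<le> T \<and> T \<le> scaled c N}"
        by (intro measure_Un_le) auto
      finally show "measure_pmf.prob (law N) {(T, Z). scaled a N \<le> T \<and> T \<le> scaled c N} \<le>
        measure_pmf.prob (law N) {(T, Z). scaled a N \<le> T \<and> T \<le> scaled b N} +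
        measure_pmf.prob (law N) {(T, Z). scaled b N \<le> T \<and> T \<le> scaled c N}" .
    qed
  qed simp
next
  fix x assume x: "u \<le> x" "x \<le> v"
  then have x01: "0 < x" "x < 1" using uv by auto
  have gap: "x < hit_density x"
    using below_g[of x] x x01 uv by (subst gt_hit_density_iff) (auto simp: gen'_def)
  define m where "m = (x + hit_density x) / 2"
  have m: "x < m" "m < hit_density x" using gap by (auto simp: m_def)
  have "\<forall>\<^sub>F y in nhds x. m < hit_density y"
  proof -
    have "(hit_density \<longlongrightarrow> hit_density x) (nhds x)"
      using isCont_hit_density[OF x01] by (simp add: isCont_def tendsto_at_iff_tendsto_nhds)
    then show ?thesis using m(2) by (rule order_tendstoD(1))
  qed
  then obtain d where d: "0 < d" "\<And>y. dist y x < d \<Longrightarrow> m < hit_density y"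
    by (auto simp: eventually_nhds_metric)
  \<comment> \<open>In order, the four terms keep \<open>a\<close> within the continuity radius,
    \<open>a\<close> positive, \<open>b\<close> below \<open>m\<close>, and \<open>b\<close> below
    1.\<close>
  let ?d = "min (min d x) (min (m - x) (1 - x))"
  show "\<exists>d>0. \<forall>a b. a \<le> x \<and> x \<le> b \<and> b - a < d \<longrightarrow> ?P a b"
  proof (intro exI[of _ ?d] conjI allI impI)
    show "0 < ?d" using d m x01 by simp
    fix a b assume ab: "a \<le> x \<and> x \<le> b \<and> b - a < ?d"
    then have "m < hit_density a" using d(2)[of a] by (auto simp: dist_real_def)
    moreover have "b < m" using ab by auto
    ultimately show "?P a b" using ab by (intro prob_domain_between_limit) auto
  qed
qed

section \<open>The early phase in the supercritical case\<close>

text \<open>Edges of size 2 alone bound the patch rate below by \<open>?y\<close>, and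
  \<open>1 - exp (- y) \<ge> y / (1 + y)\<close> turns this into a linear bound. The slope lies
  halfway between 1 and \<open>2 * \<beta> 2\<close>; \<open>small\<close> is the range of
  \<open>n\<close> in which the denominator \<open>1 + ?y\<close> costs no more than that.\<close>

lemma patch_prob_lower:
  assumes N: "2 \<le> N" and n: "n \<le> N - 1" and l: "1 < 2 * \<beta> 2"
    and small: "real n * (2 * \<beta> 2 * (2 * \<beta> 2 + 1)) \<le> (2 * \<beta> 2 - 1) * (real N - 1)"
  shows "(2 * \<beta> 2 + 1) / 2 * real n \<le> (real N - 1) * patch_prob N n"
proof -
  let ?l = "2 * \<beta> 2" let ?y = "?l * real n / (real N - 1)" let ?M = "real N - 1"
  have M: "0 < ?M" using N by simp
  have C: "real (N choose 2) = real N * (real N - 1) / 2"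
    using N by (simp add: binomial_gbinomial gbinomial_prod_rev numeral_2_eq_2 field_simps)
  have "?y = real n * rates N 2"
    unfolding initial_rates_def C using M N by (simp add: divide_simps)
  also have "\<dots> = real (n choose 1) * rates N (1 + 1)" by (simp add: numeral_2_eq_2)
  also have "\<dots> \<le> (\<Sum>i\<le>n. real (n choose i) * rates N (1 + i))"
  proof (cases "1 \<le> n")
    case True
    then show ?thesis by (intro member_le_sum) (auto simp: rates_nonneg)
  next
    case False
    then have "n = 0" by simp
    then show ?thesis by (simp add: rates_nonneg)
  qed
  also have "\<dots> = patch_rate (rates N) n"
    by (subst patch_rate_eq) (auto simp: initial_rates_def \<beta>1 shift_rates_funpow)
  finally have y: "?y \<le> patch_rate (rates N) n" .
  have y0: "0 \<le> ?y" using M \<beta>2 by simp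
  have "exp (- patch_rate (rates N) n) \<le> exp (- ?y)" using y by simp
  also have "\<dots> \<le> 1 / (1 + ?y)"
    using exp_ge_add_one_self[of ?y] y0 by (simp add: exp_minus inverse_eq_divide frac_le)
  finally have "1 - 1 / (1 + ?y) \<le> patch_prob N n" by simp
  moreover have "1 - 1 / (1 + ?y) = ?y / (1 + ?y)" using y0 by (simp add: field_simps)
  ultimately have pp: "?y / (1 + ?y) \<le> patch_prob N n" by simp
  have "?M * (?y / (1 + ?y)) \<le> ?M * patch_prob N n" using M pp by (intro mult_left_mono) auto
  moreover have "(?l + 1) / 2 * real n \<le> ?M * (?y / (1 + ?y))"
  proof -
    have e: "?M * (?y / (1 + ?y)) = ?l * real n / (1 + ?y)" using M by simp
    have "?y * (?l + 1) \<le> ?l - 1"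
      using small M by (simp add: field_simps)
    then have "(?l + 1) * (1 + ?y) \<le> 2 * ?l" by (simp add: algebra_simps)
    then have "(?l + 1) / 2 \<le> ?l / (1 + ?y)" using y0 by (simp add: field_simps)
    then have "(?l + 1) / 2 * real n \<le> ?l / (1 + ?y) * real n" by (intro mult_right_mono) auto
    then show ?thesis unfolding e by simp
  qed
  ultimately show ?thesis by linarith
qed

text \<open>Early on, the number of patched vertices outruns \<open>n\<close> by a fixed factor, so
  a stop at exactly \<open>n\<close> is geometrically unlikely, uniformly in \<open>N\<close>. This
  bridges bounded and linear times.\<close>

lemma prob_domain_small:
  assumes l: "1 < 2 * \<beta> 2"
  obtains \<delta> r where "0 < \<delta>" "\<delta> < 1" "0 < r" "r < 1"
    "\<forall>\<^sub>F N in sequentially. \<forall>n. 1 \<le> n \<and> n \<le> scaled \<delta> N \<longrightarrow>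
      measure_pmf.prob (law N) {(T, Z). n \<le> T \<and> T \<le> n} \<le> r ^ n"
proof -
  define l where "l = 2 * \<beta> 2"
  have l1: "1 < l" using assms by (simp add: l_def)
  \<comment> \<open>Guaranteed relative excess of patched vertices over \<open>n\<close>: half the
    drift \<open>l - 1\<close>.\<close>
  define \<kappa> where "\<kappa> = (l - 1) / 2"
  have k: "0 < \<kappa>" "1 + \<kappa> = (l + 1) / 2" using l1 by (auto simp: \<kappa>_def field_simps)
  \<comment> \<open>Chernoff exponent per step for the tilt
    \<open>1 / (1 + \<kappa>)\<close>.\<close>
  define c where "c = \<kappa> - ln (1 + \<kappa>)"
  have c: "0 < c" using ln_add_one_self_less_self[OF k(1)] by (simp add: c_def)
  \<comment> \<open>Makes the premise \<open>small\<close> hold for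
    \<open>n \<le> \<delta> * N\<close>: its left side is then at most
    \<open>(l - 1) * N / 2\<close>, which is at most \<open>(l - 1) * (N - 1)\<close> once
    \<open>N \<ge> 2\<close>.\<close>
  define \<delta> where "\<delta> = (l - 1) / (2 * (l * (l + 1)))"
  have d0: "0 < \<delta>" using l1 by (simp add: \<delta>_def)
  have "l - 1 < 2 * (l * (l + 1))"
  proof -
    have "0 < l * (l + 1)" "l * 1 \<le> l * (l + 1)" using l1 by auto
    then show ?thesis by linarith
  qed
  then have d1: "\<delta> < 1" using l1 by (simp add: \<delta>_def divide_less_eq)
  have ev: "\<forall>\<^sub>F N in sequentially. \<forall>n. 1 \<le> n \<and> n \<le> scaled \<delta> N \<longrightarrow>
      measure_pmf.prob (law N) {(T, Z). n \<le> T \<and> T \<le> n} \<le> exp (- c) ^ n"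
    using eventually_ge_at_top[of v0] eventually_ge_at_top[of 2] eventually_scaled_less[OF less_imp_le[OF d0] d1]
  proof eventually_elim
    case (elim N)
    show ?case
    proof (intro allI impI, elim conjE)
      fix n assume n: "1 \<le> n" "n \<le> scaled \<delta> N"
      have nN: "n \<le> N - 1" using n elim by simp
      have "real n \<le> \<delta> * real N" using n scaled_le[OF less_imp_le[OF d0], of N] by linarith
      then have "real n * (l * (l + 1)) \<le> \<delta> * real N * (l * (l + 1))" using l1 by (intro mult_right_mono) auto
      also have "\<dots> = (l - 1) * (real N / 2)"
      proof -
        have "l * (l + 1) \<noteq> 0" using l1 by auto
        then show ?thesis unfolding \<delta>_def by (simp only: times_divide_eq_left) simp
      qed
      also have "\<dots> \<le> (l - 1) * (real N - 1)" using l1 elim(2) by (intro mult_left_mono) auto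
      finally have "(2 * \<beta> 2 + 1) / 2 * real n \<le> (real N - 1) * patch_prob N n"
        using elim(2) nN assms unfolding l_def by (intro patch_prob_lower)
      then have low: "(1 + \<kappa>) * real n \<le> (real N - 1) * patch_prob N n"
        unfolding k(2) l_def .
      let ?t = "1 / (1 + \<kappa>)"
      have "measure_pmf.prob (law N) {(T, Z). n \<le> T \<and> T \<le> n} \<le>
          exp ((1 - real n) * ln ?t + (real N - 1) * patch_prob N n * (?t - 1))"
        using elim n nN k by (intro prob_domain_between) auto
      also have "\<dots> \<le> exp (real n * - c)"
      proof -
        have t: "?t - 1 = - (\<kappa> / (1 + \<kappa>))" "ln ?t = - ln (1 + \<kappa>)"
          using k by (auto simp: field_simps ln_div)
        have "(1 + \<kappa>) * real n * (\<kappa> / (1 + \<kappa>)) \<le> (real N - 1) * patch_prob N n * (\<kappa> / (1 + \<kappa>))"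
          by (rule mult_right_mono[OF low]) (use k in simp)
        moreover have "(1 + \<kappa>) * real n * (\<kappa> / (1 + \<kappa>)) = real n * \<kappa>" using k by simp
        moreover have "0 \<le> ln (1 + \<kappa>)" using k by simp
        ultimately show ?thesis unfolding t by (simp add: c_def algebra_simps)
      qed
      also have "\<dots> = exp (- c) ^ n" by (simp add: exp_of_nat_mult [symmetric])
      finally show "measure_pmf.prob (law N) {(T, Z). n \<le> T \<and> T \<le> n} \<le> exp (- c) ^ n" .
    qed
  qed
  show ?thesis by (rule that[OF d0 d1 _ _ ev]) (use c in auto)
qed


section \<open>The crossing point g\<close>

lemma g_Inf': "g = Inf {x \<in> {0..<1}. gen' x + ln (1 - x) < 0}"
  unfolding gen'_def by (rule g_Inf)

lemma crossing_nonempty: "{x \<in> {0..<1}. gen' x + ln (1 - x) < 0} \<noteq> {}"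
proof -
  define C where "C = (\<Sum>k. real k * \<beta> k)"
  have C0: "0 \<le> C" unfolding C_def by (intro suminf_nonneg deriv_summable) (simp add: \<beta>_nonneg)
  \<comment> \<open>Chosen so that \<open>ln (1 - x) = - (C + 1)\<close>, while
    \<open>gen' x \<le> C\<close>.\<close>
  define x where "x = 1 - exp (- (C + 1))"
  have x: "0 \<le> x" "x < 1" using C0 by (auto simp: x_def)
  have "gen' x \<le> C" unfolding gen'_def C_def using x
    by (intro suminf_le gen'_summable deriv_summable)
      (auto simp: \<beta>_nonneg intro!: mult_left_le power_le_one)
  moreover have "ln (1 - x) = - (C + 1)" unfolding x_def by simp
  ultimately have "gen' x + ln (1 - x) < 0" by simp
  then show ?thesis using x by auto
qed

lemma crossing_bdd_below: "bdd_below {x \<in> {0..<1}. gen' x + ln (1 - x) < 0}"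
  by (rule bdd_belowI[of _ 0]) auto

lemma g_less_1: "g < 1"
proof -
  obtain x where x: "x \<in> {x \<in> {0..<1}. gen' x + ln (1 - x) < 0}" using crossing_nonempty by blast
  then have "g \<le> x" unfolding g_Inf' by (intro cInf_lower crossing_bdd_below)
  then show ?thesis using x by auto
qed

text \<open>A point of the defining set satisfies \<open>2 * \<beta> 2 * x \<le> gen' x < - ln (1 -
  x) \<le> x / (1 - x)\<close>, hence \<open>x \<ge> 1 - 1 / (2 * \<beta> 2)\<close>.\<close>

lemma g_pos:
  assumes l: "1 < 2 * \<beta> 2"
  shows "0 < g"
proof -
  have "1 - 1 / (2 * \<beta> 2) \<le> g" unfolding g_Inf'
  proof (rule cInf_greatest[OF crossing_nonempty])
    fix x assume "x \<in> {x \<in> {0..<1}. gen' x + ln (1 - x) < 0}"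
    then have x: "0 \<le> x" "x < 1" "gen' x + ln (1 - x) < 0" by auto
    have x0: "x \<noteq> 0" using x gen'_ge[of x] by auto
    have "ln (1 / (1 - x)) \<le> 1 / (1 - x) - 1" using x by (intro ln_le_minus_one) auto
    then have "1 - 1 / (1 - x) \<le> ln (1 - x)" using x by (simp add: ln_div)
    moreover have "1 - 1 / (1 - x) = - (x / (1 - x))" using x by (simp add: field_simps)
    ultimately have "2 * \<beta> 2 * x < x / (1 - x)" using x gen'_ge[of x] by simp
    then have "x * (2 * \<beta> 2) < x * (1 / (1 - x))" by (simp add: mult_ac)
    then have "2 * \<beta> 2 < 1 / (1 - x)" using x x0 by (simp only: mult_less_cancel_left_pos)
    then have "2 * \<beta> 2 * (1 - x) < 1" using x by (simp add: field_simps)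
    then show "1 - 1 / (2 * \<beta> 2) \<le> x" using l by (simp add: field_simps)
  qed
  moreover have "0 < 1 - 1 / (2 * \<beta> 2)" using l by simp
  ultimately show ?thesis by linarith
qed

text \<open>By continuity, a negative value at \<open>g\<close> would contradict
  \<open>below_g\<close> just to the left, and a positive value would keep the defining set away
  from its infimum.\<close>

lemma gen'_g:
  assumes g: "0 < g"
  shows "gen' g + ln (1 - g) = 0"
proof -
  let ?F = "\<lambda>x. gen' x + ln (1 - x)"
  have "isCont ?F g" using g g_less_1 by (intro continuous_intros isCont_gen') auto
  then have lim: "(?F \<longlongrightarrow> ?F g) (nhds g)"
    using tendsto_at_iff_tendsto_nhds[of ?F g] by (simp add: isCont_def)
  have "\<not> ?F g < 0"
  proof
    assume "?F g < 0"
    then have "\<forall>\<^sub>F x in nhds g. ?F x < 0" by (rule order_tendstoD(2)[OF lim])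
    then obtain d where d: "0 < d" "\<And>x. dist x g < d \<Longrightarrow> ?F x < 0" by (auto simp: eventually_nhds_metric)
    let ?x = "g - min d g / 2"
    have "?F ?x < 0" using d g by (intro d(2)) (auto simp: dist_real_def)
    moreover have "0 < ?F ?x" using below_g[of ?x] d g unfolding gen'_def by auto
    ultimately show False by simp
  qed
  moreover have "\<not> 0 < ?F g"
  proof
    assume "0 < ?F g"
    then have "\<forall>\<^sub>F x in nhds g. 0 < ?F x" by (rule order_tendstoD(1)[OF lim])
    then obtain d where d: "0 < d" "\<And>x. dist x g < d \<Longrightarrow> 0 < ?F x" by (auto simp: eventually_nhds_metric)
    have "Inf {x \<in> {0..<1}. gen' x + ln (1 - x) < 0} < g + d" using d unfolding g_Inf'[symmetric] by simp
    then obtain x where x: "x \<in> {x \<in> {0..<1}. gen' x + ln (1 - x) < 0}" "x < g + d"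
      using cInf_lessD[OF crossing_nonempty] by blast
    then have "g \<le> x" unfolding g_Inf' by (intro cInf_lower crossing_bdd_below)
    then have "0 < ?F x" using x(2) d by (intro d(2)) (auto simp: dist_real_def)
    then show False using x by simp
  qed
  ultimately show ?thesis by linarith
qed

text \<open>The infimum is approached but, by \<open>gen'_g\<close>, not attained. The sign between
  \<open>g\<close> and the point found is unknown; one crossing is enough, since any larger domain
  has to pass that step of the collapse.\<close>

lemma crossing_above_g:
  assumes g: "0 < g" and d: "0 < d"
  obtains x where "g < x" "x < g + d" "x < 1" "hit_density x < x"
proof -
  have "Inf {x \<in> {0..<1}. gen' x + ln (1 - x) < 0} < g + d" using d unfolding g_Inf'[symmetric] by simp
  then obtain x where x: "x \<in> {x \<in> {0..<1}. gen' x + ln (1 - x) < 0}" "x < g + d"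
    using cInf_lessD[OF crossing_nonempty] by blast
  then have "g \<le> x" unfolding g_Inf' by (intro cInf_lower crossing_bdd_below)
  moreover have "x \<noteq> g" using x gen'_g[OF g] by auto
  ultimately have "g < x" by simp
  then show ?thesis using x by (intro that[of x]) (auto simp: lt_hit_density_iff)
qed

lemma edge_density_g:
  assumes "0 < g"
  shows "edge_density g = gen g - (1 - g) * ln (1 - g)"
proof -
  have "gen' g = - ln (1 - g)" using gen'_g[OF assms] by linarith
  then show ?thesis by (simp add: edge_density_def)
qed

text \<open>Union bound and the tail of a geometric series: \<open>K\<close> does not depend on
  \<open>N\<close>.\<close>

lemma prob_small_giant:
  assumes r: "0 < r" "r < 1" and e: "0 < (e::real)"
    and small: "\<forall>\<^sub>F N in sequentially. \<forall>n. 1 \<le> n \<and> n \<le> m N \<longrightarrow>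
      measure_pmf.prob (law N) {(T, Z). n \<le> T \<and> T \<le> n} \<le> r ^ n"
  obtains K where "\<forall>\<^sub>F N in sequentially. measure_pmf.prob (law N) {(T, Z). K < T \<and> T \<le> m N} \<le> e"
proof -
  have "summable (\<lambda>n. r ^ n)" using r by (intro summable_geometric) auto
  then obtain K where K: "\<And>a b. K \<le> a \<Longrightarrow> norm (sum (\<lambda>n. r ^ n) {a..<b}) < e"
    using e unfolding summable_Cauchy by blast
  have "\<forall>\<^sub>F N in sequentially. measure_pmf.prob (law N) {(T, Z). K < T \<and> T \<le> m N} \<le> e"
    using small
  proof eventually_elim
    case (elim N)
    have "measure_pmf.prob (law N) {(T, Z). K < T \<and> T \<le> m N} \<le>
      measure_pmf.prob (law N) (\<Union>n\<in>{Suc K..<Suc (m N)}. {(T, Z). n \<le> T \<and> T \<le> n})"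
      by (intro measure_pmf.finite_measure_mono) force+
    also have "\<dots> \<le> (\<Sum>n\<in>{Suc K..<Suc (m N)}. measure_pmf.prob (law N) {(T, Z). n \<le> T \<and> T \<le> n})"
      by (intro measure_pmf.finite_measure_subadditive_finite) auto
    also have "\<dots> \<le> (\<Sum>n\<in>{Suc K..<Suc (m N)}. r ^ n)"
      using elim by (intro sum_mono) auto
    also have "\<dots> \<le> norm (sum (\<lambda>n. r ^ n) {Suc K..<Suc (m N)})" by simp
    also have "\<dots> < e" by (rule K) simp
    finally show ?case by simp
  qed
  then show ?thesis by (rule that)
qed

text \<open>Beyond a constant, \<open>T\<close> is confined to times between \<open>x1 * N\<close>
  and \<open>x2 * N\<close> around \<open>g * N\<close>. The edge count is monotone along the
  collapse, so it lies between its values at these two times, and \<open>edge_density\<close> is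
  continuous at \<open>g\<close>.\<close>

lemma giant_concentration:
  assumes l: "1 < 2 * \<beta> 2" and \<rho>: "0 < \<rho>" and e: "0 < e"
  obtains K where "\<forall>\<^sub>F N in sequentially. measure_pmf.prob (law N)
      {(T, Z). K < T \<and> \<not> (\<bar>real T / real N - g\<bar> < \<rho> \<and> \<bar>real Z / real N - edge_density g\<bar> < \<rho>)} \<le> e"
proof -
  note g0 = g_pos[OF l] and g1 = g_less_1
  let ?z = "edge_density g"
  have lim: "(edge_density \<longlongrightarrow> ?z) (nhds g)"
    using isCont_edge_density[OF g0 g1] by (simp add: isCont_def tendsto_at_iff_tendsto_nhds)
  have "\<forall>\<^sub>F x in nhds g. \<bar>edge_density x - ?z\<bar> < \<rho>"
    using tendstoD[OF lim \<rho>] by (simp add: dist_real_def)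
  then obtain d where d: "0 < d" "\<And>x. dist x g < d \<Longrightarrow> \<bar>edge_density x - ?z\<bar> < \<rho>"
    by (auto simp: eventually_nhds_metric)
  define x1 where "x1 = g - min (min d \<rho>) g / 2"
  have x1: "0 < x1" "x1 < g" "g - \<rho> < x1" "\<bar>edge_density x1 - ?z\<bar> < \<rho>"
    using d g0 \<rho> by (auto simp: x1_def dist_real_def)
  obtain x2 where x2': "g < x2" "x2 < g + min d \<rho>" "x2 < 1" "hit_density x2 < x2"
    using crossing_above_g[OF g0, of "min d \<rho>"] d \<rho> by auto
  then have x2: "0 < x2" "x2 < g + \<rho>" "\<bar>edge_density x2 - ?z\<bar> < \<rho>"
    using g0 d by (auto simp: dist_real_def)
  have ed: "0 < edge_density x1" "0 < edge_density x2" "0 < ?z"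
    using x1 x2 x2' g0 g1 by (auto intro!: edge_density_pos)
  \<comment> \<open>A threshold strictly between \<open>?z - \<rho>\<close> and
    \<open>edge_density x1\<close>; the \<open>max\<close> with 0 keeps it positive for the Chernoff
    bound.\<close>
  define \<zeta>1 where "\<zeta>1 = (max (?z - \<rho>) 0 + edge_density x1) / 2"
  have z1: "0 < \<zeta>1" "\<zeta>1 < edge_density x1" "?z - \<rho> < \<zeta>1"
    using ed x1(4) by (auto simp: \<zeta>1_def)
  define \<zeta>2 where "\<zeta>2 = (?z + \<rho> + edge_density x2) / 2"
  have z2: "edge_density x2 < \<zeta>2" "\<zeta>2 < ?z + \<rho>" "0 < \<zeta>2"
    using ed x2(3) by (auto simp: \<zeta>2_def)
  obtain \<delta> r where \<delta>: "0 < \<delta>" "\<delta> < 1" "0 < r" "r < 1"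
    "\<forall>\<^sub>F N in sequentially. \<forall>n. 1 \<le> n \<and> n \<le> scaled \<delta> N \<longrightarrow>
      measure_pmf.prob (law N) {(T, Z). n \<le> T \<and> T \<le> n} \<le> r ^ n"
    by (rule prob_domain_small[OF l])
  \<comment> \<open>At most \<delta> for the early phase and at most \<open>x1\<close> for the fluid
    gap, so that the two ranges meet.\<close>
  define u where "u = min \<delta> x1"
  have u: "0 < u" "u \<le> x1" "u \<le> \<delta>" using \<delta> x1 by (auto simp: u_def)
  have us: "scaled u N \<le> scaled \<delta> N" for N
    unfolding scaled_def using u by (intro nat_mono floor_mono mult_right_mono) auto
  have small: "\<forall>\<^sub>F N in sequentially. \<forall>n. 1 \<le> n \<and> n \<le> scaled u N \<longrightarrow>
      measure_pmf.prob (law N) {(T, Z). n \<le> T \<and> T \<le> n} \<le> r ^ n"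
    using \<delta>(5)
  proof eventually_elim
    case (elim N)
    then show ?case using us[of N] by (meson order_trans)
  qed
  obtain K where K: "\<forall>\<^sub>F N in sequentially. measure_pmf.prob (law N) {(T, Z). K < T \<and> T \<le> scaled u N} \<le> e / 2"
    by (rule prob_small_giant[OF \<delta>(3,4) half_gt_zero[OF e] small])
  let ?A2 = "\<lambda>N. {(T, Z :: nat). scaled u N \<le> T \<and> T \<le> scaled x1 N}"
  let ?A3 = "\<lambda>N. {(T, Z :: nat). scaled x2 N \<le> T}"
  let ?A4 = "\<lambda>N. {(T, Z). scaled x1 N \<le> T \<and> Z \<le> scaled \<zeta>1 N}"
  let ?A5 = "\<lambda>N. {(T, Z). T \<le> scaled x2 N \<and> scaled \<zeta>2 N \<le> Z}"
  let ?p = "\<lambda>N. measure_pmf.prob (law N) (?A2 N) + measure_pmf.prob (law N) (?A3 N)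
    + measure_pmf.prob (law N) (?A4 N) + measure_pmf.prob (law N) (?A5 N)"
  have "?p \<longlonglongrightarrow> 0 + 0 + 0 + 0"
    using u x1 x2 x2' z1 z2 g1
    by (intro tendsto_add prob_domain_gap_limit prob_domain_ge_limit prob_edges_le_limit prob_edges_ge_limit) auto
  then have "\<forall>\<^sub>F N in sequentially. ?p N < e / 2" using e by (intro order_tendstoD(2)) auto
  then have "\<forall>\<^sub>F N in sequentially. measure_pmf.prob (law N)
      {(T, Z). K < T \<and> \<not> (\<bar>real T / real N - g\<bar> < \<rho> \<and> \<bar>real Z / real N - ?z\<bar> < \<rho>)} \<le> e"
    using K eventually_gt_at_top[of 0]
  proof eventually_elim
    case (elim N)
    let ?A1 = "{(T, Z :: nat). K < T \<and> T \<le> scaled u N}"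
    let ?B = "{(T, Z). K < T \<and> \<not> (\<bar>real T / real N - g\<bar> < \<rho> \<and> \<bar>real Z / real N - ?z\<bar> < \<rho>)}"
    have N: "0 < real N" using elim(3) by simp
    have "?B \<subseteq> ?A1 \<union> (?A2 N \<union> (?A3 N \<union> (?A4 N \<union> ?A5 N)))"
    proof (rule subsetI, rule ccontr)
      fix p assume p: "p \<in> ?B" "p \<notin> ?A1 \<union> (?A2 N \<union> (?A3 N \<union> (?A4 N \<union> ?A5 N)))"
      obtain T Z where TZ: "p = (T, Z)" by fastforce
      have T: "scaled x1 N < T" "T < scaled x2 N" and Z: "scaled \<zeta>1 N < Z" "Z < scaled \<zeta>2 N"
        using p unfolding TZ by auto
      have "x1 * real N < real T" using scaled_gt[of x1 N] T(1) by linarith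
      moreover have "real T < x2 * real N" using scaled_le[of x2 N] T(2) x2 by linarith
      moreover have "\<zeta>1 * real N < real Z" using scaled_gt[of \<zeta>1 N] Z(1) by linarith
      moreover have "real Z < \<zeta>2 * real N" using scaled_le[of \<zeta>2 N] Z(2) z2 by linarith
      ultimately have "x1 < real T / real N" "real T / real N < x2" "\<zeta>1 < real Z / real N" "real Z / real N < \<zeta>2"
        using N by (auto simp: pos_less_divide_eq pos_divide_less_eq)
      then have "\<bar>real T / real N - g\<bar> < \<rho>" "\<bar>real Z / real N - ?z\<bar> < \<rho>"
        using x1 x2 z1 z2 by linarith+
      then show False using p(1) unfolding TZ by simp
    qed
    then have "measure_pmf.prob (law N) ?B \<le>
        measure_pmf.prob (law N) (?A1 \<union> (?A2 N \<union> (?A3 N \<union> (?A4 N \<union> ?A5 N))))"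
      by (intro measure_pmf.finite_measure_mono) auto
    also have "\<dots> \<le> measure_pmf.prob (law N) ?A1 + (measure_pmf.prob (law N) (?A2 N) +
        (measure_pmf.prob (law N) (?A3 N) + (measure_pmf.prob (law N) (?A4 N) + measure_pmf.prob (law N) (?A5 N))))"
      by (rule order_trans[OF measure_Un_le], simp, simp, rule add_left_mono)+ (rule order_refl)
    also have "\<dots> \<le> e" using elim(1,2) by linarith
    finally show ?case .
  qed
  then show ?thesis by (rule that)
qed

text \<open>The limits of the probabilities of \<open>T = n\<close> already sum to 1 here, so no
  mass can escape to large domains.\<close>

lemma domain_law_tail_subcritical:
  assumes l: "2 * \<beta> 2 \<le> 1" and e: "0 < e"
  obtains K where "\<forall>\<^sub>F N in sequentially. measure_pmf.prob (law N) {(T, Z). K < T} \<le> e"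
proof -
  let ?h = "\<lambda>n. hit_prob (2 * \<beta> 2) n 1"
  have "(\<lambda>K. \<Sum>n<K. ?h n) \<longlonglongrightarrow> (\<Sum>n. ?h n)" by (rule summable_LIMSEQ[OF hit_prob_summable])
  then have "(\<lambda>K. \<Sum>n<K. ?h n) \<longlonglongrightarrow> 1" using hit_prob_sum_eq_1[of "2 * \<beta> 2"] \<beta>2 l by simp
  then have "\<forall>\<^sub>F K in sequentially. 1 - e < (\<Sum>n<K. ?h n)" using e by (intro order_tendstoD(1)) auto
  then obtain K where K: "1 - e < (\<Sum>n<K. ?h n)" by (auto simp: eventually_sequentially)
  have "(\<lambda>N. \<Sum>n<K. measure_pmf.prob (law N) {(T, Z). T = n}) \<longlonglongrightarrow> (\<Sum>n<K. ?h n)"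
    by (intro tendsto_sum domain_law_local_limit)
  then have "\<forall>\<^sub>F N in sequentially. 1 - e < (\<Sum>n<K. measure_pmf.prob (law N) {(T, Z). T = n})"
    using K by (intro order_tendstoD(1)) auto
  then have "\<forall>\<^sub>F N in sequentially. measure_pmf.prob (law N) {(T, Z). K < T} \<le> e"
  proof eventually_elim
    case (elim N)
    have "(\<Sum>n<K. measure_pmf.prob (law N) {(T, Z). T = n}) = measure_pmf.prob (law N) (\<Union>n<K. {(T, Z). T = n})"
      by (rule measure_pmf.finite_measure_finite_Union[symmetric]) (auto simp: disjoint_family_on_def)
    also have "(\<Union>n<K. {(T, Z :: nat). T = n}) = UNIV - {(T, Z). K \<le> T}" by auto
    also have "measure_pmf.prob (law N) \<dots> = 1 - measure_pmf.prob (law N) {(T, Z). K \<le> T}"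
      using measure_pmf.prob_compl[of "{(T, Z). K \<le> T}" "law N"] by simp
    finally have "measure_pmf.prob (law N) {(T, Z). K \<le> T} \<le> e" using elim by linarith
    moreover have "measure_pmf.prob (law N) {(T, Z). K < T} \<le> measure_pmf.prob (law N) {(T, Z). K \<le> T}"
      by (intro measure_pmf.finite_measure_mono) auto
    ultimately show ?case by linarith
  qed
  then show ?thesis by (rule that)
qed

section \<open>Convergence of expectations in both scalings\<close>

text \<open>Because \<open>T \<le> Z\<close>, a large \<open>T\<close> puts both coordinates near
  \<infinity> in the compactification, so continuity of \<open>f\<close> at
  \<open>(\<infinity>, \<infinity>)\<close> supplies the tail condition.\<close>

lemma expectation_enat_limit:
  fixes f :: "enat \<times> enat \<Rightarrow> real"
  assumes cont: "continuous_on UNIV f" and B: "\<And>x. \<bar>f x\<bar> \<le> B"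
  shows "(\<lambda>N. measure_pmf.expectation (law N) (\<lambda>(T, Z). f (enat T, enat Z)))
    \<longlonglongrightarrow> (\<integral>\<omega>. f (rw_hitting_time \<omega>, rw_hitting_time \<omega>) \<partial>iid_poisson_space (2 * \<beta> 2))"
proof -
  let ?h = "\<lambda>n. hit_prob (2 * \<beta> 2) n 1"
  have tail: "\<exists>K. \<forall>\<^sub>F N in sequentially. measure_pmf.prob (law N)
      {(T, Z). K < T \<and> e < \<bar>(\<lambda>(T, Z). f (enat T, enat Z)) (T, Z) - f (\<infinity>, \<infinity>)\<bar>} \<le> e" if e: "0 < e" for e
  proof -
    have "isCont f (\<infinity>, \<infinity>)" using cont by (simp add: continuous_on_eq_continuous_at)
    then have "(f \<longlongrightarrow> f (\<infinity>, \<infinity>)) (nhds (\<infinity>, \<infinity>))" by (simp add: isCont_def tendsto_at_iff_tendsto_nhds)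
    then have "\<forall>\<^sub>F x in nhds (\<infinity>, \<infinity>). dist (f x) (f (\<infinity>, \<infinity>)) < e" using e by (rule tendstoD)
    then obtain S where S: "open S" "(\<infinity>, \<infinity>) \<in> S" "\<And>x. x \<in> S \<Longrightarrow> dist (f x) (f (\<infinity>, \<infinity>)) < e"
      by (auto simp: eventually_nhds)
    obtain U V where UV: "open U" "open V" "\<infinity> \<in> U" "\<infinity> \<in> V" "U \<times> V \<subseteq> S"
      using S(1,2) by (auto elim: open_prod_elim)
    obtain a b :: nat where ab: "{enat a<..} \<subseteq> U" "{enat b<..} \<subseteq> V"
      using UV by (auto simp: open_enat_iff)
    have "\<forall>\<^sub>F N in sequentially. measure_pmf.prob (law N)
        {(T, Z). max a b < T \<and> e < \<bar>(\<lambda>(T, Z). f (enat T, enat Z)) (T, Z) - f (\<infinity>, \<infinity>)\<bar>} \<le> e"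
      using eventually_ge_at_top[of v0]
    proof eventually_elim
      case (elim N)
      have "emeasure (law N) {(T, Z). max a b < T \<and> e < \<bar>(\<lambda>(T, Z). f (enat T, enat Z)) (T, Z) - f (\<infinity>, \<infinity>)\<bar>} = 0"
      proof (rule emeasure_pmf_zero)
        fix p assume p: "p \<in> set_pmf (law N)"
        obtain T Z where TZ: "p = (T, Z)" by fastforce
        have le: "T \<le> Z" using set_domain_law(2)[OF elim] p unfolding TZ by simp
        have "\<bar>f (enat T, enat Z) - f (\<infinity>, \<infinity>)\<bar> < e" if "max a b < T"
        proof -
          have "enat T \<in> U" "enat Z \<in> V" using ab that le by auto
          then show ?thesis using UV(5) S(3)[of "(enat T, enat Z)"] by (auto simp: dist_real_def)
        qed
        then show "p \<notin> {(T, Z). max a b < T \<and> e < \<bar>(\<lambda>(T, Z). f (enat T, enat Z)) (T, Z) - f (\<infinity>, \<infinity>)\<bar>}"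
          unfolding TZ by fastforce
      qed
      then show ?case using e by (simp add: measure_pmf.emeasure_eq_measure)
    qed
    then show ?thesis by blast
  qed
  have "(\<lambda>N. measure_pmf.expectation (law N) (\<lambda>(T, Z). f (enat T, enat Z)))
    \<longlonglongrightarrow> (\<Sum>n. ?h n * f (enat n, enat n)) + (1 - suminf ?h) * f (\<infinity>, \<infinity>)"
    by (rule expectation_two_point_limit[where F = "\<lambda>_ (T, Z). f (enat T, enat Z)" and B = B and h = ?h])
      (use B tail domain_law_local_limit hit_prob_summable in \<open>auto split: prod.splits\<close>)
  then show ?thesis
    using integral_rw_hitting_time[of "\<lambda>m. f (m, m)" B "2 * \<beta> 2"] B by simp
qed

lemma expectation_scaled_limit:
  fixes f :: "real \<times> real \<Rightarrow> real"
  assumes cont: "continuous_on UNIV f" and B: "\<And>x. \<bar>f x\<bar> \<le> B"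
  shows "(\<lambda>N. measure_pmf.expectation (law N) (\<lambda>(T, Z). f (real T / real N, real Z / real N)))
    \<longlonglongrightarrow> (\<integral>\<omega>. f (if rw_hitting_time \<omega> = \<infinity> then g else 0,
        if rw_hitting_time \<omega> = \<infinity> then gen g - (1 - g) * ln (1 - g) else 0) \<partial>iid_poisson_space (2 * \<beta> 2))"
proof -
  let ?h = "\<lambda>n. hit_prob (2 * \<beta> 2) n 1"
  define b where "b = f (g, gen g - (1 - g) * ln (1 - g))"
  let ?F = "\<lambda>N (T, Z). f (real T / real N, real Z / real N)"
  have contx: "isCont f x" for x using cont by (metis UNIV_I continuous_on_eq_continuous_at open_UNIV)
  have a: "(\<lambda>N. ?F N (n, n)) \<longlonglongrightarrow> f (0, 0)" for n
  proof -
    have "(\<lambda>N. (real n / real N, real n / real N)) \<longlonglongrightarrow> (0, 0)"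
      by (intro tendsto_Pair lim_const_over_n)
    then show ?thesis using isCont_tendsto_compose[OF contx] by simp
  qed
  have tail: "\<exists>K. \<forall>\<^sub>F N in sequentially. measure_pmf.prob (law N)
      {(T, Z). K < T \<and> e < \<bar>?F N (T, Z) - b\<bar>} \<le> e" if e: "0 < e" for e
  \<comment> \<open>Without positive drift the tail condition holds whatever \<open>b\<close> is,
    since large \<open>T\<close> is itself unlikely; otherwise large \<open>T\<close> means
    concentration at \<open>g\<close>.\<close>
  proof (cases "1 < 2 * \<beta> 2")
    case False
    then have "2 * \<beta> 2 \<le> 1" by simp
    from domain_law_tail_subcritical[OF this e]
    obtain K where "\<forall>\<^sub>F N in sequentially. measure_pmf.prob (law N) {(T, Z). K < T} \<le> e" .
    then have "\<forall>\<^sub>F N in sequentially. measure_pmf.prob (law N) {(T, Z). K < T \<and> e < \<bar>?F N (T, Z) - b\<bar>} \<le> e"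
    proof eventually_elim
      case (elim N)
      have "measure_pmf.prob (law N) {(T, Z). K < T \<and> e < \<bar>?F N (T, Z) - b\<bar>} \<le> measure_pmf.prob (law N) {(T, Z). K < T}"
        by (intro measure_pmf.finite_measure_mono) auto
      then show ?case using elim by linarith
    qed
    then show ?thesis by blast
  next
    case True
    have b: "b = f (g, edge_density g)" using edge_density_g[OF g_pos[OF True]] by (simp add: b_def)
    obtain d where d: "0 < d" "\<And>x. dist x (g, edge_density g) < d \<Longrightarrow> dist (f x) b < e"
      using contx[of "(g, edge_density g)"] e unfolding b continuous_at_eps_delta by metis
    obtain K where "\<forall>\<^sub>F N in sequentially. measure_pmf.prob (law N)
      {(T, Z). K < T \<and> \<not> (\<bar>real T / real N - g\<bar> < d / 2 \<and> \<bar>real Z / real N - edge_density g\<bar> < d / 2)} \<le> e"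
      by (rule giant_concentration[OF True half_gt_zero[OF d(1)] e])
    then have "\<forall>\<^sub>F N in sequentially. measure_pmf.prob (law N) {(T, Z). K < T \<and> e < \<bar>?F N (T, Z) - b\<bar>} \<le> e"
    proof eventually_elim
      case (elim N)
      have "{(T, Z). K < T \<and> e < \<bar>?F N (T, Z) - b\<bar>} \<subseteq>
        {(T, Z). K < T \<and> \<not> (\<bar>real T / real N - g\<bar> < d / 2 \<and> \<bar>real Z / real N - edge_density g\<bar> < d / 2)}"
      proof (rule subsetI, rule ccontr)
        fix p assume p: "p \<in> {(T, Z). K < T \<and> e < \<bar>?F N (T, Z) - b\<bar>}"
          "p \<notin> {(T, Z). K < T \<and> \<not> (\<bar>real T / real N - g\<bar> < d / 2 \<and> \<bar>real Z / real N - edge_density g\<bar> < d / 2)}"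
        obtain T Z where TZ: "p = (T, Z)" by fastforce
        have h: "e < \<bar>f (real T / real N, real Z / real N) - b\<bar>"
          "\<bar>real T / real N - g\<bar> < d / 2" "\<bar>real Z / real N - edge_density g\<bar> < d / 2"
          using p unfolding TZ by auto
        have "dist (real T / real N, real Z / real N) (g, edge_density g) < d"
          using h(2,3) sqrt_sum_squares_le_sum_abs[of "real T / real N - g" "real Z / real N - edge_density g"]
          by (simp add: dist_Pair_Pair dist_real_def)
        then have "dist (f (real T / real N, real Z / real N)) b < e" by (rule d(2))
        then show False using h(1) by (simp add: dist_real_def)
      qed
      then have "measure_pmf.prob (law N) {(T, Z). K < T \<and> e < \<bar>?F N (T, Z) - b\<bar>} \<le> measure_pmf.prob (law N)
          {(T, Z). K < T \<and> \<not> (\<bar>real T / real N - g\<bar> < d / 2 \<and> \<bar>real Z / real N - edge_density g\<bar> < d / 2)}"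
        by (intro measure_pmf.finite_measure_mono) auto
      then show ?case using elim by linarith
    qed
    then show ?thesis by blast
  qed
  have "(\<lambda>N. measure_pmf.expectation (law N) (?F N)) \<longlonglongrightarrow> (\<Sum>n. ?h n * f (0, 0)) + (1 - suminf ?h) * b"
    by (rule expectation_two_point_limit[where B = B and h = ?h])
      (use B a tail domain_law_local_limit hit_prob_summable in \<open>auto simp: b_def split: prod.splits\<close>)
  moreover have "(\<integral>\<omega>. f (if rw_hitting_time \<omega> = \<infinity> then g else 0,
        if rw_hitting_time \<omega> = \<infinity> then gen g - (1 - g) * ln (1 - g) else 0) \<partial>iid_poisson_space (2 * \<beta> 2))
     = (\<Sum>n. ?h n * f (0, 0)) + (1 - suminf ?h) * b"
    using integral_rw_hitting_time[of "\<lambda>m. f (if m = \<infinity> then g else 0, if m = \<infinity> then gen g - (1 - g) * ln (1 - g) else 0)" B "2 * \<beta> 2"] B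
    by (simp add: b_def)
  ultimately show ?thesis by simp
qed

end

lemma function_of_rw_hitting_time_measurable:
  "(\<lambda>\<omega>. G (rw_hitting_time \<omega>)) \<in> borel_measurable (iid_poisson_space l)"
  by (rule measurable_compose[OF rw_hitting_time_measurable]) simp

theorem theorem6p2:
  fixes \<beta> :: "nat \<Rightarrow> real" and v0 :: nat and g :: real
  assumes nonneg: "\<forall>k. 0 \<le> \<beta> k"
    and b0: "\<beta> 0 = 0" and b1: "\<beta> 1 = 0" and b2: "0 < \<beta> 2"
    and deriv_fin: "summable (\<lambda>k. real k * \<beta> k)"
    and g_def: "g = Inf {x \<in> {0..<1}. (\<Sum>k. real k * \<beta> k * x ^ (k - 1)) + ln (1 - x) < 0}"
    and pos_below_g: "\<forall>x. 0 < x \<and> x < g \<longrightarrow> (\<Sum>k. real k * \<beta> k * x ^ (k - 1)) + ln (1 - x) > 0"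
    and v0: "1 \<le> v0"
  shows
    "conv_in_distribution
       (\<lambda>N. distr (measure_pmf (poisson_hypergraph \<beta> N)) borel
              (\<lambda>Lam. (enat (card (domain_of {1..N} Lam v0)),
                      enat (identifiable_from {1..N} Lam v0))))
       (distr (iid_poisson_space (2 * \<beta> 2)) borel
              (\<lambda>\<omega>. (rw_hitting_time \<omega>, rw_hitting_time \<omega>)))
   \<and> conv_in_distribution
       (\<lambda>N. distr (measure_pmf (poisson_hypergraph \<beta> N)) borel
              (\<lambda>Lam. (real (card (domain_of {1..N} Lam v0)) / real N,
                      real (identifiable_from {1..N} Lam v0) / real N)))
       (distr (iid_poisson_space (2 * \<beta> 2)) borel
              (\<lambda>\<omega>. (if rw_hitting_time \<omega> = \<infinity> then g else 0,
                     if rw_hitting_time \<omega> = \<infinity>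
                     then (\<Sum>k. \<beta> k * g ^ k) - (1 - g) * ln (1 - g) else 0)))"
proof -
  interpret collapse_parameters \<beta> v0 g
    using assms by unfold_locales auto
  let ?HG = "\<lambda>N. measure_pmf (poisson_hypergraph \<beta> N)"
  let ?S = "iid_poisson_space (2 * \<beta> 2)"
  \<comment> \<open>Both test functions see the hypergraph only through the pair with law
    \<open>domain_law\<close>.\<close>
  have law: "measure_pmf.expectation (poisson_hypergraph \<beta> N)
      (\<lambda>Lam. H (card (domain_of {1..N} Lam v0)) (identifiable_from {1..N} Lam v0)) =
    measure_pmf.expectation (law N) (\<lambda>(T, Z). H T Z)" for N and H :: "nat \<Rightarrow> nat \<Rightarrow> real"
    by (simp add: domain_law_def)
  show ?thesis
    unfolding conv_in_distribution_def
  proof (intro conjI allI impI)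
    fix f :: "enat \<times> enat \<Rightarrow> real"
    assume f: "continuous_on UNIV f" "bounded (range f)"
    obtain B where B: "\<And>x. \<bar>f x\<bar> \<le> B" using f(2) by (auto simp: bounded_iff)
    have fm: "f \<in> borel_measurable borel" using f(1) by (rule borel_measurable_continuous_onI)
    show "(\<lambda>N. \<integral>x. f x \<partial>distr (?HG N) borel
            (\<lambda>Lam. (enat (card (domain_of {1..N} Lam v0)), enat (identifiable_from {1..N} Lam v0))))
       \<longlonglongrightarrow> (\<integral>x. f x \<partial>distr ?S borel (\<lambda>\<omega>. (rw_hitting_time \<omega>, rw_hitting_time \<omega>)))"
      using expectation_enat_limit[OF f(1) B]
      by (simp only: integral_distr[OF _ fm] integral_distr[OF function_of_rw_hitting_time_measurable[where G = "\<lambda>m. (m, m)"] fm]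
          law[of _ "\<lambda>T Z. f (enat T, enat Z)"] measurable_pmf_measure1 space_borel UNIV_I Pi_UNIV)
  next
    fix f :: "real \<times> real \<Rightarrow> real"
    assume f: "continuous_on UNIV f" "bounded (range f)"
    obtain B where B: "\<And>x. \<bar>f x\<bar> \<le> B" using f(2) by (auto simp: bounded_iff)
    have fm: "f \<in> borel_measurable borel" using f(1) by (rule borel_measurable_continuous_onI)
    have "(\<lambda>N. \<integral>x. f x \<partial>distr (?HG N) borel
            (\<lambda>Lam. (real (card (domain_of {1..N} Lam v0)) / real N, real (identifiable_from {1..N} Lam v0) / real N)))
      = (\<lambda>N. measure_pmf.expectation (law N) (\<lambda>(T, Z). f (real T / real N, real Z / real N)))"
    proof
      fix N
      show "(\<integral>x. f x \<partial>distr (?HG N) borel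
            (\<lambda>Lam. (real (card (domain_of {1..N} Lam v0)) / real N, real (identifiable_from {1..N} Lam v0) / real N)))
        = measure_pmf.expectation (law N) (\<lambda>(T, Z). f (real T / real N, real Z / real N))"
        by (simp only: integral_distr[OF _ fm] law[of _ "\<lambda>T Z. f (real T / real N, real Z / real N)"]
            measurable_pmf_measure1 space_borel UNIV_I Pi_UNIV)
    qed
    moreover have "(\<integral>x. f x \<partial>distr ?S borel
              (\<lambda>\<omega>. (if rw_hitting_time \<omega> = \<infinity> then g else 0,
                     if rw_hitting_time \<omega> = \<infinity> then (\<Sum>k. \<beta> k * g ^ k) - (1 - g) * ln (1 - g) else 0)))
      = (\<integral>\<omega>. f (if rw_hitting_time \<omega> = \<infinity> then g else 0,
        if rw_hitting_time \<omega> = \<infinity> then gen g - (1 - g) * ln (1 - g) else 0) \<partial>?S)"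
      unfolding gen_def
      by (rule integral_distr[OF function_of_rw_hitting_time_measurable[where G = "\<lambda>m. (if m = \<infinity> then g else 0,
        if m = \<infinity> then (\<Sum>k. \<beta> k * g ^ k) - (1 - g) * ln (1 - g) else 0)"] fm])
    ultimately show "(\<lambda>N. \<integral>x. f x \<partial>distr (?HG N) borel
            (\<lambda>Lam. (real (card (domain_of {1..N} Lam v0)) / real N, real (identifiable_from {1..N} Lam v0) / real N)))
       \<longlonglongrightarrow> (\<integral>x. f x \<partial>distr ?S borel
              (\<lambda>\<omega>. (if rw_hitting_time \<omega> = \<infinity> then g else 0,
                     if rw_hitting_time \<omega> = \<infinity> then (\<Sum>k. \<beta> k * g ^ k) - (1 - g) * ln (1 - g) else 0)))"
      using expectation_scaled_limit[OF f(1) B] by simp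
  qed
qed

end
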